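(* Let $m\ge n$ and let the $m\times n$ quaternion matrix $\mathbf A$ have quaternion singular value decomposition $$\mathbf A=\mathbf U\Sigma\mathbf V^*=\mathbf U\begin{bmatrix}\Sigma_1&0\\0&\Sigma_2\end{bmatrix}\begin{bmatrix}\mathbf V_1^*\\ \mathbf V_2^*\end{bmatrix},\qquad \Sigma_1\in\mathbb R^{k\times k},\quad \mathbf V_1\in\mathbb Q^{n\times k},$$ where $\Sigma=\mathrm{diag}(\sigma_1,\ldots,\sigma_n)$ with $\sigma_1\ge\sigma_2\ge\cdots\ge\sigma_n\ge 0$ and $k\ge 1$ is the target rank. Let $p\ge 1$, $\ell=k+p\le n$, let $\mathbf\Omega$ be an $n\times\ell$ quaternion random test matrix, and assume $\mathbf\Omega_1=\mathbf V_1^*\mathbf\Omega$ has full row rank. Then the expected spectral norm of the approximation error of the power-scheme-free ($q=0$) randomized QSVD algorithm satisfies $$\mathsf E\,\|\widehat{\mathbf A}^{(0)}_{k+p}-\mathbf A\|_2\le\left(1+3\sqrt{\frac{k}{4p+2}}\right)\sigma_{k+1}+\frac{3\mathrm e\sqrt{4k+4p+2}}{2p+2}\Big(\sum_{j>k}\sigma_j^2\Big)^{1/2}.$$ If $q>0$ and the power scheme is used, then for the rank-$(k+p)$ matrix $\widehat{\mathbf A}^{(q)}_{k+p}$ the spectral error satisfies $$\mathsf E\,\|\widehat{\mathbf A}^{(q)}_{k+p}-\mathbf A\|_2\le\left[\left(1+3\sqrt{\frac{k}{4p+2}}\right)\sigma_{k+1}^{2q+1}+\frac{3\mathrm e\s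qrt{4k+4p+2}}{2p+2}\Big(\sum_{j>k}\sigma_j^{2(2q+1)}\Big)^{1/2}\right]^{1/(2q+1)}.$$
   Context: $\mathbb Q$ denotes the real quaternions and $\mathbb Q^{m\times n}$ the $m\times n$ quaternion matrices; $\mathbf M^*$ is the conjugate transpose. Every $\mathbf A\in\mathbb Q^{m\times n}$ has a QSVD $\mathbf A=\mathbf U\Sigma\mathbf V^*$ with $\mathbf U\in\mathbb Q^{m\times m}$, $\mathbf V\in\mathbb Q^{n\times n}$ quaternion unitary and $\Sigma\in\mathbb R^{m\times n}$ diagonal with nonnegative nonincreasing diagonal entries (the singular values); for $m\ge n$ the notation $\Sigma=\mathrm{diag}(\sigma_1,\dots,\sigma_n)$ means this $m\times n$ matrix. $\|\mathbf M\|_2$ is the largest singular value of $\mathbf M$. $\mathrm e$ is the base of the natural logarithm. Quaternion random test matrix: $\mathbf\Omega=\Omega_0+\Omega_1\mathbf i+\Omega_2\mathbf j+\Omega_3\mathbf k\in\mathbb Q^{n\times\ell}$, where all entries of the four real $n\times \ell$ component matrices are independent $N(0,1)$ random variables. (These real component matrices are not to be confused with the quaternion matrix $\mathbf\Omega_1=\mathbf V_1^*\mathbf\Omega\in\mathbb Q^{k\times\ell}$.) Randomized QSVD algorithm (power scheme parameter $q$, a nonnegative integer): form $\mathbf Y_q=(\mathbf A\mathbf A^* )^q\mathbf A\mathbf\Omega$ (for $q=0$, $\mathbf Y_0=\mathbf A\mathbf\Omega$); compute by quaternion QR decomposition of $\mathbf Y_q$ an $m\times\ell$ matrix $\mathbf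 Q$ with orthonormal columns whose range contains the column range of $\mathbf Y_q$ (an orthonormal basis for that range). The rank-$(k+p)$ approximation is $\widehat{\mathbf A}^{(q)}_{k+p}=\mathbf Q\mathbf Q^*\mathbf A$, so $\|\widehat{\mathbf A}^{(q)}_{k+p}-\mathbf A\|=\|(I_m-\mathbf Q\mathbf Q^* )\mathbf A\|$. $\mathsf E$ is expectation with respect to $\mathbf\Omega$. *)

theory Defs
  imports "HOL-Probability.Probability" "Jordan_Normal_Form.Matrix"
begin

text \<open>The skew field of real quaternions, \<open>Quat a b c d\<close> standing for \<open>a + b i + c j + d k\<close>.\<close>

datatype quat = Quat (qre: real) (qim1: real) (qim2: real) (qim3: real)

instantiation quat :: ring_1
begin

definition zero_quat :: quat where "0 = Quat 0 0 0 0"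
definition one_quat :: quat where "1 = Quat 1 0 0 0"
definition plus_quat :: "quat \<Rightarrow> quat \<Rightarrow> quat" where
  "x + y = Quat (qre x + qre y) (qim1 x + qim1 y) (qim2 x + qim2 y) (qim3 x + qim3 y)"
definition minus_quat :: "quat \<Rightarrow> quat \<Rightarrow> quat" where
  "x - y = Quat (qre x - qre y) (qim1 x - qim1 y) (qim2 x - qim2 y) (qim3 x - qim3 y)"
definition uminus_quat :: "quat \<Rightarrow> quat" where
  "- x = Quat (- qre x) (- qim1 x) (- qim2 x) (- qim3 x)"
definition times_quat :: "quat \<Rightarrow> quat \<Rightarrow> quat" where
  "x * y = Quat
    (qre x * qre y - qim1 x * qim1 y - qim2 x * qim2 y - qim3 x * qim3 y)
    (qre x * qim1 y + qim1 x * qre y + qim2 x * qim3 y - qim3 x * qim2 y)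
    (qre x * qim2 y - qim1 x * qim3 y + qim2 x * qre y + qim3 x * qim1 y)
    (qre x * qim3 y + qim1 x * qim2 y - qim2 x * qim1 y + qim3 x * qre y)"

instance
  by standard
    (simp_all add: zero_quat_def one_quat_def plus_quat_def minus_quat_def uminus_quat_def
      times_quat_def quat.expand algebra_simps)

end

text \<open>Only the bare class \<^class>\<open>conjugate\<close> is available: quaternion conjugation reverses
  products, so \<^class>\<open>conjugatable_ring\<close> fails.\<close>

instantiation quat :: conjugate
begin

definition conjugate_quat :: "quat \<Rightarrow> quat" where
  "conjugate x = Quat (qre x) (- qim1 x) (- qim2 x) (- qim3 x)"

instance
  by standard (auto simp: conjugate_quat_def quat.expand intro: quat.expand)

end

definition quat_of_real :: "real \<Rightarrow> quat" where
  "quat_of_real r = Quat r 0 0 0"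

definition quat_component :: "nat \<Rightarrow> quat \<Rightarrow> real" where
  "quat_component c x = [qre x, qim1 x, qim2 x, qim3 x] ! c"

definition quat_adjoint :: "quat mat \<Rightarrow> quat mat" where
  "quat_adjoint M = map_mat conjugate (transpose_mat M)"

definition quat_unitary :: "quat mat \<Rightarrow> bool" where
  "quat_unitary U \<longleftrightarrow> square_mat U \<and>
     quat_adjoint U * U = 1\<^sub>m (dim_row U) \<and> U * quat_adjoint U = 1\<^sub>m (dim_row U)"

text \<open>The \<open>m \<times> n\<close> matrix with diagonal \<open>\<sigma> 1, \<sigma> 2, \<dots>\<close>: matrix indices start at 0, but singular
  values are numbered from 1.\<close>

definition quat_diag :: "nat \<Rightarrow> nat \<Rightarrow> (nat \<Rightarrow> real) \<Rightarrow> quat mat" where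
  "quat_diag m n \<sigma> =
     Matrix.mat m n (\<lambda>(i, j). if i = j then quat_of_real (\<sigma> (Suc i)) else 0)"

definition is_qsvd :: "quat mat \<Rightarrow> quat mat \<Rightarrow> (nat \<Rightarrow> real) \<Rightarrow> quat mat \<Rightarrow> bool" where
  "is_qsvd A U \<sigma> V \<longleftrightarrow>
     U \<in> carrier_mat (dim_row A) (dim_row A) \<and> quat_unitary U \<and>
     V \<in> carrier_mat (dim_col A) (dim_col A) \<and> quat_unitary V \<and>
     (\<forall>i \<in> {1..min (dim_row A) (dim_col A)}. 0 \<le> \<sigma> i) \<and>
     antimono_on {1..min (dim_row A) (dim_col A)} \<sigma> \<and>
     A = U * quat_diag (dim_row A) (dim_col A) \<sigma> * quat_adjoint V"

text \<open>The largest singular value, which does not depend on the chosen decomposition.  It is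
  meaningful only for matrices with at least one row and one column.\<close>

definition quat_spectral_norm :: "quat mat \<Rightarrow> real" where
  "quat_spectral_norm A =
     (THE s. \<exists>U \<sigma> V. is_qsvd A U \<sigma> V \<and> s = Max (\<sigma> ` {1..min (dim_row A) (dim_col A)}))"

definition first_cols :: "nat \<Rightarrow> quat mat \<Rightarrow> quat mat" where
  "first_cols k V = Matrix.mat (dim_row V) k (\<lambda>(i, j). V $$ (i, j))"

text \<open>The column range is a right \<open>quat\<close>-module, whereas rows are combined with coefficients on
  the left.\<close>

definition quat_range :: "quat mat \<Rightarrow> quat Matrix.vec set" where
  "quat_range M = {M *\<^sub>v x | x. x \<in> carrier_vec (dim_col M)}"

definition full_row_rank :: "quat mat \<Rightarrow> bool" where
  "full_row_rank M \<longleftrightarrow>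
     (\<forall>x \<in> carrier_mat 1 (dim_row M). x * M = 0\<^sub>m 1 (dim_col M) \<longrightarrow> x = 0\<^sub>m 1 (dim_row M))"

definition quat_test_matrix :: "'w measure \<Rightarrow> nat \<Rightarrow> nat \<Rightarrow> ('w \<Rightarrow> quat mat) \<Rightarrow> bool" where
  "quat_test_matrix M n l \<Omega> \<longleftrightarrow>
     (\<forall>w \<in> space M. \<Omega> w \<in> carrier_mat n l) \<and>
     prob_space.indep_vars M (\<lambda>_. borel) (\<lambda>(c, i, j) w. quat_component c (\<Omega> w $$ (i, j)))
       ({..<4} \<times> {..<n} \<times> {..<l}) \<and>
     (\<forall>c<4. \<forall>i<n. \<forall>j<l.
        distributed M lborel (\<lambda>w. quat_component c (\<Omega> w $$ (i, j))) std_normal_density)"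

definition power_sample :: "quat mat \<Rightarrow> nat \<Rightarrow> quat mat \<Rightarrow> quat mat" where
  "power_sample A q W = (A * quat_adjoint A) ^\<^sub>m q * A * W"

text \<open>\<open>Q\<close> is an admissible orthonormal factor for \<open>Y\<close>.  It has as many columns as \<open>Y\<close> even if \<open>Y\<close>
  is rank deficient, hence only inclusion of the ranges.\<close>

definition range_finder :: "quat mat \<Rightarrow> quat mat \<Rightarrow> bool" where
  "range_finder Y Q \<longleftrightarrow>
     Q \<in> carrier_mat (dim_row Y) (dim_col Y) \<and>
     quat_adjoint Q * Q = 1\<^sub>m (dim_col Y) \<and>
     quat_range Y \<subseteq> quat_range Q"

definition rqsvd_approx :: "quat mat \<Rightarrow> quat mat \<Rightarrow> quat mat" where
  "rqsvd_approx Q A = Q * quat_adjoint Q * A"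

end

theory Submission
  imports Defs "HOL-Real_Asymp.Real_Asymp"
begin

text \<open>
  Let \<open>X\<close> and \<open>Y\<close> be the first \<open>k\<close> rows of \<open>V\<^sup>* \<Omega>\<close> and all of it, let \<open>T\<close> be the pseudoinverse of \<open>X\<close>, and let
  \<open>S\<close> be \<open>\<Sigma>\<close> with its first \<open>k\<close> entries deleted. Comparing \<open>A x\<close> with the vector \<open>A \<Omega> T x\<^sub>1\<close> of the sampled range
  bounds the error by \<open>\<sigma>\<^sub>k\<^sub>+\<^sub>1 + \<parallel>S Y T\<parallel>\<close>. Conditionally on \<open>X\<close> the remaining rows of \<open>Y\<close> are Gaussian, and
  \<open>E \<parallel>S Y T\<parallel> \<le> 3/2 (\<parallel>T\<parallel> \<rho> + \<parallel>S\<parallel> \<tau>)\<close>, where \<open>\<rho>\<^sup>2\<close> and \<open>\<tau>\<^sup>2\<close> are the second moments of \<open>S\<close> and \<open>T\<close> applied to a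
  Gaussian vector. Instead of a Gaussian comparison inequality this uses a PAC-Bayesian argument: the exponential
  moment of the bilinear form \<open>\<xi>\<^sup>* S Y T \<eta>\<close> over independent Gaussian \<open>\<xi>, \<eta>\<close> is known, and tilting the laws of
  \<open>\<xi>\<close> and \<open>\<eta>\<close> to any pair of means recovers the supremum over all unit vectors at once.

  The moments of \<open>T\<close> come from the quadratic form of \<open>(X X\<^sup>*)\<^sup>-\<^sup>1\<close>: by rotation invariance its value at any unit vector
  is distributed as the inverse squared distance of one row of \<open>X\<close> from the span of the others, an inverse
  chi-square variable with \<open>4 (p + 1)\<close> degrees of freedom. The operator norm of \<open>T\<close> is controlled by testing \<open>T\<close>
  on an independent Gaussian vector, with moments of order \<open>4 p + 2\<close>. The power scheme reduces to the case of
  \<open>(A A\<^sup>*)\<^sup>q A\<close> by the power mean inequality and Jensen's inequality.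
\<close>

subsection \<open>Quaternions as a normed division algebra and a Euclidean space\<close>

text \<open>Quaternions do not commute, so determinants, eigenvalue calculus and Wishart densities
  are avoided. Everything rests on the real inner product \<open>mat_inner\<close>, for which
  multiplication by \<open>A\<close> has multiplication by \<open>A\<^sup>\<dagger>\<close> as
  adjoint, and on invariance under rotations. The matrix \<open>Q\<close> is an arbitrary admissible
  choice at each outcome, so the error need not be a measurable function. It is dominated pointwise
  by a measurable majorant built from suprema over countable dense sets, and for the error itself
  only monotonicity of the integral is used. Origin of the constants: testing \<open>S\<close> on a
  quaternion Gaussian vector gives \<open>\<rho> = 2 * F\<close> with \<open>F\<close> the Frobenius
  norm of \<open>S\<close>, and the mean of \<open>\<tau>\<^sup>2\<close> is at most
  \<open>4 * k / (4 * p + 2)\<close>; the factor 3/2 turns both into the coefficient 3. The order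
  \<open>4 * p + 2\<close> belongs to the inverse chi-square moment of order
  \<open>2 * p + 1\<close>, the largest integer order below half the number of degrees of freedom.
  Euler's number enters through \<open>n ^ n \<le> exp n * fact n\<close>.\<close>

lemmas quat_defs = zero_quat_def one_quat_def plus_quat_def minus_quat_def uminus_quat_def
  times_quat_def conjugate_quat_def

instantiation quat :: real_vector
begin

definition scaleR_quat :: "real \<Rightarrow> quat \<Rightarrow> quat" where
  "scaleR_quat r x = Quat (r * qre x) (r * qim1 x) (r * qim2 x) (r * qim3 x)"

instance
  by standard (simp_all add: scaleR_quat_def plus_quat_def algebra_simps quat.expand)

end

instantiation quat :: real_inner
begin

definition inner_quat :: "quat \<Rightarrow> quat \<Rightarrow> real" where
  "inner_quat x y = qre x * qre y + qim1 x * qim1 y + qim2 x * qim2 y + qim3 x * qim3 y"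
definition norm_quat :: "quat \<Rightarrow> real" where
  "norm_quat x = sqrt (inner x x)"
definition sgn_quat :: "quat \<Rightarrow> quat" where
  "sgn_quat x = x /\<^sub>R norm x"
definition dist_quat :: "quat \<Rightarrow> quat \<Rightarrow> real" where
  "dist_quat x y = norm (x - y)"
definition uniformity_quat :: "(quat \<times> quat) filter" where
  "uniformity_quat = (INF e\<in>{0 <..}. principal {(x, y). dist x y < e})"
definition open_quat :: "quat set \<Rightarrow> bool" where
  "open_quat U \<longleftrightarrow> (\<forall>x\<in>U. eventually (\<lambda>(x', y). x' = x \<longrightarrow> y \<in> U) uniformity)"

instance
proof
  fix x y z :: quat and r s :: real
  show "inner x y = inner y x" "inner (x + y) z = inner x z + inner y z"
    "inner (r *\<^sub>R x) y = r * inner x y" "0 \<le> inner x x"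
    by (simp_all add: inner_quat_def plus_quat_def scaleR_quat_def algebra_simps)
  show "(inner x x = 0) = (x = 0)"
    by (cases x) (auto simp: inner_quat_def zero_quat_def add_nonneg_eq_0_iff)
qed (simp_all add: norm_quat_def sgn_quat_def dist_quat_def uniformity_quat_def open_quat_def)

end

lemma quat_of_real_eq_scaleR: "quat_of_real r = r *\<^sub>R 1"
  by (simp add: quat_of_real_def scaleR_quat_def one_quat_def)

lemma norm_quat_sq: "(norm (x :: quat))\<^sup>2 = (qre x)\<^sup>2 + (qim1 x)\<^sup>2 + (qim2 x)\<^sup>2 + (qim3 x)\<^sup>2"
  by (simp add: norm_quat_def inner_quat_def power2_eq_square)

instantiation quat :: real_normed_div_algebra
begin

definition inverse_quat :: "quat \<Rightarrow> quat" where
  "inverse_quat x = conjugate x /\<^sub>R (norm x)\<^sup>2"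
definition divide_quat :: "quat \<Rightarrow> quat \<Rightarrow> quat" where
  "divide_quat x y = x * inverse y"

instance
proof
  fix x y :: quat and r :: real
  have scaleR_mult: "r *\<^sub>R x * y = r *\<^sub>R (x * y)" "x * r *\<^sub>R y = r *\<^sub>R (x * y)"
    for x y :: quat and r
    by (simp_all add: scaleR_quat_def times_quat_def algebra_simps)
  then show "r *\<^sub>R x * y = r *\<^sub>R (x * y)" "x * r *\<^sub>R y = r *\<^sub>R (x * y)"
    by auto
  show "x div y = x * inverse y" by (rule divide_quat_def)
  show "inverse (0 :: quat) = 0"
    by (simp add: inverse_quat_def)
  \<comment> \<open>Euler's four-square identity.\<close>
  have "(norm (x * y))\<^sup>2 = (norm x * norm y)\<^sup>2"
    unfolding power_mult_distrib norm_quat_sq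
    by (simp add: times_quat_def power2_eq_square algebra_simps)
  then show "norm (x * y) = norm x * norm y"
    by (rule power2_eq_imp_eq) simp_all
  assume "x \<noteq> 0"
  then have *: "(norm x)\<^sup>2 \<noteq> 0" by simp
  have "conjugate x * x = (norm x)\<^sup>2 *\<^sub>R 1" "x * conjugate x = (norm x)\<^sup>2 *\<^sub>R 1"
    unfolding norm_quat_sq
    by (simp_all add: quat_defs scaleR_quat_def algebra_simps power2_eq_square)
  then have "inverse x * x = inverse ((norm x)\<^sup>2) *\<^sub>R (norm x)\<^sup>2 *\<^sub>R 1"
    "x * inverse x = inverse ((norm x)\<^sup>2) *\<^sub>R (norm x)\<^sup>2 *\<^sub>R 1"
    by (simp_all only: inverse_quat_def scaleR_mult)
  then show "inverse x * x = 1" "x * inverse x = 1"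
    using * by simp_all
qed

end

text \<open>This supplies second countability, used for Borel measurability of products and for
  countable dense sets, and compactness of closed balls.\<close>

instantiation quat :: euclidean_space
begin

definition Basis_quat :: "quat set" where
  "Basis_quat = {Quat 1 0 0 0, Quat 0 1 0 0, Quat 0 0 1 0, Quat 0 0 0 1}"

instance
  by standard (auto simp: Basis_quat_def inner_quat_def zero_quat_def quat.expand intro: quat.expand)

end

text \<open>The factor stays on the left on both sides, so entrywise use yields the adjoint rule
  \<open>mat_inner_mult_left\<close> without any commutativity.\<close>

lemma inner_mult_left_conj: "inner (a * x) y = inner x (conjugate a * y)" for x :: quat
  by (simp add: inner_quat_def times_quat_def conjugate_quat_def algebra_simps)

lemma conjugate_add_quat: "conjugate (x + y) = conjugate x + conjugate (y :: quat)"
  and conjugate_mult_quat: "conjugate (x * y) = conjugate y * conjugate (x :: quat)"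
  and conjugate_scaleR_quat: "conjugate (r *\<^sub>R x) = r *\<^sub>R conjugate (x :: quat)"
  and conjugate_one_quat: "conjugate (1 :: quat) = 1"
  and conjugate_zero_quat: "conjugate (0 :: quat) = 0"
  and conjugate_minus_quat: "conjugate (- x) = - conjugate (x :: quat)"
  and norm_conjugate_quat: "norm (conjugate x) = norm (x :: quat)"
  and inner_conjugate_quat: "inner (conjugate x) (conjugate y) = inner x (y :: quat)"
  by (simp_all add: quat_defs scaleR_quat_def algebra_simps norm_quat_def inner_quat_def)

lemma conjugate_sum_quat: "conjugate (sum f A) = (\<Sum>i\<in>A. conjugate (f i :: quat))"
  by (induction A rule: infinite_finite_induct)
    (simp_all add: conjugate_add_quat conjugate_zero_quat)

lemma mult_conjugate_quat: "x * conjugate x = (norm (x :: quat))\<^sup>2 *\<^sub>R 1"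
  "conjugate x * x = (norm (x :: quat))\<^sup>2 *\<^sub>R 1"
  unfolding norm_quat_sq
  by (simp_all add: quat_defs scaleR_quat_def algebra_simps power2_eq_square)

subsection \<open>Frobenius geometry of quaternion matrices\<close>

notation quat_adjoint (\<open>(_\<^sup>\<dagger>)\<close> [1000] 999)

lemma quat_adjoint_carrier [simp]: "X\<^sup>\<dagger> \<in> carrier_mat a b \<longleftrightarrow> X \<in> carrier_mat b a"
  by (auto simp: quat_adjoint_def)

lemma dim_quat_adjoint [simp]: "dim_row (X\<^sup>\<dagger>) = dim_col X" "dim_col (X\<^sup>\<dagger>) = dim_row X"
  by (simp_all add: quat_adjoint_def)

lemma quat_adjoint_index [simp]:
  "i < dim_col X \<Longrightarrow> j < dim_row X \<Longrightarrow> X\<^sup>\<dagger> $$ (i, j) = conjugate (X $$ (j, i))"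
  by (simp add: quat_adjoint_def)

lemma quat_adjoint_adjoint [simp]: "(X\<^sup>\<dagger>)\<^sup>\<dagger> = X"
  by (rule eq_matI) auto

lemma quat_adjoint_one [simp]: "(1\<^sub>m n)\<^sup>\<dagger> = 1\<^sub>m n"
  by (rule eq_matI) (auto simp: conjugate_one_quat conjugate_zero_quat)

lemma quat_adjoint_zero [simp]: "(0\<^sub>m a b)\<^sup>\<dagger> = 0\<^sub>m b a"
  by (rule eq_matI) (auto simp: conjugate_zero_quat)

lemma mat_mult_entry:
  "A \<in> carrier_mat a b \<Longrightarrow> B \<in> carrier_mat b c \<Longrightarrow> i < a \<Longrightarrow> j < c \<Longrightarrow>
    (A * B) $$ (i, j) = (\<Sum>k<b. A $$ (i, k) * B $$ (k, j))"
  by (simp add: times_mat_def scalar_prod_def atLeast0LessThan)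

lemma quat_adjoint_mult:
  assumes "A \<in> carrier_mat a b" "B \<in> carrier_mat b c"
  shows "(A * B)\<^sup>\<dagger> = B\<^sup>\<dagger> * A\<^sup>\<dagger>"
proof (rule eq_matI)
  fix i j assume ij: "i < dim_row (B\<^sup>\<dagger> * A\<^sup>\<dagger>)" "j < dim_col (B\<^sup>\<dagger> * A\<^sup>\<dagger>)"
  then show "(A * B)\<^sup>\<dagger> $$ (i, j) = (B\<^sup>\<dagger> * A\<^sup>\<dagger>) $$ (i, j)"
    using assms
    by (subst mat_mult_entry[of _ c b _ a])
      (auto simp: mat_mult_entry[OF assms] conjugate_sum_quat conjugate_mult_quat simp del: index_mult_mat(1))
qed (use assms in auto)

text \<open>Real scalars only: they are central, so they move through products on either
  side.\<close>

definition mat_scale :: "real \<Rightarrow> quat mat \<Rightarrow> quat mat" where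
  "mat_scale r X = map_mat (scaleR r) X"

lemma mat_scale_carrier [simp]: "mat_scale r X \<in> carrier_mat a b \<longleftrightarrow> X \<in> carrier_mat a b"
  by (auto simp: mat_scale_def)

lemma mat_scale_dim [simp]: "dim_row (mat_scale r X) = dim_row X" "dim_col (mat_scale r X) = dim_col X"
  by (auto simp: mat_scale_def)

lemma mat_scale_index [simp]:
  "i < dim_row X \<Longrightarrow> j < dim_col X \<Longrightarrow> mat_scale r X $$ (i, j) = r *\<^sub>R X $$ (i, j)"
  by (simp add: mat_scale_def)

lemma mult_mat_scale:
  assumes "A \<in> carrier_mat a b" "B \<in> carrier_mat b c"
  shows "A * mat_scale r B = mat_scale r (A * B)" "mat_scale r A * B = mat_scale r (A * B)"
  by (rule eq_matI; use assms in \<open>auto simp: mat_mult_entry[of _ a b _ c] scaleR_sum_right simp del: index_mult_mat(1)\<close>)+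

lemma mat_scale_scale: "mat_scale r (mat_scale s X) = mat_scale (r * s) X"
  by (rule eq_matI) auto

lemma mat_scale_one [simp]: "mat_scale 1 X = X"
  by (rule eq_matI) auto

text \<open>The real part of the trace of \<open>X\<^sup>\<dagger> * Y\<close>, that is, the
  Euclidean inner product of the real coordinates.\<close>

definition mat_inner :: "quat mat \<Rightarrow> quat mat \<Rightarrow> real" where
  "mat_inner X Y = (\<Sum>i<dim_row X. \<Sum>j<dim_col X. inner (X $$ (i, j)) (Y $$ (i, j)))"

definition fnorm :: "quat mat \<Rightarrow> real" where
  "fnorm X = sqrt (mat_inner X X)"

lemma mat_inner_self_nonneg [simp]: "0 \<le> mat_inner X X"
  by (auto simp: mat_inner_def intro!: sum_nonneg)

lemma fnorm_nonneg [simp]: "0 \<le> fnorm X"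
  by (simp add: fnorm_def)

lemma fnorm_sq: "(fnorm X)\<^sup>2 = mat_inner X X"
  by (simp add: fnorm_def)

lemma fnorm_sq_sum: "(fnorm X)\<^sup>2 = (\<Sum>i<dim_row X. \<Sum>j<dim_col X. (norm (X $$ (i, j)))\<^sup>2)"
  by (simp add: fnorm_sq mat_inner_def power2_norm_eq_inner)

lemma mat_inner_cong_dims:
  "X \<in> carrier_mat a b \<Longrightarrow>
    mat_inner X Y = (\<Sum>i<a. \<Sum>j<b. inner (X $$ (i, j)) (Y $$ (i, j)))"
  by (auto simp: mat_inner_def)

lemma mat_inner_commute:
  "X \<in> carrier_mat a b \<Longrightarrow> Y \<in> carrier_mat a b \<Longrightarrow> mat_inner X Y = mat_inner Y X"
  by (simp add: mat_inner_cong_dims inner_commute)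

lemma mat_inner_scale:
  assumes "X \<in> carrier_mat a b" "Y \<in> carrier_mat a b"
  shows "mat_inner (mat_scale r X) Y = r * mat_inner X Y"
    and "mat_inner X (mat_scale r Y) = r * mat_inner X Y"
  using assms by (auto simp: mat_inner_def sum_distrib_left)

lemma mat_inner_add:
  assumes "X \<in> carrier_mat a b" "Y \<in> carrier_mat a b" "Z \<in> carrier_mat a b"
  shows "mat_inner (X + Y) Z = mat_inner X Z + mat_inner Y Z"
    and "mat_inner Z (X + Y) = mat_inner Z X + mat_inner Z Y"
  using assms by (auto simp: mat_inner_def sum.distrib inner_add_left inner_add_right)

lemma mat_inner_minus:
  assumes "X \<in> carrier_mat a b" "Y \<in> carrier_mat a b" "Z \<in> carrier_mat a b"
  shows "mat_inner (X - Y) Z = mat_inner X Z - mat_inner Y Z"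
    and "mat_inner Z (X - Y) = mat_inner Z X - mat_inner Z Y"
  using assms by (auto simp: mat_inner_def sum_subtractf inner_diff_left inner_diff_right)

lemma mat_inner_zero [simp]:
  "X \<in> carrier_mat a b \<Longrightarrow> mat_inner X (0\<^sub>m a b) = 0"
  "mat_inner (0\<^sub>m a b) Y = 0"
  by (auto simp: mat_inner_def)

lemma fnorm_eq_0_iff:
  assumes "X \<in> carrier_mat a b"
  shows "fnorm X = 0 \<longleftrightarrow> X = 0\<^sub>m a b"
proof
  assume "fnorm X = 0"
  then have "(\<Sum>i<a. \<Sum>j<b. (norm (X $$ (i, j)))\<^sup>2) = 0"
    using fnorm_sq_sum[of X] assms by auto
  then have "X $$ (i, j) = 0" if "i < a" "j < b" for i j
    using that by (subst (asm) sum_nonneg_eq_0_iff)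
      (auto intro!: sum_nonneg simp: sum_nonneg_eq_0_iff)
  then show "X = 0\<^sub>m a b" using assms by (auto intro!: eq_matI)
qed (auto simp: fnorm_def)

lemma fnorm_scale: "fnorm (mat_scale r X) = \<bar>r\<bar> * fnorm X"
proof -
  have "mat_inner (mat_scale r X) (mat_scale r X) = r\<^sup>2 * mat_inner X X"
    by (simp add: mat_inner_def sum_distrib_left power2_eq_square mult.assoc)
  then show ?thesis by (simp add: fnorm_def real_sqrt_mult)
qed

lemma mat_inner_mult_left:
  assumes "A \<in> carrier_mat a b" "X \<in> carrier_mat b c" "Y \<in> carrier_mat a c"
  shows "mat_inner (A * X) Y = mat_inner X (A\<^sup>\<dagger> * Y)"
proof -
  have "mat_inner (A * X) Y = (\<Sum>i<a. \<Sum>j<c. \<Sum>k<b. inner (X $$ (k, j)) (conjugate (A $$ (i, k)) * Y $$ (i, j)))"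
    using assms
    by (simp add: mat_inner_cong_dims[of _ a c] mat_mult_entry[of _ a b _ c] inner_sum_left
      inner_mult_left_conj del: index_mult_mat(1))
  also have "\<dots> = (\<Sum>j<c. \<Sum>k<b. \<Sum>i<a. inner (X $$ (k, j)) (conjugate (A $$ (i, k)) * Y $$ (i, j)))"
    by (subst sum.swap, rule sum.cong[OF refl], rule sum.swap)
  also have "\<dots> = (\<Sum>k<b. \<Sum>j<c. \<Sum>i<a. inner (X $$ (k, j)) (conjugate (A $$ (i, k)) * Y $$ (i, j)))"
    by (rule sum.swap)
  also have "\<dots> = mat_inner X (A\<^sup>\<dagger> * Y)"
    using assms
    by (simp add: mat_inner_cong_dims[of _ b c] mat_mult_entry[of _ b a _ c] inner_sum_right
       del: index_mult_mat(1))
  finally show ?thesis .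
qed

lemma mat_inner_Cauchy_Schwarz:
  assumes "X \<in> carrier_mat a b" "Y \<in> carrier_mat a b"
  shows "\<bar>mat_inner X Y\<bar> \<le> fnorm X * fnorm Y"
proof -
  define f g where "f = (\<lambda>(i, j). norm (X $$ (i, j)))" and "g = (\<lambda>(i, j). norm (Y $$ (i, j)))"
  have "fnorm X = L2_set f ({..<a} \<times> {..<b})" "fnorm Y = L2_set g ({..<a} \<times> {..<b})"
    using assms
    by (simp_all add: fnorm_def mat_inner_cong_dims[of _ a b] L2_set_def f_def g_def
      sum.cartesian_product power2_norm_eq_inner case_prod_beta)
  moreover have "\<bar>mat_inner X Y\<bar> \<le> (\<Sum>p\<in>{..<a} \<times> {..<b}. \<bar>f p\<bar> * \<bar>g p\<bar>)"
    using assms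
    by (auto simp: mat_inner_cong_dims[of _ a b] sum.cartesian_product f_def g_def
      intro!: order.trans[OF sum_abs] sum_mono Cauchy_Schwarz_ineq2)
  ultimately show ?thesis
    using order.trans[OF _ L2_set_mult_ineq[of f g "{..<a} \<times> {..<b}"]] by simp
qed

lemma fnorm_add_sq:
  assumes "X \<in> carrier_mat a b" "Y \<in> carrier_mat a b"
  shows "(fnorm (X + Y))\<^sup>2 = (fnorm X)\<^sup>2 + 2 * mat_inner X Y + (fnorm Y)\<^sup>2"
  using assms by (simp add: fnorm_sq mat_inner_add[of _ a b] mat_inner_commute[of Y a b X])

lemma fnorm_triangle:
  assumes "X \<in> carrier_mat a b" "Y \<in> carrier_mat a b"
  shows "fnorm (X + Y) \<le> fnorm X + fnorm Y"
proof (rule power2_le_imp_le)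
  show "(fnorm (X + Y))\<^sup>2 \<le> (fnorm X + fnorm Y)\<^sup>2"
    using mat_inner_Cauchy_Schwarz[OF assms] by (simp add: fnorm_add_sq[OF assms] power2_sum)
qed simp

lemma fnorm_triangle_minus:
  assumes "X \<in> carrier_mat a b" "Y \<in> carrier_mat a b"
  shows "fnorm (X - Y) \<le> fnorm X + fnorm Y"
proof -
  have "X - Y = X + mat_scale (- 1) Y"
    using assms by (intro eq_matI) auto
  then show ?thesis
    using fnorm_triangle[of X a b "mat_scale (- 1) Y"] assms by (simp add: fnorm_scale)
qed

section \<open>Unitary matrices and isometries\<close>

lemma quat_unitaryD:
  assumes "quat_unitary U" "U \<in> carrier_mat n n"
  shows "U\<^sup>\<dagger> * U = 1\<^sub>m n" "U * U\<^sup>\<dagger> = 1\<^sub>m n"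
  using assms by (auto simp: quat_unitary_def)

lemma quat_unitaryI:
  assumes "U \<in> carrier_mat n n" "U\<^sup>\<dagger> * U = 1\<^sub>m n" "U * U\<^sup>\<dagger> = 1\<^sub>m n"
  shows "quat_unitary U"
  using assms by (auto simp: quat_unitary_def)

lemma quat_unitary_adjoint:
  "quat_unitary U \<Longrightarrow> quat_unitary (U\<^sup>\<dagger>)"
  by (auto simp: quat_unitary_def)

lemma quat_unitary_one [simp]: "quat_unitary (1\<^sub>m n)"
  by (auto intro!: quat_unitaryI[of _ n])

lemma mat_assoc_cancel:
  fixes A B X :: "quat mat"
  assumes "A \<in> carrier_mat a b" "B \<in> carrier_mat b a" "A * B = 1\<^sub>m a" "X \<in> carrier_mat a c"
  shows "A * (B * X) = X"
proof -
  have "A * (B * X) = (A * B) * X"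
    using assoc_mult_mat[OF assms(1,2,4)] by simp
  then show ?thesis using assms(3,4) by simp
qed

lemma quat_unitary_mult:
  assumes U: "quat_unitary U" "U \<in> carrier_mat n n" and V: "quat_unitary V" "V \<in> carrier_mat n n"
  shows "quat_unitary (U * V)"
proof (rule quat_unitaryI)
  show "U * V \<in> carrier_mat n n" using assms by auto
  have "(U * V)\<^sup>\<dagger> * (U * V) = V\<^sup>\<dagger> * (U\<^sup>\<dagger> * (U * V))"
    using assms by (simp add: quat_adjoint_mult[of _ n n _ n] assoc_mult_mat[of _ n n _ n _ n])
  then show "(U * V)\<^sup>\<dagger> * (U * V) = 1\<^sub>m n"
    using assms by (simp add: mat_assoc_cancel[of _ n n] quat_unitaryD)
  have "(U * V) * (U * V)\<^sup>\<dagger> = U * (V * (V\<^sup>\<dagger> * U\<^sup>\<dagger>))"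
    using assms by (simp add: quat_adjoint_mult[of _ n n _ n] assoc_mult_mat[of _ n n _ n _ n])
  then show "(U * V) * (U * V)\<^sup>\<dagger> = 1\<^sub>m n"
    using assms by (simp add: mat_assoc_cancel[of _ n n] quat_unitaryD)
qed

lemma mat_inner_unitary_mult:
  assumes "quat_unitary U" "U \<in> carrier_mat n n" "X \<in> carrier_mat n c" "Y \<in> carrier_mat n c"
  shows "mat_inner (U * X) (U * Y) = mat_inner X Y"
  using assms by (simp add: mat_inner_mult_left[of _ n n _ c] mat_assoc_cancel[of _ n n] quat_unitaryD)

lemma fnorm_isometry_mult:
  assumes "U \<in> carrier_mat m n" "U\<^sup>\<dagger> * U = 1\<^sub>m n" "X \<in> carrier_mat n c"
  shows "fnorm (U * X) = fnorm X"
  using assms by (simp add: fnorm_def mat_inner_mult_left[of _ m n _ c] mat_assoc_cancel[of _ n m])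

lemma fnorm_unitary_mult:
  assumes "quat_unitary U" "U \<in> carrier_mat n n" "X \<in> carrier_mat n c"
  shows "fnorm (U * X) = fnorm X"
  using assms fnorm_isometry_mult quat_unitaryD by blast

lemma fnorm_adjoint: "fnorm (X\<^sup>\<dagger>) = fnorm X"
  by (auto simp: fnorm_def mat_inner_def inner_conjugate_quat intro: sum.swap)

text \<open>Vectors are one-column matrices throughout, so the norm, the adjoint and associativity
  of matrices serve for vectors as well.\<close>

definition unit_col :: "nat \<Rightarrow> nat \<Rightarrow> quat mat" where
  "unit_col n j = Matrix.mat n 1 (\<lambda>(i, _). if i = j then 1 else 0)"

lemma unit_col_carrier [simp]: "unit_col n j \<in> carrier_mat n 1"
  "unit_col n j \<in> carrier_mat n (Suc 0)"
  by (auto simp: unit_col_def intro!: carrier_matI)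

lemma unit_col_dim [simp]: "dim_row (unit_col n j) = n" "dim_col (unit_col n j) = Suc 0"
  by (simp_all add: unit_col_def)

lemma unit_col_index [simp]: "i < n \<Longrightarrow> unit_col n j $$ (i, 0) = (if i = j then 1 else 0)"
  by (simp add: unit_col_def)

lemma fnorm_unit_col [simp]: "j < n \<Longrightarrow> fnorm (unit_col n j) = 1"
  by (simp add: fnorm_def mat_inner_def if_distrib[of "\<lambda>x. inner x _"] cong: if_cong)
    (simp add: inner_quat_def one_quat_def zero_quat_def)

lemma mult_unit_col_index:
  assumes "A \<in> carrier_mat m n" "j < n" "i < m"
  shows "(A * unit_col n j) $$ (i, 0) = A $$ (i, j)"
  using assms
  by (subst mat_mult_entry[of _ m n _ 1]) (auto simp: if_distrib[of "\<lambda>x. _ * x"] cong: if_cong)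

lemma adjoint_mult_self_col:
  assumes "w \<in> carrier_mat m 1"
  shows "w\<^sup>\<dagger> * w = mat_scale ((fnorm w)\<^sup>2) (1\<^sub>m 1)"
  using assms
  by (intro eq_matI)
    (auto simp: mat_mult_entry[of _ 1 m _ 1] fnorm_sq_sum mult_conjugate_quat scaleR_sum_left
      simp del: index_mult_mat(1))

lemma fnorm_sq_col: "x \<in> carrier_mat n 1 \<Longrightarrow> (fnorm x)\<^sup>2 = (\<Sum>i<n. (norm (x $$ (i, 0)))\<^sup>2)"
  by (auto simp: fnorm_sq_sum)

text \<open>A quaternion Householder reflection; a right scalar factor adjusts the phase.\<close>

lemma exists_unitary_first_col:
  assumes u: "u \<in> carrier_mat m 1" "fnorm u = 1"
  obtains U where "U \<in> carrier_mat m m" "quat_unitary U" "U * unit_col m 0 = u"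
proof -
  have m: "0 < m"
  proof (rule ccontr)
    assume "\<not> 0 < m"
    with u show False by (auto simp: fnorm_def mat_inner_def)
  qed
  define a where "a = norm (u $$ (0, 0))"
  \<comment> \<open>The phase of the first entry; any unit quaternion would do when that entry is
    0.\<close>
  define q where "q = (if u $$ (0, 0) = 0 then 1 else u $$ (0, 0) /\<^sub>R a)"
  have qn: "norm q = 1" by (simp add: q_def a_def)
  have uq: "u $$ (0, 0) = a *\<^sub>R q" by (simp add: q_def a_def)
  have qq: "q * conjugate q = 1" "conjugate q * q = 1" by (simp_all add: mult_conjugate_quat qn)
  \<comment> \<open>The reflection \<open>H\<close> below sends the first coordinate column to
    \<open>- v\<close>; the right factor \<open>- q\<close> turns this into
    \<open>v q = u\<close>.\<close>
  define D where "D = Matrix.mat m m (\<lambda>(i, j). if i = j then - q else 0)"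
  define v where "v = Matrix.mat m 1 (\<lambda>(i, _). u $$ (i, 0) * conjugate q)"
  \<comment> \<open>The sum rather than the difference: as the first entry \<open>a\<close> of
    \<open>v\<close> is nonnegative, the squared norm \<open>2 * (1 + a)\<close> of \<open>w\<close>
    never vanishes.\<close>
  define w where "w = v + unit_col m 0"
  define c where "c = 1 + a"
  define P where "P = w * w\<^sup>\<dagger>"
  define H where "H = 1\<^sub>m m - mat_scale (1 / c) P"
  have c0: "0 < c" by (simp add: c_def a_def add_pos_nonneg)
  have carr: "v \<in> carrier_mat m 1" "w \<in> carrier_mat m 1" "P \<in> carrier_mat m m" "H \<in> carrier_mat m m"
    "D \<in> carrier_mat m m"
    using u by (auto simp: v_def w_def P_def H_def D_def)
  have v0: "v $$ (0, 0) = a *\<^sub>R 1"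
    using m u by (simp add: v_def uq qq)
  have vn: "(fnorm v)\<^sup>2 = 1"
    using u fnorm_sq_col[of u m] fnorm_sq_col[of v m] carr
    by (simp add: v_def norm_mult norm_conjugate_quat qn)
  have ve: "mat_inner v (unit_col m 0) = a"
    using m carr by (simp add: mat_inner_cong_dims[of _ m 1] if_distrib[of "inner _"] v0 cong: if_cong)
      (simp add: inner_quat_def one_quat_def)
  have wn: "(fnorm w)\<^sup>2 = 2 * c"
    unfolding w_def using carr m by (simp add: fnorm_add_sq[of _ m 1] vn ve c_def)
  have PP: "P * P = mat_scale (2 * c) P"
  proof -
    have "P * P = w * ((w\<^sup>\<dagger> * w) * w\<^sup>\<dagger>)"
      using carr by (simp add: P_def assoc_mult_mat[of _ m 1 _ m _ m] assoc_mult_mat[of _ 1 m _ 1 _ m])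
    then show ?thesis
      using carr by (simp add: adjoint_mult_self_col wn mult_mat_scale[of _ 1 1 _ m] mult_mat_scale[of _ m 1 _ m] P_def)
  qed
  have Hadj: "H\<^sup>\<dagger> = H"
  proof -
    have "P\<^sup>\<dagger> = P" using carr by (simp add: P_def quat_adjoint_mult[of _ m 1 _ m])
    then have P: "conjugate (P $$ (j, i)) = P $$ (i, j)" if "i < m" "j < m" for i j
      using carr that quat_adjoint_index[of i P j] by (auto simp del: quat_adjoint_index)
    show ?thesis
      using carr by (intro eq_matI) (auto simp: H_def P conjugate_scaleR_quat conjugate_one_quat
        conjugate_zero_quat conjugate_minus_quat diff_conv_add_uminus conjugate_add_quat simp del: add_uminus_conv_diff)
  qed
  have HH: "H * H = 1\<^sub>m m"
  proof -
    have "H * H = 1\<^sub>m m * H - mat_scale (1 / c) P * H"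
      using carr by (subst (1) H_def) (simp add: minus_mult_distrib_mat[of _ m m _ _ m])
    also have "mat_scale (1 / c) P * H = mat_scale (1 / c) P - mat_scale (1 / c) P * mat_scale (1 / c) P"
      using carr by (subst H_def) (simp add: mult_minus_distrib_mat[of _ m m _ m])
    also have "mat_scale (1 / c) P * mat_scale (1 / c) P = mat_scale (2 / c) P"
      using carr c0 by (simp add: mult_mat_scale[of _ m m _ m] mat_scale_scale PP)
    finally show ?thesis
      using carr by (intro eq_matI) (auto simp: H_def algebra_simps simp flip: scaleR_add_left)
  qed
  have Hu: "quat_unitary H" using carr by (auto intro!: quat_unitaryI[of _ m] simp: Hadj HH)
  have DD: "D\<^sup>\<dagger> * D = 1\<^sub>m m" "D * D\<^sup>\<dagger> = 1\<^sub>m m"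
    using carr
    by (intro eq_matI; simp add: mat_mult_entry[of _ m m _ m] D_def if_distrib[of "\<lambda>x. _ * x"]
      if_distrib[of "\<lambda>x. x * _"] if_distrib[of conjugate] conjugate_zero_quat
      conjugate_minus_quat qq del: index_mult_mat(1) cong: if_cong)+
  have Du: "quat_unitary D" using carr DD by (auto intro!: quat_unitaryI[of _ m])
  have we: "(w\<^sup>\<dagger> * unit_col m 0) = mat_scale c (1\<^sub>m 1)"
    using carr m by (intro eq_matI)
      (auto simp: mult_unit_col_index[of _ 1 m] w_def c_def v0 scaleR_add_left conjugate_add_quat
        conjugate_one_quat conjugate_scaleR_quat simp del: index_mult_mat(1))
  have Pe: "P * unit_col m 0 = mat_scale c w"
    using carr by (simp add: P_def assoc_mult_mat[of _ m 1 _ m _ 1] we mult_mat_scale[of _ m 1 _ 1])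
  have He: "H * unit_col m 0 = mat_scale (- 1) v"
  proof -
    have "H * unit_col m 0 = unit_col m 0 - w"
      using carr c0 by (simp add: H_def minus_mult_distrib_mat[of _ m m _ _ 1] mult_mat_scale[of _ m m _ 1]
        Pe mat_scale_scale)
    then show ?thesis
      using carr by (intro eq_matI) (auto simp: w_def)
  qed
  have De: "(D * unit_col m 0) $$ (i, 0) = (if i = 0 then - q else 0)" if "i < m" for i
    using that m carr by (simp add: mult_unit_col_index[of _ m m] D_def del: index_mult_mat(1))
  have HDe: "H * (D * unit_col m 0) = u"
  proof (rule eq_matI)
    fix i j assume "i < dim_row u" "j < dim_col u"
    then have i: "i < m" "j = 0" using u by auto
    have "(H * (D * unit_col m 0)) $$ (i, 0) = H $$ (i, 0) * (- q)"
      using i m carr De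
      by (subst mat_mult_entry[of _ m m _ 1])
        (auto simp: if_distrib[of "\<lambda>x. _ * x"] simp del: index_mult_mat(1) cong: if_cong)
    also have "H $$ (i, 0) = (H * unit_col m 0) $$ (i, 0)"
      using i m carr by (simp add: mult_unit_col_index[of _ m m] del: index_mult_mat(1))
    also have "\<dots> * (- q) = u $$ (i, 0)"
      unfolding He using i carr by (simp add: v_def mult.assoc qq)
    finally show "(H * (D * unit_col m 0)) $$ (i, j) = u $$ (i, j)"
      using i by simp
  qed (use carr u in auto)
  show ?thesis
  proof
    show "H * D \<in> carrier_mat m m" "quat_unitary (H * D)" "H * D * unit_col m 0 = u"
      using carr HDe by (auto simp: assoc_mult_mat[of _ m m _ m _ 1] intro!: quat_unitary_mult[of _ m] Hu Du)
  qed
qed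

subsection \<open>Existence of the singular value decomposition and the spectral norm\<close>

text \<open>Matrices of all sizes share one type, so continuity is meant entrywise with the
  dimensions fixed.\<close>

definition cont_mat :: "nat \<Rightarrow> nat \<Rightarrow> ('t::topological_space \<Rightarrow> quat mat) \<Rightarrow> bool" where
  "cont_mat a b F \<longleftrightarrow> (\<forall>t. F t \<in> carrier_mat a b) \<and>
     (\<forall>i<a. \<forall>j<b. continuous_on UNIV (\<lambda>t. F t $$ (i, j)))"

lemma cont_mat_const: "X \<in> carrier_mat a b \<Longrightarrow> cont_mat a b (\<lambda>_. X)"
  by (simp add: cont_mat_def)

lemma cont_mat_mult:
  assumes "cont_mat a b F" "cont_mat b c G"
  shows "cont_mat a c (\<lambda>t. F t * G t)"
  using assms unfolding cont_mat_def
  by (auto simp: mat_mult_entry[of _ a b _ c] mult_carrier_mat[of _ a b _ c]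
    simp del: index_mult_mat(1) intro!: continuous_intros)

lemma continuous_mat_inner:
  assumes "cont_mat a b F" "cont_mat a b G"
  shows "continuous_on UNIV (\<lambda>t. mat_inner (F t) (G t))"
  using assms unfolding cont_mat_def
  by (auto simp: mat_inner_cong_dims[of _ a b] intro!: continuous_intros)

lemma continuous_fnorm:
  "cont_mat a b F \<Longrightarrow> continuous_on UNIV (\<lambda>t. fnorm (F t))"
  unfolding fnorm_def by (intro continuous_intros continuous_mat_inner)

text \<open>Columns of every height are parametrised by one space of sequences with the product
  topology. It provides compactness for the maximal stretch and, later, a countable dense set for
  measurability.\<close>

definition col_of :: "nat \<Rightarrow> (nat \<Rightarrow> quat) \<Rightarrow> quat mat" where
  "col_of n \<zeta> = Matrix.mat n 1 (\<lambda>(i, _). \<zeta> i)"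

lemma col_of_carrier [simp]: "col_of n \<zeta> \<in> carrier_mat n 1" "col_of n \<zeta> \<in> carrier_mat n (Suc 0)"
  by (auto simp: col_of_def intro!: carrier_matI)

lemma col_of_index [simp]: "i < n \<Longrightarrow> col_of n \<zeta> $$ (i, 0) = \<zeta> i"
  by (simp add: col_of_def)

lemma col_of_entries: "x \<in> carrier_mat n 1 \<Longrightarrow> col_of n (\<lambda>i. x $$ (i, 0)) = x"
  by (rule eq_matI) (auto simp: col_of_def)

lemma cont_mat_col_of: "cont_mat n 1 (col_of n)"
  unfolding cont_mat_def by (auto intro!: continuous_on_product_coordinates)

text \<open>Compactness of the unit sphere comes from Tychonoff: coordinates below \<open>n\<close>
  range over the unit ball, all others are pinned to 0.\<close>

lemma exists_max_stretch:
  assumes B: "B \<in> carrier_mat m n" and n: "0 < n"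
  obtains x where "x \<in> carrier_mat n 1" "fnorm x = 1"
    "\<And>y. y \<in> carrier_mat n 1 \<Longrightarrow> fnorm y = 1 \<Longrightarrow> fnorm (B * y) \<le> fnorm (B * x)"
proof -
  define K :: "nat \<Rightarrow> quat set" where "K = (\<lambda>i. if i < n then cball 0 1 else {0})"
  define S where "S = Pi\<^sub>E UNIV K \<inter> {\<zeta>. fnorm (col_of n \<zeta>) = 1}"
  have "compactin (product_topology (\<lambda>_. euclidean) UNIV) (Pi\<^sub>E UNIV K)"
    by (simp add: compactin_PiE K_def)
  then have "compact (Pi\<^sub>E UNIV K)"
    by (simp add: euclidean_product_topology)
  moreover have "closed {\<zeta>. fnorm (col_of n \<zeta>) = 1}"
    by (intro closed_Collect_eq continuous_fnorm[OF cont_mat_col_of] continuous_intros)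
  ultimately have "compact S"
    unfolding S_def by (rule compact_Int_closed)
  have in_S: "(\<lambda>i. if i < n then x $$ (i, 0) else 0) \<in> S" if "x \<in> carrier_mat n 1" "fnorm x = 1" for x
  proof -
    have "norm (x $$ (i, 0)) \<le> 1" if "i < n" for i
    proof -
      have "(norm (x $$ (i, 0)))\<^sup>2 \<le> (\<Sum>i<n. (norm (x $$ (i, 0)))\<^sup>2)"
        using that by (intro member_le_sum) auto
      also have "\<dots> = 1"
        using fnorm_sq_col[of x n] \<open>x \<in> _\<close> \<open>fnorm x = 1\<close> by simp
      finally show ?thesis by (simp add: power_le_one_iff abs_square_le_1)
    qed
    moreover have "col_of n (\<lambda>i. if i < n then x $$ (i, 0) else 0) = x"
      using that by (intro eq_matI) (auto simp: col_of_def)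
    ultimately show ?thesis
      using that by (auto simp: S_def K_def)
  qed
  have "S \<noteq> {}" using in_S[of "unit_col n 0"] n by auto
  moreover have "continuous_on S (\<lambda>\<zeta>. fnorm (B * col_of n \<zeta>))"
    by (rule continuous_on_subset[OF continuous_fnorm])
      (auto intro!: cont_mat_mult[of m n _ 1] cont_mat_col_of cont_mat_const B)
  ultimately obtain \<zeta> where \<zeta>: "\<zeta> \<in> S" "\<And>\<xi>. \<xi> \<in> S \<Longrightarrow> fnorm (B * col_of n \<xi>) \<le> fnorm (B * col_of n \<zeta>)"
    using continuous_attains_sup[OF \<open>compact S\<close>] by blast
  show ?thesis
  proof
    show "col_of n \<zeta> \<in> carrier_mat n 1" "fnorm (col_of n \<zeta>) = 1"
      using \<zeta> by (auto simp: S_def)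
    fix y assume y: "y \<in> carrier_mat n 1" "fnorm y = 1"
    have "col_of n (\<lambda>i. if i < n then y $$ (i, 0) else 0) = y"
      using y by (intro eq_matI) (auto simp: col_of_def)
    then show "fnorm (B * y) \<le> fnorm (B * col_of n \<zeta>)"
      using \<zeta>(2)[OF in_S[OF y]] by simp
  qed
qed

lemma fnorm_le_of_unit_bound:
  assumes B: "B \<in> carrier_mat m n" and x: "x \<in> carrier_mat n 1"
    and bd: "\<And>y. y \<in> carrier_mat n 1 \<Longrightarrow> fnorm y = 1 \<Longrightarrow> fnorm (B * y) \<le> c"
  shows "fnorm (B * x) \<le> c * fnorm x"
proof (cases "fnorm x = 0")
  case True
  then have "x = 0\<^sub>m n 1" using x fnorm_eq_0_iff by blast
  then show ?thesis using B by (simp add: fnorm_def)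
next
  case False
  then have "0 < fnorm x" using fnorm_nonneg[of x] by linarith
  moreover have "fnorm (B * mat_scale (1 / fnorm x) x) \<le> c"
    using x False by (intro bd) (auto simp: fnorm_scale)
  ultimately show ?thesis
    using B x by (simp add: mult_mat_scale[of _ m n _ 1] fnorm_scale field_simps)
qed

text \<open>The block diagonal matrix with blocks \<open>c\<close> and \<open>X\<close>, the shape
  left by one deflation step.\<close>

definition bordered :: "real \<Rightarrow> quat mat \<Rightarrow> quat mat" where
  "bordered c X = Matrix.mat (Suc (dim_row X)) (Suc (dim_col X))
     (\<lambda>(i, j). if i = 0 \<and> j = 0 then quat_of_real c else if i = 0 \<or> j = 0 then 0 else X $$ (i - 1, j - 1))"

lemma bordered_carrier [simp]: "bordered c X \<in> carrier_mat (Suc a) (Suc b) \<longleftrightarrow> X \<in> carrier_mat a b"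
  by (auto simp: bordered_def intro!: carrier_matI dest: carrier_matD)

lemma bordered_dim [simp]: "dim_row (bordered c X) = Suc (dim_row X)" "dim_col (bordered c X) = Suc (dim_col X)"
  by (auto simp: bordered_def)

lemma bordered_index:
  "bordered c X $$ (0, 0) = quat_of_real c"
  "j < dim_col X \<Longrightarrow> bordered c X $$ (0, Suc j) = 0"
  "i < dim_row X \<Longrightarrow> bordered c X $$ (Suc i, 0) = 0"
  "i < dim_row X \<Longrightarrow> j < dim_col X \<Longrightarrow> bordered c X $$ (Suc i, Suc j) = X $$ (i, j)"
  by (auto simp: bordered_def)

lemma bordered_mult:
  assumes "X \<in> carrier_mat a b" "Y \<in> carrier_mat b d"
  shows "bordered r X * bordered s Y = bordered (r * s) (X * Y)"
proof (rule eq_matI)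
  fix i j assume "i < dim_row (bordered (r * s) (X * Y))" "j < dim_col (bordered (r * s) (X * Y))"
  then have ij: "i < Suc a" "j < Suc d" using assms by auto
  have "(bordered r X * bordered s Y) $$ (i, j)
    = (\<Sum>k<Suc b. bordered r X $$ (i, k) * bordered s Y $$ (k, j))"
    using assms ij by (intro mat_mult_entry) auto
  also have "\<dots> = bordered (r * s) (X * Y) $$ (i, j)"
    using assms ij unfolding sum.lessThan_Suc_shift
    by (cases i; cases j)
      (auto simp: bordered_index mat_mult_entry[of _ a b _ d] quat_of_real_eq_scaleR simp del: index_mult_mat(1))
  finally show "(bordered r X * bordered s Y) $$ (i, j) = bordered (r * s) (X * Y) $$ (i, j)" .
qed (use assms in auto)

lemma bordered_adjoint: "(bordered r X)\<^sup>\<dagger> = bordered r (X\<^sup>\<dagger>)"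
proof (rule eq_matI)
  fix i j assume "i < dim_row (bordered r (X\<^sup>\<dagger>))" "j < dim_col (bordered r (X\<^sup>\<dagger>))"
  then show "(bordered r X)\<^sup>\<dagger> $$ (i, j) = bordered r (X\<^sup>\<dagger>) $$ (i, j)"
    by (cases i; cases j) (auto simp: bordered_index conjugate_zero_quat quat_of_real_eq_scaleR
      conjugate_scaleR_quat conjugate_one_quat)
qed auto

lemma bordered_one: "bordered 1 (1\<^sub>m n) = 1\<^sub>m (Suc n)"
  by (rule eq_matI) (auto simp: bordered_def quat_of_real_eq_scaleR)

lemma bordered_unitary:
  "quat_unitary U \<Longrightarrow> U \<in> carrier_mat n n \<Longrightarrow> quat_unitary (bordered 1 U)"
  by (rule quat_unitaryI[of _ "Suc n"])
    (auto simp: bordered_adjoint bordered_mult[of _ n n _ n] quat_unitaryD bordered_one)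

lemma quat_diag_carrier [simp]: "quat_diag m n \<sigma> \<in> carrier_mat m n"
  by (simp add: quat_diag_def)

lemma quat_diag_dim [simp]: "dim_row (quat_diag m n \<sigma>) = m" "dim_col (quat_diag m n \<sigma>) = n"
  by (simp_all add: quat_diag_def)

lemma quat_diag_Suc: "quat_diag (Suc m) (Suc n) \<sigma> = bordered (\<sigma> 1) (quat_diag m n (\<lambda>i. \<sigma> (Suc i)))"
  by (rule eq_matI) (auto simp: quat_diag_def bordered_def)

lemma quat_diag_adjoint: "(quat_diag m n \<sigma>)\<^sup>\<dagger> = quat_diag n m \<sigma>"
  by (rule eq_matI) (auto simp: quat_diag_def quat_of_real_eq_scaleR conjugate_scaleR_quat
    conjugate_one_quat conjugate_zero_quat)

lemma quat_diag_mult_index: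
  assumes "z \<in> carrier_mat n c" "i < m" "j < c"
  shows "(quat_diag m n \<sigma> * z) $$ (i, j) = (if i < n then \<sigma> (Suc i) *\<^sub>R z $$ (i, j) else 0)"
  using assms
  by (subst mat_mult_entry[of _ m n _ c])
    (auto simp: quat_diag_def if_distrib[of "\<lambda>x. x * _"] quat_of_real_eq_scaleR cong: if_cong)

lemma fnorm_quat_diag_mult:
  assumes "z \<in> carrier_mat n 1"
  shows "(fnorm (quat_diag m n \<sigma> * z))\<^sup>2 = (\<Sum>i<min m n. (\<sigma> (Suc i))\<^sup>2 * (norm (z $$ (i, 0)))\<^sup>2)"
proof -
  have "(fnorm (quat_diag m n \<sigma> * z))\<^sup>2
      = (\<Sum>i<m. if i < n then (\<sigma> (Suc i))\<^sup>2 * (norm (z $$ (i, 0)))\<^sup>2 else 0)"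
    using assms
    by (subst fnorm_sq_col[of _ m])
      (auto simp: quat_diag_mult_index[of _ n 1] power_mult_distrib simp del: index_mult_mat(1) intro!: sum.cong)
  also have "\<dots> = (\<Sum>i\<in>{..<m} \<inter> {i. i < n}. (\<sigma> (Suc i))\<^sup>2 * (norm (z $$ (i, 0)))\<^sup>2)"
    by (simp add: sum.inter_restrict)
  also have "{..<m} \<inter> {i. i < n} = {..<min m n}" by auto
  finally show ?thesis .
qed

lemma is_qsvdD:
  assumes "is_qsvd A U \<sigma> V" "A \<in> carrier_mat m n"
  shows "U \<in> carrier_mat m m" "quat_unitary U" "V \<in> carrier_mat n n" "quat_unitary V"
    "A = U * quat_diag m n \<sigma> * V\<^sup>\<dagger>"
    "\<And>i. 1 \<le> i \<Longrightarrow> i \<le> min m n \<Longrightarrow> 0 \<le> \<sigma> i"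
    "\<And>i j. 1 \<le> i \<Longrightarrow> i \<le> j \<Longrightarrow> j \<le> min m n \<Longrightarrow> \<sigma> j \<le> \<sigma> i"
  using assms by (auto simp: is_qsvd_def monotone_on_def)

lemma qsvd_fnorm:
  assumes "is_qsvd A U \<sigma> V" "A \<in> carrier_mat m n" "x \<in> carrier_mat n 1"
  shows "fnorm (A * x) = fnorm (quat_diag m n \<sigma> * (V\<^sup>\<dagger> * x))"
proof -
  note D = is_qsvdD[OF assms(1,2)]
  have "A * x = U * (quat_diag m n \<sigma> * (V\<^sup>\<dagger> * x))"
    using D assms(3)
    by (simp add: assoc_mult_mat[of _ m n _ n _ 1] assoc_mult_mat[of _ m m _ n _ 1])
  then show ?thesis
    using fnorm_unitary_mult[OF D(2,1), of "quat_diag m n \<sigma> * (V\<^sup>\<dagger> * x)" 1] D(3) assms(3)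
    by (simp add: mult_carrier_mat[of _ m n _ "Suc 0"] mult_carrier_mat[of _ n n _ "Suc 0"])
qed

lemma qsvd_norm_le:
  assumes "is_qsvd A U \<sigma> V" "A \<in> carrier_mat m n" "x \<in> carrier_mat n 1" "0 < m" "0 < n"
  shows "fnorm (A * x) \<le> \<sigma> 1 * fnorm x"
proof (rule power2_le_imp_le)
  note D = is_qsvdD[OF assms(1,2)]
  define z where "z = V\<^sup>\<dagger> * x"
  have z: "z \<in> carrier_mat n 1" "fnorm z = fnorm x"
    using D assms(3) by (auto simp: z_def fnorm_unitary_mult[of _ n _ 1] quat_unitary_adjoint)
  have "(fnorm (A * x))\<^sup>2 = (\<Sum>i<min m n. (\<sigma> (Suc i))\<^sup>2 * (norm (z $$ (i, 0)))\<^sup>2)"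
    using z by (simp add: qsvd_fnorm[OF assms(1-3)] fnorm_quat_diag_mult flip: z_def)
  also have "\<dots> \<le> (\<Sum>i<min m n. (\<sigma> 1)\<^sup>2 * (norm (z $$ (i, 0)))\<^sup>2)"
    using D(6,7) assms(4,5) by (intro sum_mono mult_right_mono power_mono) auto
  also have "\<dots> \<le> (\<Sum>i<n. (\<sigma> 1)\<^sup>2 * (norm (z $$ (i, 0)))\<^sup>2)"
    by (intro sum_mono2) auto
  also have "\<dots> = (\<sigma> 1 * fnorm x)\<^sup>2"
    using z fnorm_sq_col[of z n] by (simp add: power_mult_distrib sum_distrib_left)
  finally show "(fnorm (A * x))\<^sup>2 \<le> (\<sigma> 1 * fnorm x)\<^sup>2" .
  show "0 \<le> \<sigma> 1 * fnorm x" using D(6)[of 1] assms(4,5) by simp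
qed

lemma qsvd_norm_attained:
  assumes "is_qsvd A U \<sigma> V" "A \<in> carrier_mat m n" "0 < m" "0 < n"
  shows "fnorm (A * (V * unit_col n 0)) = \<sigma> 1" "fnorm (V * unit_col n 0) = 1"
proof -
  note D = is_qsvdD[OF assms(1,2)]
  have "V\<^sup>\<dagger> * (V * unit_col n 0) = unit_col n 0"
    using D(3,4) by (intro mat_assoc_cancel[of _ n n _ _ 1]) (auto simp: quat_unitaryD)
  then have "fnorm (A * (V * unit_col n 0)) = fnorm (quat_diag m n \<sigma> * unit_col n 0)"
    using qsvd_fnorm[OF assms(1,2), of "V * unit_col n 0"] D(3)
    by (simp add: mult_carrier_mat[of _ n n _ "Suc 0"])
  then have "(fnorm (A * (V * unit_col n 0)))\<^sup>2 = (\<Sum>i<min m n. (\<sigma> (Suc i))\<^sup>2 * (norm (unit_col n 0 $$ (i, 0)))\<^sup>2)"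
    by (simp add: fnorm_quat_diag_mult)
  also have "\<dots> = (\<Sum>i<min m n. if i = 0 then (\<sigma> 1)\<^sup>2 else 0)"
    by (intro sum.cong) auto
  also have "\<dots> = (\<sigma> 1)\<^sup>2" using assms by simp
  finally show "fnorm (A * (V * unit_col n 0)) = \<sigma> 1"
    by (rule power2_eq_imp_eq[OF _ fnorm_nonneg]) (use D(6)[of 1] assms(3,4) in auto)
  show "fnorm (V * unit_col n 0) = 1"
    using fnorm_unitary_mult[OF D(4,3), of "unit_col n 0" 1] assms(4) by simp
qed

text \<open>In orthonormal bases beginning with a direction \<open>x\<close> of maximal stretch and
  with the direction of \<open>B * x\<close>, the first column is \<open>s\<close> times a
  coordinate column. The rest of the first row then vanishes, since otherwise the adjoint of this
  row would be stretched by more than \<open>s\<close>.\<close>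

lemma exists_deflation:
  assumes B: "B \<in> carrier_mat (Suc m) (Suc n)"
  obtains U V s B' where "U \<in> carrier_mat (Suc m) (Suc m)" "quat_unitary U"
    "V \<in> carrier_mat (Suc n) (Suc n)" "quat_unitary V" "B' \<in> carrier_mat m n"
    "B = U * bordered s B' * V\<^sup>\<dagger>" "0 \<le> s"
    "\<And>y. y \<in> carrier_mat n 1 \<Longrightarrow> fnorm y = 1 \<Longrightarrow> fnorm (B' * y) \<le> s"
proof -
  obtain x where x: "x \<in> carrier_mat (Suc n) 1" "fnorm x = 1"
    and mx: "\<And>y. y \<in> carrier_mat (Suc n) 1 \<Longrightarrow> fnorm y = 1 \<Longrightarrow> fnorm (B * y) \<le> fnorm (B * x)"
    using exists_max_stretch[OF B] by auto
  define s where "s = fnorm (B * x)"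
  \<comment> \<open>For \<open>s = 0\<close> the image has no direction and any unit column
    serves.\<close>
  define u where "u = (if s = 0 then unit_col (Suc m) 0 else mat_scale (1 / s) (B * x))"
  have Bx: "B * x \<in> carrier_mat (Suc m) 1" using B x by auto
  have u: "u \<in> carrier_mat (Suc m) 1" "fnorm u = 1"
    using Bx by (auto simp: u_def fnorm_scale) (auto simp: s_def)
  have Bxu: "B * x = mat_scale s u"
  proof (cases "s = 0")
    case True
    then have "B * x = 0\<^sub>m (Suc m) 1" using Bx fnorm_eq_0_iff unfolding s_def by blast
    then show ?thesis using True by (auto simp: u_def intro!: eq_matI)
  qed (simp add: u_def mat_scale_scale)
  obtain U where U: "U \<in> carrier_mat (Suc m) (Suc m)" "quat_unitary U" "U * unit_col (Suc m) 0 = u"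
    using exists_unitary_first_col[OF u] .
  obtain V where V: "V \<in> carrier_mat (Suc n) (Suc n)" "quat_unitary V" "V * unit_col (Suc n) 0 = x"
    using exists_unitary_first_col[OF x] .
  define C where "C = U\<^sup>\<dagger> * (B * V)"
  have C: "C \<in> carrier_mat (Suc m) (Suc n)" using U V B by (auto simp: C_def)
  have Cnorm: "fnorm (C * y) \<le> s * fnorm y" if "y \<in> carrier_mat (Suc n) 1" for y
  proof -
    have "C * y = U\<^sup>\<dagger> * (B * (V * y))"
      using U V B that by (simp add: C_def assoc_mult_mat[of _ "Suc m" "Suc m" _ "Suc n" _ 1]
        assoc_mult_mat[of _ "Suc m" "Suc n" _ "Suc n" _ 1])
    then have "fnorm (C * y) = fnorm (B * (V * y))"
      using U V B that by (simp add: fnorm_unitary_mult[of _ "Suc m" _ 1] quat_unitary_adjoint)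
    also have "\<dots> \<le> s * fnorm (V * y)"
      unfolding s_def using V B that mx by (intro fnorm_le_of_unit_bound[of _ "Suc m" "Suc n"]) auto
    finally show ?thesis using V that by (simp add: fnorm_unitary_mult[of _ "Suc n" _ 1])
  qed
  have Ce: "C * unit_col (Suc n) 0 = mat_scale s (unit_col (Suc m) 0)"
  proof -
    have "C * unit_col (Suc n) 0 = U\<^sup>\<dagger> * (B * (V * unit_col (Suc n) 0))"
      using U V B by (simp add: C_def assoc_mult_mat[of _ "Suc m" "Suc m" _ "Suc n" _ 1]
        assoc_mult_mat[of _ "Suc m" "Suc n" _ "Suc n" _ 1])
    also have "\<dots> = mat_scale s (U\<^sup>\<dagger> * (U * unit_col (Suc m) 0))"
      using U u by (simp add: V Bxu mult_mat_scale[of _ "Suc m" "Suc m" _ 1])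
    also have "U\<^sup>\<dagger> * (U * unit_col (Suc m) 0) = unit_col (Suc m) 0"
      using U(1,2) by (intro mat_assoc_cancel[of _ "Suc m" "Suc m" _ _ 1]) (auto simp: quat_unitaryD)
    finally show ?thesis .
  qed
  have C0: "C $$ (i, 0) = (if i = 0 then s *\<^sub>R 1 else 0)" if "i < Suc m" for i
  proof -
    have "C $$ (i, 0) = (C * unit_col (Suc n) 0) $$ (i, 0)"
      using mult_unit_col_index[OF C, of 0 i] that by (simp del: index_mult_mat(1))
    also have "\<dots> = (if i = 0 then s *\<^sub>R 1 else 0)"
      unfolding Ce using that by simp
    finally show ?thesis .
  qed
  \<comment> \<open>The adjoint of the first row. Its squared norm is the first entry of
    \<open>C * y\<close>, hence at most \<open>s * fnorm y\<close>, so it cannot exceed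
    \<open>s\<^sup>2\<close>, which its first entry already uses up.\<close>
  define y where "y = C\<^sup>\<dagger> * unit_col (Suc m) 0"
  have y: "y \<in> carrier_mat (Suc n) 1" using C by (auto simp: y_def)
  have yj: "y $$ (j, 0) = conjugate (C $$ (0, j))" if "j < Suc n" for j
    using that C by (simp add: y_def mult_unit_col_index[of _ "Suc n" "Suc m"] del: index_mult_mat(1))
  have "(fnorm y)\<^sup>2 = mat_inner (unit_col (Suc m) 0) (C * y)"
    using C mat_inner_mult_left[of "C\<^sup>\<dagger>" "Suc n" "Suc m" "unit_col (Suc m) 0" 1 y] y
    by (simp add: fnorm_sq flip: y_def)
  also have "\<dots> \<le> fnorm (unit_col (Suc m) 0) * fnorm (C * y)"
    using C y mat_inner_Cauchy_Schwarz[of "unit_col (Suc m) 0" "Suc m" 1 "C * y"] by auto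
  also have "\<dots> \<le> s * fnorm y" using Cnorm[OF y] by simp
  finally have "fnorm y \<le> s \<or> fnorm y = 0"
    using fnorm_nonneg[of y] by (auto simp: power2_eq_square mult_le_cancel_right order_less_le)
  then have "(fnorm y)\<^sup>2 \<le> s\<^sup>2"
    by (auto simp: s_def intro!: power_mono)
  moreover have "(fnorm y)\<^sup>2 = s\<^sup>2 + (\<Sum>j<n. (norm (C $$ (0, Suc j)))\<^sup>2)"
    using y yj C0[of 0] by (subst fnorm_sq_col[of _ "Suc n"])
      (auto simp: norm_conjugate_quat sum.lessThan_Suc_shift simp del: sum.lessThan_Suc)
  ultimately have "(\<Sum>j<n. (norm (C $$ (0, Suc j)))\<^sup>2) = 0"
    using sum_nonneg[of "{..<n}" "\<lambda>j. (norm (C $$ (0, Suc j)))\<^sup>2"] by auto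
  then have C0': "C $$ (0, Suc j) = 0" if "j < n" for j
    using that by (simp add: sum_nonneg_eq_0_iff)
  define B' where "B' = Matrix.mat m n (\<lambda>(i, j). C $$ (Suc i, Suc j))"
  have B': "B' \<in> carrier_mat m n" by (simp add: B'_def)
  have CB: "C = bordered s B'"
  proof (rule eq_matI)
    fix i j assume "i < dim_row (bordered s B')" "j < dim_col (bordered s B')"
    then have "i < Suc m" "j < Suc n" using B' by auto
    then show "C $$ (i, j) = bordered s B' $$ (i, j)"
      by (cases i; cases j) (auto simp: bordered_def C0 C0' B'_def quat_of_real_eq_scaleR)
  qed (use C B' in auto)
  show ?thesis
  proof
    have "U * C * V\<^sup>\<dagger> = U * (C * V\<^sup>\<dagger>)"
      using U V C by (simp add: assoc_mult_mat[of _ "Suc m" "Suc m" _ "Suc n" _ "Suc n"])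
    also have "C * V\<^sup>\<dagger> = U\<^sup>\<dagger> * (B * (V * V\<^sup>\<dagger>))"
      using U V B by (simp add: C_def assoc_mult_mat[of _ "Suc m" "Suc m" _ "Suc n" _ "Suc n"]
        assoc_mult_mat[of _ "Suc m" "Suc n" _ "Suc n" _ "Suc n"])
    also have "U * \<dots> = B"
      using U V B by (simp add: quat_unitaryD mat_assoc_cancel[of _ "Suc m" "Suc m"])
    finally show "B = U * bordered s B' * V\<^sup>\<dagger>" by (simp add: CB)
    show "0 \<le> s" by (simp add: s_def)
    fix z assume z: "z \<in> carrier_mat n 1" "fnorm z = 1"
    \<comment> \<open>Padding with a zero on top shows that \<open>B'\<close> stretches no more than
      \<open>C\<close>.\<close>
    define z' where "z' = Matrix.mat (Suc n) 1 (\<lambda>(i, _). if i = 0 then 0 else z $$ (i - 1, 0))"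
    have z': "z' \<in> carrier_mat (Suc n) 1" by (simp add: z'_def)
    have "(fnorm z')\<^sup>2 = (fnorm z)\<^sup>2"
      using z' unfolding fnorm_sq_col[OF z(1)] by (simp add: fnorm_sq_col[of _ "Suc n"] sum.lessThan_Suc_shift z'_def
        del: sum.lessThan_Suc)
    then have "fnorm z' = 1" using z by (simp add: power2_eq_1_iff) (metis fnorm_nonneg neg_0_le_iff_le not_one_le_zero)
    have "(C * z') $$ (Suc i, 0) = (B' * z) $$ (i, 0)" if "i < m" for i
      using that z z' C B' unfolding CB
      by (simp add: mat_mult_entry[of _ "Suc m" "Suc n" _ 1] mat_mult_entry[of _ m n _ 1]
        sum.lessThan_Suc_shift bordered_index del: index_mult_mat(1) sum.lessThan_Suc) (simp add: z'_def)
    then have "(fnorm (B' * z))\<^sup>2 \<le> (fnorm (C * z'))\<^sup>2"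
      using z z' C B' by (simp add: fnorm_sq_col[of _ "Suc m"] fnorm_sq_col[of _ m] sum.lessThan_Suc_shift
        del: index_mult_mat(1) sum.lessThan_Suc)
    then have "fnorm (B' * z) \<le> fnorm (C * z')"
      by (rule power2_le_imp_le) simp
    also have "\<dots> \<le> s" using Cnorm[OF z'] \<open>fnorm z' = 1\<close> by simp
    finally show "fnorm (B' * z) \<le> s" .
  qed (use U V B' in auto)
qed

text \<open>Induction by deflation. The stretch bound on the remaining block keeps the singular
  values nonincreasing, because its first singular value is an attained stretch.\<close>

theorem qsvd_exists:
  assumes "A \<in> carrier_mat m n"
  shows "\<exists>U \<sigma> V. is_qsvd A U \<sigma> V"
  using assms
proof (induction m arbitrary: n A)
  case 0
  then have "is_qsvd A (1\<^sub>m 0) (\<lambda>_. 0) (1\<^sub>m n)"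
    by (auto simp: is_qsvd_def monotone_on_def intro!: eq_matI)
  then show ?case by blast
next
  case (Suc m)
  show ?case
  proof (cases n)
    case 0
    then have "is_qsvd A (1\<^sub>m (Suc m)) (\<lambda>_. 0) (1\<^sub>m 0)"
      using Suc.prems by (auto simp: is_qsvd_def monotone_on_def intro!: eq_matI)
    then show ?thesis by blast
  next
    case [simp]: (Suc n')
    obtain U V s B where U: "U \<in> carrier_mat (Suc m) (Suc m)" "quat_unitary U"
      and V: "V \<in> carrier_mat (Suc n') (Suc n')" "quat_unitary V" and B: "B \<in> carrier_mat m n'"
      and A: "A = U * bordered s B * V\<^sup>\<dagger>" "0 \<le> s"
      and mx: "\<And>y. y \<in> carrier_mat n' 1 \<Longrightarrow> fnorm y = 1 \<Longrightarrow> fnorm (B * y) \<le> s"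
      by (rule exists_deflation[OF Suc.prems[unfolded Suc]]) (rule that; assumption)
    obtain U' \<sigma> V' where svd: "is_qsvd B U' \<sigma> V'" using Suc.IH[OF B] by blast
    note D = is_qsvdD[OF svd B]
    \<comment> \<open>Singular values are numbered from 1, so \<open>s\<close> takes index 1 and the
      others move up by one.\<close>
    define \<tau> where "\<tau> i = (if i = 1 then s else \<sigma> (i - 1))" for i :: nat
    have le: "\<sigma> i \<le> s" if "1 \<le> i" "i \<le> min m n'" for i
    proof -
      have "fnorm (B * (V' * unit_col n' 0)) \<le> s"
        using D that by (intro mx) (auto simp: fnorm_unitary_mult[of _ n' _ 1] intro!: mult_carrier_mat)
      then show ?thesis
        using qsvd_norm_attained[OF svd B] D(7)[of 1 i] that by auto
    qed
    have "is_qsvd A (U * bordered 1 U') \<tau> (V * bordered 1 V')"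
      unfolding is_qsvd_def
    proof (intro conjI ballI)
      have dims: "dim_row A = Suc m" "dim_col A = Suc n'" using Suc.prems by auto
      show "U * bordered 1 U' \<in> carrier_mat (dim_row A) (dim_row A)"
        "V * bordered 1 V' \<in> carrier_mat (dim_col A) (dim_col A)"
        using U V D by (auto simp: dims intro!: mult_carrier_mat[of _ _ "Suc m"] mult_carrier_mat[of _ _ "Suc n'"])
      show "quat_unitary (U * bordered 1 U')"
        using U D(1,2) by (intro quat_unitary_mult[of _ "Suc m"] bordered_unitary) auto
      show "quat_unitary (V * bordered 1 V')"
        using V D(3,4) by (intro quat_unitary_mult[of _ "Suc n'"] bordered_unitary) auto
      show "0 \<le> \<tau> i" if "i \<in> {1..min (dim_row A) (dim_col A)}" for i
      proof (cases "i = 1")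
        case False
        then have "1 \<le> i - 1" "i - 1 \<le> min m n'" using that unfolding dims by auto
        then show ?thesis using D(6)[of "i - 1"] False by (simp add: \<tau>_def)
      qed (simp add: \<tau>_def A)
      show "antimono_on {1..min (dim_row A) (dim_col A)} \<tau>"
      proof (rule monotone_onI)
        fix i j assume "i \<in> {1..min (dim_row A) (dim_col A)}" "j \<in> {1..min (dim_row A) (dim_col A)}" "i \<le> j"
        moreover from this obtain i' j' where "i = Suc i'" "j = Suc j'"
          by (cases i; cases j) auto
        ultimately show "\<tau> j \<le> \<tau> i"
          using D(7)[of i' j'] le[of j'] unfolding dims \<tau>_def
          by (cases "i' = 0"; cases "j' = 0") auto
      qed
      have "bordered s B = bordered 1 U' * (bordered s (quat_diag m n' \<sigma>) * bordered 1 (V'\<^sup>\<dagger>))"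
        using D(1,3) by (subst D(5)) (simp add: bordered_mult[of _ m n' _ n'] bordered_mult[of _ m m _ n']
          assoc_mult_mat[of _ m m _ n' _ n'] mult_carrier_mat[of _ m n' _ n'])
      also have "bordered s (quat_diag m n' \<sigma>) = quat_diag (Suc m) (Suc n') \<tau>"
        unfolding quat_diag_Suc by (rule eq_matI) (auto simp: bordered_def quat_diag_def \<tau>_def)
      also have "bordered 1 (V'\<^sup>\<dagger>) = (bordered 1 V')\<^sup>\<dagger>" by (simp add: bordered_adjoint)
      finally show "A = U * bordered 1 U' * quat_diag (dim_row A) (dim_col A) \<tau> * (V * bordered 1 V')\<^sup>\<dagger>"
        using U V D(1,3) unfolding A dims[unfolded A]
        by (simp add: quat_adjoint_mult[of _ "Suc n'" "Suc n'" _ "Suc n'"]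
          assoc_mult_mat[of _ "Suc m" "Suc m" _ "Suc n'" _ "Suc n'"]
          assoc_mult_mat[of _ "Suc m" "Suc m" _ "Suc m" _ "Suc n'"]
          assoc_mult_mat[of _ "Suc m" "Suc n'" _ "Suc n'" _ "Suc n'"]
          mult_carrier_mat[of _ "Suc m" "Suc m" _ "Suc m"]
          mult_carrier_mat[of _ "Suc m" "Suc m" _ "Suc n'"]
          mult_carrier_mat[of _ "Suc m" "Suc n'" _ "Suc n'"]
          mult_carrier_mat[of _ "Suc n'" "Suc n'" _ "Suc n'"])
    qed
    then show ?thesis by blast
  qed
qed

text \<open>The description by \<open>THE\<close> is meaningful because the first singular value is
  the maximal stretch: attained through one decomposition, it is bounded through any other.\<close>

lemma quat_spectral_norm_eq:
  assumes "is_qsvd A U \<sigma> V" "A \<in> carrier_mat m n" "0 < m" "0 < n"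
  shows "quat_spectral_norm A = \<sigma> 1"
proof -
  have Max: "Max (\<sigma>' ` {1..min (dim_row A) (dim_col A)}) = \<sigma>' 1" if "is_qsvd A U' \<sigma>' V'" for U' \<sigma>' V'
  proof (rule Max_eqI)
    fix y assume "y \<in> \<sigma>' ` {1..min (dim_row A) (dim_col A)}"
    then show "y \<le> \<sigma>' 1" using is_qsvdD(7)[OF that assms(2), of 1] assms(2) by auto
  qed (use assms in auto)
  have le: "\<sigma>1 1 \<le> \<sigma>2 1" if "is_qsvd A U1 \<sigma>1 V1" "is_qsvd A U2 \<sigma>2 V2" for U1 \<sigma>1 V1 U2 \<sigma>2 V2
    using qsvd_norm_le[OF that(2) assms(2) _ assms(3,4), of "V1 * unit_col n 0"]
      qsvd_norm_attained[OF that(1) assms(2-4)] is_qsvdD(3)[OF that(1) assms(2)]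
    by (auto simp: mult_carrier_mat[of _ n n])
  show ?thesis
    unfolding quat_spectral_norm_def
  proof (rule the_equality)
    show "\<exists>U' \<sigma>' V'. is_qsvd A U' \<sigma>' V' \<and> \<sigma> 1 = Max (\<sigma>' ` {1..min (dim_row A) (dim_col A)})"
      using Max[OF assms(1)] assms(1) by metis
  qed (metis Max assms(1) le order.antisym)
qed

lemma spectral_norm_bound:
  assumes "A \<in> carrier_mat m n" "0 < m" "0 < n" "x \<in> carrier_mat n 1"
  shows "fnorm (A * x) \<le> quat_spectral_norm A * fnorm x"
  using qsvd_exists[OF assms(1)] quat_spectral_norm_eq[OF _ assms(1-3)] qsvd_norm_le[OF _ assms(1,4,2,3)]
  by metis

lemma spectral_norm_attained:
  assumes "A \<in> carrier_mat m n" "0 < m" "0 < n"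
  obtains x where "x \<in> carrier_mat n 1" "fnorm x = 1" "fnorm (A * x) = quat_spectral_norm A"
proof -
  obtain U \<sigma> V where svd: "is_qsvd A U \<sigma> V" using qsvd_exists[OF assms(1)] by blast
  show ?thesis
    by (rule that[of "V * unit_col n 0"])
      (use qsvd_norm_attained[OF svd assms] quat_spectral_norm_eq[OF svd assms] is_qsvdD(3)[OF svd assms(1)] in auto)
qed

subsection \<open>Standard Gaussian measures on finite index sets\<close>

definition gauss :: "'i set \<Rightarrow> ('i \<Rightarrow> real) measure" where
  "gauss I = PiM I (\<lambda>_. density lborel (\<lambda>x. ennreal (std_normal_density x)))"

interpretation std_normal: prob_space "density lborel (\<lambda>x. ennreal (std_normal_density x))"
  by (rule prob_space_normal_density) simp

interpretation gauss: product_prob_space "\<lambda>_::'i. density lborel (\<lambda>x. ennreal (std_normal_density x))" UNIV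
  by standard

interpretation lebesgue_pi: product_sigma_finite "\<lambda>_::'i. lborel :: real measure"
  by standard

lemma sets_gauss [measurable_cong, simp]: "sets (gauss I) = sets (PiM I (\<lambda>_. borel))"
  unfolding gauss_def by (intro sets_PiM_cong) auto

lemma sets_lebesgue_pi [measurable_cong, simp]:
  "sets (PiM I (\<lambda>_. lborel :: real measure)) = sets (PiM I (\<lambda>_. borel))"
  by (intro sets_PiM_cong) auto

lemma space_gauss [simp]: "space (gauss I) = I \<rightarrow>\<^sub>E UNIV"
  by (simp add: gauss_def space_PiM)

lemma prob_space_gauss: "prob_space (gauss I)"
  unfolding gauss_def by (rule prob_space_PiM) (rule std_normal.prob_space_axioms)

lemma sigma_finite_gauss: "sigma_finite_measure (gauss I)"
  using prob_space_gauss prob_space_imp_sigma_finite by blast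

lemma sigma_finite_lebesgue_pi: "finite I \<Longrightarrow> sigma_finite_measure (PiM I (\<lambda>_. lborel :: real measure))"
  by (rule lebesgue_pi.sigma_finite)

definition gauss_dens :: "'i set \<Rightarrow> ('i \<Rightarrow> real) \<Rightarrow> real" where
  "gauss_dens I x = (1 / sqrt (2 * pi)) ^ card I * exp (- (\<Sum>i\<in>I. (x i)\<^sup>2) / 2)"

lemma gauss_dens_pos: "0 < gauss_dens I x"
  by (simp add: gauss_dens_def)

lemma gauss_dens_prod:
  "finite I \<Longrightarrow> ennreal (gauss_dens I x) = (\<Prod>i\<in>I. ennreal (std_normal_density (x i)))"
  unfolding gauss_dens_def std_normal_density_def
  by (subst prod_ennreal) (auto simp: prod.distrib prod_dividef exp_sum sum_divide_distrib power_divide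
    simp flip: exp_sum sum_negf)

lemma measurable_gauss_dens [measurable]: "gauss_dens I \<in> borel_measurable (PiM I (\<lambda>_. borel))"
  unfolding gauss_dens_def by measurable

lemma gauss_eq_density:
  fixes I :: "'i set"
  assumes "finite I"
  shows "gauss I = density (PiM I (\<lambda>_. lborel)) (\<lambda>x. ennreal (gauss_dens I x))"
proof -
  have "density (PiM I (\<lambda>_. lborel)) (\<lambda>x. ennreal (gauss_dens I x)) = gauss I"
    unfolding gauss_def
  proof (rule gauss.PiM_eqI[OF assms])
    show "sets (density (PiM I (\<lambda>_. lborel)) (\<lambda>x. ennreal (gauss_dens I x)))
      = sets (PiM I (\<lambda>_. density lborel (\<lambda>x. ennreal (std_normal_density x))))"
      using sets_gauss[of I] by (simp add: gauss_def)
    fix A :: "'i \<Rightarrow> real set"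
    assume "\<And>i. i \<in> I \<Longrightarrow> A i \<in> sets (density lborel (\<lambda>x. ennreal (std_normal_density x)))"
    then have A [measurable]: "\<And>i. i \<in> I \<Longrightarrow> A i \<in> sets borel" by simp
    have PA: "Pi\<^sub>E I A \<in> sets (PiM I (\<lambda>_. borel))"
      using assms A by (auto intro!: sets_PiM_I_finite)
    have "emeasure (density (PiM I (\<lambda>_. lborel)) (\<lambda>x. ennreal (gauss_dens I x))) (Pi\<^sub>E I A)
        = (\<integral>\<^sup>+x. ennreal (gauss_dens I x) * indicator (Pi\<^sub>E I A) x \<partial>PiM I (\<lambda>_. lborel))"
      using PA by (subst emeasure_density) auto
    also have "\<dots> = (\<integral>\<^sup>+x. (\<Prod>i\<in>I. ennreal (std_normal_density (x i)) * indicator (A i) (x i)) \<partial>PiM I (\<lambda>_. lborel))"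
    proof (rule nn_integral_cong)
      fix x :: "'i \<Rightarrow> real" assume "x \<in> space (PiM I (\<lambda>_. lborel))"
      then have "(indicator (Pi\<^sub>E I A) x :: ennreal) = (\<Prod>i\<in>I. indicator (A i) (x i))"
        using assms by (auto simp: indicator_def space_PiM PiE_iff prod_zero_iff)
      then show "ennreal (gauss_dens I x) * indicator (Pi\<^sub>E I A) x
        = (\<Prod>i\<in>I. ennreal (std_normal_density (x i)) * indicator (A i) (x i))"
        using assms by (simp add: gauss_dens_prod prod.distrib)
    qed
    also have "\<dots> = (\<Prod>i\<in>I. \<integral>\<^sup>+x. ennreal (std_normal_density x) * indicator (A i) x \<partial>lborel)"
      using assms by (intro lebesgue_pi.product_nn_integral_prod) auto
    also have "\<dots> = (\<Prod>i\<in>I. emeasure (density lborel (\<lambda>x. ennreal (std_normal_density x))) (A i))"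
      using A by (intro prod.cong refl) (simp add: emeasure_density)
    finally show "emeasure (density (PiM I (\<lambda>_. lborel)) (\<lambda>x. ennreal (gauss_dens I x))) (Pi\<^sub>E I A)
      = (\<Prod>i\<in>I. emeasure (density lborel (\<lambda>x. ennreal (std_normal_density x))) (A i))" .
  qed
  then show ?thesis by simp
qed

lemma nn_integral_gauss:
  assumes "finite I" and [measurable]: "f \<in> borel_measurable (PiM I (\<lambda>_. borel))"
  shows "(\<integral>\<^sup>+x. f x \<partial>gauss I) = (\<integral>\<^sup>+x. ennreal (gauss_dens I x) * f x \<partial>PiM I (\<lambda>_. lborel))"
  unfolding gauss_eq_density[OF assms(1)] by (rule nn_integral_density) measurable

text \<open>Restricted to \<open>I\<close>, so that sums stay inside the extensional product
  space.\<close>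

definition ext_add :: "'i set \<Rightarrow> ('i \<Rightarrow> real) \<Rightarrow> ('i \<Rightarrow> real) \<Rightarrow> 'i \<Rightarrow> real" where
  "ext_add I x y = (\<lambda>i\<in>I. x i + y i)"

lemma measurable_ext_add [measurable (raw)]:
  assumes "f \<in> N \<rightarrow>\<^sub>M PiM I (\<lambda>_. borel)" "g \<in> N \<rightarrow>\<^sub>M PiM I (\<lambda>_. borel)"
  shows "(\<lambda>w. ext_add I (f w) (g w)) \<in> N \<rightarrow>\<^sub>M PiM I (\<lambda>_. borel)"
  unfolding ext_add_def
  by (intro measurable_restrict borel_measurable_add measurable_compose[OF assms(1)]
    measurable_compose[OF assms(2)] measurable_component_singleton)

lemma nn_integral_lebesgue_pi_translate:
  fixes I :: "'i set"
  assumes "finite I" and [measurable]: "f \<in> borel_measurable (PiM I (\<lambda>_. borel))"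
    and a: "a \<in> I \<rightarrow>\<^sub>E UNIV"
  shows "(\<integral>\<^sup>+x. f (ext_add I x a) \<partial>PiM I (\<lambda>_. lborel)) = (\<integral>\<^sup>+x. f x \<partial>PiM I (\<lambda>_. lborel))"
proof -
  have [measurable]: "(\<lambda>x. ext_add I x a) \<in> PiM I (\<lambda>_. borel) \<rightarrow>\<^sub>M PiM I (\<lambda>_. borel)"
    using a by (intro measurable_ext_add) (auto simp: space_PiM)
  have "distr (PiM I (\<lambda>_. lborel)) (PiM I (\<lambda>_. borel)) (\<lambda>x. ext_add I x a) = PiM I (\<lambda>_. lborel)"
  proof (rule lebesgue_pi.PiM_eqI[OF assms(1)])
    fix A :: "'i \<Rightarrow> real set" assume "\<And>i. i \<in> I \<Longrightarrow> A i \<in> sets lborel"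
    then have A [measurable]: "\<And>i. i \<in> I \<Longrightarrow> A i \<in> sets borel" by simp
    have "emeasure (distr (PiM I (\<lambda>_. lborel)) (PiM I (\<lambda>_. borel)) (\<lambda>x. ext_add I x a)) (Pi\<^sub>E I A)
      = emeasure (PiM I (\<lambda>_. lborel)) ((\<lambda>x. ext_add I x a) -` Pi\<^sub>E I A \<inter> space (PiM I (\<lambda>_. lborel)))"
      using assms(1) A by (intro emeasure_distr) (auto intro!: sets_PiM_I_finite)
    also have "(\<lambda>x. ext_add I x a) -` Pi\<^sub>E I A \<inter> space (PiM I (\<lambda>_. lborel)) = Pi\<^sub>E I (\<lambda>i. (\<lambda>x. a i + x) -` A i)"
      by (auto simp: space_PiM PiE_iff ext_add_def add.commute)
    also have "emeasure (PiM I (\<lambda>_. lborel)) \<dots> = (\<Prod>i\<in>I. emeasure lborel ((\<lambda>x. a i + x) -` A i))"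
      using A measurable_sets[of "(+) (a _)" borel borel] by (intro lebesgue_pi.emeasure_PiM assms(1)) auto
    also have "\<dots> = (\<Prod>i\<in>I. emeasure lborel (A i))"
    proof (intro prod.cong refl)
      fix i assume "i \<in> I"
      then have "emeasure (distr lborel borel ((+) (a i))) (A i) = emeasure lborel ((+) (a i) -` A i)"
        using A by (subst emeasure_distr) auto
      then show "emeasure lborel ((+) (a i) -` A i) = emeasure lborel (A i)"
        by (simp add: lborel_distr_plus)
    qed
    finally show "emeasure (distr (PiM I (\<lambda>_. lborel)) (PiM I (\<lambda>_. borel)) (\<lambda>x. ext_add I x a)) (Pi\<^sub>E I A)
      = (\<Prod>i\<in>I. emeasure lborel (A i))" .
  qed simp
  then have "(\<integral>\<^sup>+x. f x \<partial>PiM I (\<lambda>_. lborel))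
    = (\<integral>\<^sup>+x. f x \<partial>distr (PiM I (\<lambda>_. lborel)) (PiM I (\<lambda>_. borel)) (\<lambda>x. ext_add I x a))"
    by simp
  also have "\<dots> = (\<integral>\<^sup>+x. f (ext_add I x a) \<partial>PiM I (\<lambda>_. lborel))"
    by (rule nn_integral_distr) simp_all
  finally show ?thesis by simp
qed

text \<open>Rotation invariance without Jacobians: with \<open>h\<close> arbitrary and \<open>g x = exp (- |x|\<^sup>2 / 2)\<close>, translation
  invariance of Lebesgue measure alone turns \<open>\<integral>\<integral> h (L x) g y\<close> into \<open>\<integral>\<integral> h (L x + y) g y\<close>, then into
  \<open>\<integral>\<integral> h y g (y - L x)\<close>, and finally into \<open>\<integral>\<integral> h y g (- L x)\<close>.\<close>

lemma nn_integral_gauss_isometry: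
  fixes I :: "'i set"
  assumes I: "finite I" and f: "f \<in> borel_measurable (PiM I (\<lambda>_. borel))"
    and L: "L \<in> PiM I (\<lambda>_. borel) \<rightarrow>\<^sub>M PiM I (\<lambda>_. borel)"
    and add: "\<And>x y. x \<in> I \<rightarrow>\<^sub>E UNIV \<Longrightarrow> y \<in> I \<rightarrow>\<^sub>E UNIV \<Longrightarrow> L (ext_add I x y) = ext_add I (L x) (L y)"
    and surj: "\<And>y. y \<in> I \<rightarrow>\<^sub>E UNIV \<Longrightarrow> \<exists>x \<in> I \<rightarrow>\<^sub>E UNIV. L x = y"
    and iso: "\<And>x. x \<in> I \<rightarrow>\<^sub>E UNIV \<Longrightarrow> (\<Sum>i\<in>I. (L x i)\<^sup>2) = (\<Sum>i\<in>I. (x i)\<^sup>2)"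
  shows "(\<integral>\<^sup>+x. f (L x) \<partial>gauss I) = (\<integral>\<^sup>+x. f x \<partial>gauss I)"
proof -
  note [measurable] = f L
  define N where "N = PiM I (\<lambda>_::'i. lborel :: real measure)"
  have [measurable_cong, simp]: "sets N = sets (PiM I (\<lambda>_. borel))" by (simp add: N_def)
  have sp: "space N = I \<rightarrow>\<^sub>E UNIV" by (simp add: N_def space_PiM)
  interpret N: sigma_finite_measure N
    unfolding N_def by (rule sigma_finite_lebesgue_pi[OF I])
  interpret NN: pair_sigma_finite N N by standard
  define g where "g x = ennreal (gauss_dens I x)" for x
  define h where "h x = g x * f x" for x
  have [measurable]: "g \<in> borel_measurable N" "h \<in> borel_measurable N" unfolding g_def h_def by measurable
  have Lsp: "L x \<in> I \<rightarrow>\<^sub>E UNIV" if "x \<in> I \<rightarrow>\<^sub>E UNIV" for x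
    using measurable_space[OF L] that by (simp add: space_PiM)
  have gL: "g (L x) = g x" if "x \<in> I \<rightarrow>\<^sub>E UNIV" for x
    using iso[OF that] by (simp add: g_def gauss_dens_def)
  have trans: "(\<integral>\<^sup>+x. F (ext_add I x a) \<partial>N) = (\<integral>\<^sup>+x. F x \<partial>N)"
    if "F \<in> borel_measurable N" "a \<in> I \<rightarrow>\<^sub>E UNIV" for F a
    using nn_integral_lebesgue_pi_translate[OF I, of F a] that by (simp add: N_def)
  define neg where "neg x = (\<lambda>i\<in>I. - x i)" for x :: "'i \<Rightarrow> real"
  have neg_in: "neg x \<in> I \<rightarrow>\<^sub>E UNIV" for x by (simp add: neg_def)
  have [measurable]: "neg \<in> PiM I (\<lambda>_. borel) \<rightarrow>\<^sub>M PiM I (\<lambda>_. borel)"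
    unfolding neg_def by measurable
  have g_neg: "g (neg x) = g x" for x by (simp add: g_def gauss_dens_def neg_def)
  have c: "(\<integral>\<^sup>+x. g x \<partial>N) = 1"
    using nn_integral_gauss[OF I, of "\<lambda>_. 1"] prob_space.emeasure_space_1[OF prob_space_gauss, of I]
    by (simp add: g_def N_def)
  \<comment> \<open>Inserting the factor \<open>\<integral> g = 1\<close> supplies the second
    variable.\<close>
  have "(\<integral>\<^sup>+x. h (L x) \<partial>N) = (\<integral>\<^sup>+y. \<integral>\<^sup>+x. h (L x) * g y \<partial>N \<partial>N)"
    by (simp add: nn_integral_multc nn_integral_cmult c)
  also have "\<dots> = (\<integral>\<^sup>+y. \<integral>\<^sup>+x. h (ext_add I (L x) y) * g y \<partial>N \<partial>N)"
  proof (rule nn_integral_cong)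
    fix y assume "y \<in> space N"
    \<comment> \<open>Surjectivity writes the shift by \<open>y\<close> as \<open>L\<close> of a
      shift by \<open>y'\<close>, a translation that the integral over \<open>x\<close> does not
      see.\<close>
    then obtain y' where y': "y' \<in> I \<rightarrow>\<^sub>E UNIV" "L y' = y" using surj sp by auto
    have "(\<integral>\<^sup>+x. h (L x) * g y \<partial>N) = (\<integral>\<^sup>+x. h (L (ext_add I x y')) * g y \<partial>N)"
      using y' by (intro trans[symmetric]) measurable
    also have "\<dots> = (\<integral>\<^sup>+x. h (ext_add I (L x) y) * g y \<partial>N)"
      using y' add sp by (intro nn_integral_cong) auto
    finally show "(\<integral>\<^sup>+x. h (L x) * g y \<partial>N) = (\<integral>\<^sup>+x. h (ext_add I (L x) y) * g y \<partial>N)" .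
  qed
  also have "\<dots> = (\<integral>\<^sup>+x. \<integral>\<^sup>+y. h (ext_add I (L x) y) * g y \<partial>N \<partial>N)"
    by (rule NN.Fubini') measurable
  also have "\<dots> = (\<integral>\<^sup>+x. \<integral>\<^sup>+y. h y * g (ext_add I y (neg (L x))) \<partial>N \<partial>N)"
  proof (rule nn_integral_cong)
    fix x assume x: "x \<in> space N"
    have "(\<integral>\<^sup>+y. h (ext_add I (L x) y) * g y \<partial>N)
      = (\<integral>\<^sup>+y. h (ext_add I (L x) (ext_add I y (neg (L x)))) * g (ext_add I y (neg (L x))) \<partial>N)"
    proof (rule trans[symmetric])
      have "(\<lambda>(x, y). h (ext_add I (L x) y) * g y) \<in> borel_measurable (N \<Otimes>\<^sub>M N)" by measurable
      from measurable_Pair2[OF this x]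
      show "(\<lambda>y. h (ext_add I (L x) y) * g y) \<in> borel_measurable N" by simp
    qed (rule neg_in)
    also have "\<dots> = (\<integral>\<^sup>+y. h y * g (ext_add I y (neg (L x))) \<partial>N)"
    proof (rule nn_integral_cong)
      fix y assume "y \<in> space N"
      then have y: "y \<in> I \<rightarrow>\<^sub>E UNIV" by (simp add: sp)
      have "ext_add I (L x) (ext_add I y (neg (L x))) = y"
      proof (rule ext)
        show "ext_add I (L x) (ext_add I y (neg (L x))) i = y i" for i
          using PiE_arb[OF y, of i] by (cases "i \<in> I") (auto simp: ext_add_def neg_def)
      qed
      then show "h (ext_add I (L x) (ext_add I y (neg (L x)))) * g (ext_add I y (neg (L x)))
        = h y * g (ext_add I y (neg (L x)))" by simp
    qed
    finally show "(\<integral>\<^sup>+y. h (ext_add I (L x) y) * g y \<partial>N) = (\<integral>\<^sup>+y. h y * g (ext_add I y (neg (L x))) \<partial>N)" .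
  qed
  also have "\<dots> = (\<integral>\<^sup>+y. \<integral>\<^sup>+x. h y * g (ext_add I y (neg (L x))) \<partial>N \<partial>N)"
    by (rule NN.Fubini') measurable
  also have "\<dots> = (\<integral>\<^sup>+y. h y \<partial>N)"
  proof (rule nn_integral_cong)
    fix y assume y: "y \<in> space N"
    then obtain y' where y': "y' \<in> I \<rightarrow>\<^sub>E UNIV" "L y' = y" using surj sp by auto
    have "(\<lambda>(y, x). g (ext_add I y (neg (L x)))) \<in> borel_measurable (N \<Otimes>\<^sub>M N)" by measurable
    from measurable_Pair2[OF this y]
    have my: "(\<lambda>x. g (ext_add I y (neg (L x)))) \<in> borel_measurable N" by simp
    then have "(\<integral>\<^sup>+x. h y * g (ext_add I y (neg (L x))) \<partial>N) = h y * (\<integral>\<^sup>+x. g (ext_add I y (neg (L x))) \<partial>N)"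
      by (intro nn_integral_cmult) simp
    \<comment> \<open>The same device again: translating \<open>x\<close> by \<open>y'\<close>
      cancels \<open>y\<close>, and what remains is \<open>g\<close> at minus \<open>L x\<close>,
      which equals \<open>g x\<close>.\<close>
    also have "(\<integral>\<^sup>+x. g (ext_add I y (neg (L x))) \<partial>N) = (\<integral>\<^sup>+x. g (ext_add I y (neg (L (ext_add I x y')))) \<partial>N)"
      using y' my by (intro trans[symmetric]) simp_all
    also have "\<dots> = (\<integral>\<^sup>+x. g x \<partial>N)"
    proof (rule nn_integral_cong)
      fix x assume x: "x \<in> space N"
      then have "ext_add I y (neg (L (ext_add I x y'))) = neg (L x)"
        using y' add sp by (auto simp: ext_add_def neg_def fun_eq_iff)
      then show "g (ext_add I y (neg (L (ext_add I x y')))) = g x"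
        using x gL sp by (simp add: g_neg)
    qed
    finally show "(\<integral>\<^sup>+x. h y * g (ext_add I y (neg (L x))) \<partial>N) = h y" by (simp add: c)
  qed
  finally have "(\<integral>\<^sup>+x. h (L x) \<partial>N) = (\<integral>\<^sup>+x. h x \<partial>N)" .
  moreover have "(\<integral>\<^sup>+x. h (L x) \<partial>N) = (\<integral>\<^sup>+x. f (L x) \<partial>gauss I)"
    using nn_integral_gauss[OF I, of "\<lambda>x. f (L x)"] gL sp
    by (auto simp: h_def N_def g_def intro!: nn_integral_cong)
  moreover have "(\<integral>\<^sup>+x. h x \<partial>N) = (\<integral>\<^sup>+x. f x \<partial>gauss I)"
    using nn_integral_gauss[OF I, of f] by (simp add: h_def N_def g_def)
  ultimately show ?thesis by simp
qed

text \<open>The Cameron-Martin formula: translation invariance of Lebesgue measure, with the square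
  expanded in the density.\<close>

lemma nn_integral_gauss_shift:
  fixes I :: "'i set"
  assumes I: "finite I" and f [measurable]: "f \<in> borel_measurable (PiM I (\<lambda>_. borel))"
    and a: "a \<in> I \<rightarrow>\<^sub>E UNIV"
  shows "(\<integral>\<^sup>+x. f x \<partial>gauss I)
    = (\<integral>\<^sup>+x. ennreal (exp (- (\<Sum>i\<in>I. a i * x i) - (\<Sum>i\<in>I. (a i)\<^sup>2) / 2)) * f (ext_add I x a) \<partial>gauss I)"
proof -
  have [measurable]: "(\<lambda>x. ext_add I x a) \<in> PiM I (\<lambda>_. borel) \<rightarrow>\<^sub>M PiM I (\<lambda>_. borel)"
    using a by (intro measurable_ext_add) (auto simp: space_PiM)
  have "(\<integral>\<^sup>+x. f x \<partial>gauss I)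
    = (\<integral>\<^sup>+x. ennreal (gauss_dens I (ext_add I x a)) * f (ext_add I x a) \<partial>PiM I (\<lambda>_. lborel))"
    using nn_integral_gauss[OF I f]
      nn_integral_lebesgue_pi_translate[OF I _ a, of "\<lambda>x. ennreal (gauss_dens I x) * f x"] by simp
  also have "\<dots> = (\<integral>\<^sup>+x. ennreal (gauss_dens I x) *
      (ennreal (exp (- (\<Sum>i\<in>I. a i * x i) - (\<Sum>i\<in>I. (a i)\<^sup>2) / 2)) * f (ext_add I x a)) \<partial>PiM I (\<lambda>_. lborel))"
  proof (rule nn_integral_cong)
    fix x
    have "(\<Sum>i\<in>I. (x i + a i)\<^sup>2) = (\<Sum>i\<in>I. (x i)\<^sup>2) + 2 * (\<Sum>i\<in>I. a i * x i) + (\<Sum>i\<in>I. (a i)\<^sup>2)"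
      by (simp add: power2_sum sum.distrib sum_distrib_left algebra_simps)
    then have "gauss_dens I (ext_add I x a)
        = gauss_dens I x * exp (- (\<Sum>i\<in>I. a i * x i) - (\<Sum>i\<in>I. (a i)\<^sup>2) / 2)"
      by (simp add: gauss_dens_def ext_add_def field_simps flip: exp_add)
    then show "ennreal (gauss_dens I (ext_add I x a)) * f (ext_add I x a) = ennreal (gauss_dens I x) *
      (ennreal (exp (- (\<Sum>i\<in>I. a i * x i) - (\<Sum>i\<in>I. (a i)\<^sup>2) / 2)) * f (ext_add I x a))"
      by (simp add: ennreal_mult' gauss_dens_pos less_imp_le mult.assoc)
  qed
  also have "\<dots> = (\<integral>\<^sup>+x. ennreal (exp (- (\<Sum>i\<in>I. a i * x i) - (\<Sum>i\<in>I. (a i)\<^sup>2) / 2)) * f (ext_add I x a) \<partial>gauss I)"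
    by (rule nn_integral_gauss[symmetric, OF I]) measurable
  finally show ?thesis .
qed

section \<open>Moments and Laplace transforms of Gaussian vectors\<close>

lemma nn_integral_gauss_prod:
  assumes "finite I" "\<And>i. i \<in> I \<Longrightarrow> f i \<in> borel_measurable borel"
  shows "(\<integral>\<^sup>+x. (\<Prod>i\<in>I. f i (x i)) \<partial>gauss I)
    = (\<Prod>i\<in>I. \<integral>\<^sup>+x. f i x \<partial>density lborel (\<lambda>x. ennreal (std_normal_density x)))"
  unfolding gauss_def using assms by (intro gauss.product_nn_integral_prod) auto

lemma nn_integral_normal_density:
  "0 < s \<Longrightarrow> (\<integral>\<^sup>+x. ennreal (normal_density \<mu> s x) \<partial>lborel) = 1"
  using prob_space.emeasure_space_1[OF prob_space_normal_density[of s \<mu>]]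
  by (simp add: emeasure_density)

lemma std_normal_exp_moment:
  "(\<integral>\<^sup>+x. ennreal (exp (a * x)) \<partial>density lborel (\<lambda>x. ennreal (std_normal_density x))) = ennreal (exp (a\<^sup>2 / 2))"
proof -
  have "std_normal_density x * exp (a * x) = exp (a\<^sup>2 / 2) * normal_density a 1 x" for x
  proof -
    have "- x\<^sup>2 / 2 + a * x = a\<^sup>2 / 2 + - (x - a)\<^sup>2 / 2"
      by (simp add: power2_diff field_simps)
    then have "exp (- x\<^sup>2 / 2) * exp (a * x) = exp (a\<^sup>2 / 2) * exp (- (x - a)\<^sup>2 / 2)"
      by (simp only: flip: exp_add)
    then show ?thesis by (simp add: normal_density_def)
  qed
  then show ?thesis
    by (simp add: nn_integral_density nn_integral_cmult nn_integral_normal_density flip: ennreal_mult')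
      (simp add: ennreal_mult' nn_integral_cmult nn_integral_normal_density)
qed

lemma std_normal_laplace_sq:
  assumes "0 \<le> t"
  shows "(\<integral>\<^sup>+x. ennreal (exp (- t * x\<^sup>2)) \<partial>density lborel (\<lambda>x. ennreal (std_normal_density x)))
    = ennreal (1 / sqrt (1 + 2 * t))"
proof -
  have "std_normal_density x * exp (- t * x\<^sup>2) = 1 / sqrt (1 + 2 * t) * normal_density 0 (1 / sqrt (1 + 2 * t)) x" for x
  proof -
    have "exp (- x\<^sup>2 / 2) * exp (- t * x\<^sup>2) = exp (- x\<^sup>2 / (2 * (1 / sqrt (1 + 2 * t))\<^sup>2))"
      using assms by (simp add: power_divide flip: exp_add) (simp add: field_simps)
    then show ?thesis
      using assms by (simp add: normal_density_def real_sqrt_mult real_sqrt_divide power_divide)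
  qed
  then have "(\<integral>\<^sup>+x. ennreal (exp (- t * x\<^sup>2)) \<partial>density lborel (\<lambda>x. ennreal (std_normal_density x)))
    = (\<integral>\<^sup>+x. ennreal (1 / sqrt (1 + 2 * t)) * ennreal (normal_density 0 (1 / sqrt (1 + 2 * t)) x) \<partial>lborel)"
    using assms by (subst nn_integral_density) (simp_all flip: ennreal_mult ennreal_mult')
  then show ?thesis
    using assms by (simp add: nn_integral_cmult nn_integral_normal_density)
qed

text \<open>The double factorial of \<open>2 * j - 1\<close> is written with a rising factorial, the
  form that extends to chi-square variables with any number of degrees of freedom.\<close>

lemma std_normal_even_moment:
  "(\<integral>\<^sup>+x. ennreal ((x\<^sup>2) ^ j) \<partial>density lborel (\<lambda>x. ennreal (std_normal_density x)))
    = ennreal (2 ^ j * pochhammer (1 / 2) j)"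
proof -
  have "fact (2 * j) / (2 ^ j * fact j) = (2 ^ j * pochhammer (1 / 2) j :: real)"
  proof -
    have "(2::real) ^ (2 * j) = 2 ^ j * 2 ^ j" by (simp add: mult_2 power_add)
    then show ?thesis by (simp add: fact_double)
  qed
  then show ?thesis
    using std_normal_moment_even[of j]
    by (simp add: nn_integral_density power_mult has_bochner_integral_iff nn_integral_eq_integral flip: ennreal_mult')
qed

lemma nn_integral_gauss_exp_linear:
  assumes "finite I"
  shows "(\<integral>\<^sup>+x. ennreal (exp (\<Sum>i\<in>I. a i * x i)) \<partial>gauss I) = ennreal (exp ((\<Sum>i\<in>I. (a i)\<^sup>2) / 2))"
proof -
  have "(\<integral>\<^sup>+x. ennreal (exp (\<Sum>i\<in>I. a i * x i)) \<partial>gauss I) = (\<integral>\<^sup>+x. (\<Prod>i\<in>I. ennreal (exp (a i * x i))) \<partial>gauss I)"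
    using assms by (simp add: exp_sum prod_ennreal)
  also have "\<dots> = (\<Prod>i\<in>I. ennreal (exp ((a i)\<^sup>2 / 2)))"
    using assms by (subst nn_integral_gauss_prod) (auto simp: std_normal_exp_moment)
  also have "\<dots> = ennreal (exp ((\<Sum>i\<in>I. (a i)\<^sup>2) / 2))"
    using assms by (simp add: exp_sum prod_ennreal sum_divide_distrib)
  finally show ?thesis .
qed

lemma nn_integral_gauss_laplace_sq:
  assumes I: "finite I" "J \<subseteq> I" and "0 \<le> t"
  shows "(\<integral>\<^sup>+x. ennreal (exp (- t * (\<Sum>i\<in>J. (x i)\<^sup>2))) \<partial>gauss I) = ennreal ((1 / sqrt (1 + 2 * t)) ^ card J)"
proof -
  have J: "finite J" using I finite_subset by blast
  have "exp (- t * (\<Sum>i\<in>J. (x i)\<^sup>2)) = (\<Prod>i\<in>I. if i \<in> J then exp (- t * (x i)\<^sup>2) else 1)" for x :: "'a \<Rightarrow> real"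
  proof -
    have "(\<Prod>i\<in>I. if i \<in> J then exp (- t * (x i)\<^sup>2) else 1) = (\<Prod>i\<in>J. exp (- t * (x i)\<^sup>2))"
      using I prod.inter_restrict[of I "\<lambda>i. exp (- t * (x i)\<^sup>2)" J] by (simp add: Int_absorb1)
    then show ?thesis using J by (simp add: exp_sum sum_distrib_left)
  qed
  then have "(\<integral>\<^sup>+x. ennreal (exp (- t * (\<Sum>i\<in>J. (x i)\<^sup>2))) \<partial>gauss I)
    = (\<integral>\<^sup>+x. (\<Prod>i\<in>I. ennreal (if i \<in> J then exp (- t * (x i)\<^sup>2) else 1)) \<partial>gauss I)"
    by (subst prod_ennreal) auto
  also have "\<dots> = (\<Prod>i\<in>I. \<integral>\<^sup>+x. ennreal (if i \<in> J then exp (- t * x\<^sup>2) else 1) \<partial>density lborel (\<lambda>x. ennreal (std_normal_density x)))"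
    using I by (intro nn_integral_gauss_prod) auto
  also have "\<dots> = (\<Prod>i\<in>I. if i \<in> J then ennreal (1 / sqrt (1 + 2 * t)) else 1)"
  proof (intro prod.cong refl)
    fix i
    show "(\<integral>\<^sup>+x. ennreal (if i \<in> J then exp (- t * x\<^sup>2) else 1) \<partial>density lborel (\<lambda>x. ennreal (std_normal_density x)))
      = (if i \<in> J then ennreal (1 / sqrt (1 + 2 * t)) else 1)"
      using std_normal_laplace_sq[OF assms(3)] std_normal.emeasure_space_1 by (cases "i \<in> J") auto
  qed
  also have "\<dots> = ennreal (1 / sqrt (1 + 2 * t)) ^ card J"
    using I prod.inter_restrict[of I "\<lambda>_. ennreal (1 / sqrt (1 + 2 * t))" J] by (simp add: Int_absorb1)
  also have "\<dots> = ennreal ((1 / sqrt (1 + 2 * t)) ^ card J)"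
    using assms(3) by (simp add: ennreal_power)
  finally show ?thesis .
qed

text \<open>Adding a coordinate convolves the moment sequences. In terms of rising factorials this
  is Vandermonde's identity \<open>pochhammer_binomial_sum\<close>, and the parameter
  \<open>card I / 2\<close> grows by 1/2.\<close>

lemma nn_integral_gauss_even_moment:
  assumes "finite I"
  shows "(\<integral>\<^sup>+x. ennreal ((\<Sum>i\<in>I. (x i)\<^sup>2) ^ r) \<partial>gauss I) = ennreal (2 ^ r * pochhammer (real (card I) / 2) r)"
  using assms
proof (induction I arbitrary: r)
  case empty
  interpret prob_space "gauss ({}::'a set)" by (rule prob_space_gauss)
  \<comment> \<open>Over the empty index set the moment is \<open>0 ^ r\<close>, equal to 1 for
    \<open>r = 0\<close>, in agreement with \<open>pochhammer 0 r\<close>.\<close>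
  show ?case using emeasure_space_1 by (cases r) (auto simp: pochhammer_0_left)
next
  case (insert i I)
  let ?N = "density lborel (\<lambda>x. ennreal (std_normal_density x))"
  have [measurable]: "(\<lambda>x. \<Sum>i\<in>J. (x i :: real)\<^sup>2) \<in> borel_measurable (PiM J (\<lambda>_. borel))" for J :: "'a set"
    by measurable
  have "(\<integral>\<^sup>+x. ennreal ((\<Sum>i\<in>insert i I. (x i)\<^sup>2) ^ r) \<partial>gauss (insert i I))
    = (\<integral>\<^sup>+x. \<integral>\<^sup>+y. ennreal ((\<Sum>j\<in>insert i I. ((x(i := y)) j)\<^sup>2) ^ r) \<partial>?N \<partial>gauss I)"
    unfolding gauss_def
  proof (rule gauss.product_nn_integral_insert[OF insert(1,2)])
    have "(\<lambda>x. ennreal ((\<Sum>j\<in>insert i I. (x j)\<^sup>2) ^ r)) \<in> borel_measurable (gauss (insert i I))"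
      by measurable
    then show "(\<lambda>x. ennreal ((\<Sum>j\<in>insert i I. (x j)\<^sup>2) ^ r)) \<in> borel_measurable (PiM (insert i I) (\<lambda>i. ?N))"
      by (simp add: gauss_def)
  qed
  also have "\<dots> = (\<integral>\<^sup>+x. \<integral>\<^sup>+y. (\<Sum>j\<le>r. ennreal (real (r choose j)) * (ennreal ((\<Sum>j\<in>I. (x j)\<^sup>2) ^ j) * ennreal ((y\<^sup>2) ^ (r - j)))) \<partial>?N \<partial>gauss I)"
  proof (intro nn_integral_cong)
    fix x :: "'a \<Rightarrow> real" and y :: real
    have "(\<Sum>j\<in>insert i I. ((x(i := y)) j)\<^sup>2) = (\<Sum>j\<in>I. (x j)\<^sup>2) + y\<^sup>2"
    proof -
      have "(\<Sum>j\<in>I. ((x(i := y)) j)\<^sup>2) = (\<Sum>j\<in>I. (x j)\<^sup>2)"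
        using insert by (intro sum.cong) auto
      then show ?thesis using insert by simp
    qed
    then show "ennreal ((\<Sum>j\<in>insert i I. ((x(i := y)) j)\<^sup>2) ^ r)
      = (\<Sum>j\<le>r. ennreal (real (r choose j)) * (ennreal ((\<Sum>j\<in>I. (x j)\<^sup>2) ^ j) * ennreal ((y\<^sup>2) ^ (r - j))))"
      by (simp add: binomial_ring sum_nonneg mult.assoc flip: ennreal_mult' ennreal_mult sum_ennreal)
  qed
  also have "\<dots> = (\<Sum>j\<le>r. ennreal (real (r choose j)) * ((\<integral>\<^sup>+x. ennreal ((\<Sum>j\<in>I. (x j)\<^sup>2) ^ j) \<partial>gauss I) *
      (\<integral>\<^sup>+y. ennreal ((y\<^sup>2) ^ (r - j)) \<partial>?N)))"
    by (simp add: nn_integral_sum nn_integral_cmult nn_integral_multc)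
  also have "\<dots> = (\<Sum>j\<le>r. ennreal (real (r choose j) * ((2 ^ j * pochhammer (real (card I) / 2) j) * (2 ^ (r - j) * pochhammer (1 / 2) (r - j)))))"
    unfolding insert.IH std_normal_even_moment
  proof (intro sum.cong refl)
    fix j
    have "0 \<le> pochhammer (real (card I) / 2) j" "0 \<le> pochhammer (1 / 2 :: real) (r - j)"
      by (auto simp: pochhammer_prod intro!: prod_nonneg)
    then show "ennreal (real (r choose j)) * (ennreal (2 ^ j * pochhammer (real (card I) / 2) j)
        * ennreal (2 ^ (r - j) * pochhammer (1 / 2) (r - j)))
      = ennreal (real (r choose j) * ((2 ^ j * pochhammer (real (card I) / 2) j)
        * (2 ^ (r - j) * pochhammer (1 / 2) (r - j))))"
      by (simp flip: ennreal_mult)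
  qed
  also have "\<dots> = ennreal (\<Sum>j\<le>r. real (r choose j) * ((2 ^ j * pochhammer (real (card I) / 2) j) * (2 ^ (r - j) * pochhammer (1 / 2) (r - j))))"
    by (intro sum_ennreal mult_nonneg_nonneg) (auto simp: pochhammer_prod intro!: prod_nonneg)
  also have "(\<Sum>j\<le>r. real (r choose j) * ((2 ^ j * pochhammer (real (card I) / 2) j) * (2 ^ (r - j) * pochhammer (1 / 2) (r - j))))
    = 2 ^ r * pochhammer (real (card I) / 2 + 1 / 2) r"
    unfolding pochhammer_binomial_sum sum_distrib_left
    by (intro sum.cong refl) (auto simp: simp flip: power_add)
  also have "real (card I) / 2 + 1 / 2 = real (card (insert i I)) / 2"
    using insert by (simp add: field_simps)
  finally show ?case .
qed

section \<open>Marginals and conditioning\<close>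

lemma nn_integral_gauss_marginal:
  fixes I :: "'i set"
  assumes I: "finite I" "B \<subseteq> I" and h [measurable]: "h \<in> borel_measurable (PiM B (\<lambda>_. borel))"
  shows "(\<integral>\<^sup>+x. h (restrict x B) \<partial>gauss I) = (\<integral>\<^sup>+x. h x \<partial>gauss B)"
proof -
  have fin: "finite B" "finite (I - B)" and IB: "B \<union> (I - B) = I" "B \<inter> (I - B) = {}"
    using I finite_subset by auto
  interpret P: prob_space "gauss (I - B)" by (rule prob_space_gauss)
  have [measurable]: "(\<lambda>x. restrict x B) \<in> PiM I (\<lambda>_. borel) \<rightarrow>\<^sub>M PiM B (\<lambda>_. borel)"
    using I(2) by (intro measurable_restrict_subset)
  have "(\<lambda>x. h (restrict x B)) \<in> borel_measurable (gauss I)"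
    by measurable
  then have "(\<integral>\<^sup>+x. h (restrict x B) \<partial>gauss I)
      = (\<integral>\<^sup>+x. \<integral>\<^sup>+y. h (restrict (merge B (I - B) (x, y)) B) \<partial>gauss (I - B) \<partial>gauss B)"
    using gauss.product_nn_integral_fold[OF IB(2) fin, of "\<lambda>x. h (restrict x B)"]
    unfolding IB(1) gauss_def by simp
  also have "\<dots> = (\<integral>\<^sup>+x. \<integral>\<^sup>+y. h x \<partial>gauss (I - B) \<partial>gauss B)"
  proof (intro nn_integral_cong)
    fix x y :: "'i \<Rightarrow> real" assume "x \<in> space (gauss B)"
    then have x: "x \<in> B \<rightarrow>\<^sub>E UNIV" by simp
    have "restrict (merge B (I - B) (x, y)) B = x"
    proof (rule ext)
      show "restrict (merge B (I - B) (x, y)) B i = x i" for i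
        using PiE_arb[OF x, of i] by (cases "i \<in> B") (auto simp: merge_def)
    qed
    then show "h (restrict (merge B (I - B) (x, y)) B) = h x" by simp
  qed
  finally show ?thesis using P.emeasure_space_1 by simp
qed

text \<open>Fubini for the splitting of \<open>I\<close> into \<open>B\<close> and its complement,
  phrased with full vectors on both sides: a function of a whole matrix can then be averaged over
  some of its rows without changing its argument type or dimensions.\<close>

lemma nn_integral_gauss_resample:
  fixes I :: "'i set"
  assumes I: "finite I" "B \<subseteq> I" and h [measurable]: "h \<in> borel_measurable (PiM I (\<lambda>_. borel))"
  shows "(\<integral>\<^sup>+x. h x \<partial>gauss I) = (\<integral>\<^sup>+y. \<integral>\<^sup>+x. h (\<lambda>i\<in>I. if i \<in> B then x i else y i) \<partial>gauss I \<partial>gauss I)"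
proof -
  let ?C = "I - B"
  have fin: "finite B" "finite ?C" and IB: "?C \<union> B = I" "?C \<inter> B = {}" "?C \<subseteq> I"
    using I finite_subset by auto
  interpret B: sigma_finite_measure "gauss B" by (rule sigma_finite_gauss)
  have "merge ?C B \<in> (gauss ?C \<Otimes>\<^sub>M gauss B) \<rightarrow>\<^sub>M PiM (?C \<union> B) (\<lambda>_. borel)"
    by measurable
  then have mrg [measurable]: "merge ?C B \<in> (gauss ?C \<Otimes>\<^sub>M gauss B) \<rightarrow>\<^sub>M PiM I (\<lambda>_. borel)"
    unfolding IB(1) .
  have "h \<in> borel_measurable (gauss I)" by measurable
  then have "(\<integral>\<^sup>+x. h x \<partial>gauss I) = (\<integral>\<^sup>+y. \<integral>\<^sup>+x. h (merge ?C B (y, x)) \<partial>gauss B \<partial>gauss ?C)"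
    using gauss.product_nn_integral_fold[OF IB(2) fin(2,1), of h]
    unfolding IB(1) gauss_def by simp
  also have "\<dots> = (\<integral>\<^sup>+y. \<integral>\<^sup>+x. h (merge ?C B (restrict y ?C, x)) \<partial>gauss B \<partial>gauss I)"
    by (rule nn_integral_gauss_marginal[symmetric, OF I(1) IB(3)]) measurable
  also have "\<dots> = (\<integral>\<^sup>+y. \<integral>\<^sup>+x. h (merge ?C B (restrict y ?C, restrict x B)) \<partial>gauss I \<partial>gauss I)"
  proof (rule nn_integral_cong)
    fix y :: "'i \<Rightarrow> real"
    have "(\<lambda>x. (restrict y ?C, x)) \<in> gauss B \<rightarrow>\<^sub>M (gauss ?C \<Otimes>\<^sub>M gauss B)"
      by (intro measurable_Pair measurable_const) auto
    then have "(\<lambda>x. h (merge ?C B (restrict y ?C, x))) \<in> borel_measurable (gauss B)"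
      by measurable
    then show "(\<integral>\<^sup>+x. h (merge ?C B (restrict y ?C, x)) \<partial>gauss B)
      = (\<integral>\<^sup>+x. h (merge ?C B (restrict y ?C, restrict x B)) \<partial>gauss I)"
      by (intro nn_integral_gauss_marginal[symmetric, OF I]) simp
  qed
  also have "\<dots> = (\<integral>\<^sup>+y. \<integral>\<^sup>+x. h (\<lambda>i\<in>I. if i \<in> B then x i else y i) \<partial>gauss I \<partial>gauss I)"
  proof (intro nn_integral_cong arg_cong[where f=h])
    fix x y :: "'i \<Rightarrow> real"
    show "merge ?C B (restrict y ?C, restrict x B) = (\<lambda>i\<in>I. if i \<in> B then x i else y i)"
      using I by (auto simp: merge_def restrict_def fun_eq_iff)
  qed
  finally show ?thesis .
qed

lemma nn_integral_gauss_component: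
  assumes I: "finite I" "i \<in> I" and h [measurable]: "h \<in> borel_measurable borel"
  shows "(\<integral>\<^sup>+x. h (x i) \<partial>gauss I) = (\<integral>\<^sup>+x. h x \<partial>density lborel (\<lambda>x. ennreal (std_normal_density x)))"
proof -
  have "(\<integral>\<^sup>+x. h (restrict x {i} i) \<partial>gauss I) = (\<integral>\<^sup>+x. h (x i) \<partial>gauss {i})"
    using I by (intro nn_integral_gauss_marginal[of I "{i}" "\<lambda>x. h (x i)"]) auto
  also have "\<dots> = (\<integral>\<^sup>+x. h x \<partial>density lborel (\<lambda>x. ennreal (std_normal_density x)))"
    unfolding gauss_def by (intro gauss.product_nn_integral_singleton) auto
  finally show ?thesis by simp
qed

subsection \<open>Inverse moments of chi-square variables\<close>

text \<open>\<open>s\<^sup>-\<^sup>r\<close> as a Laplace integral, which is \<open>\<infinity>\<close> at \<open>s = 0\<close>.\<close>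

definition inv_pow :: "nat \<Rightarrow> real \<Rightarrow> ennreal" where
  "inv_pow r s = (\<integral>\<^sup>+t. ennreal (t ^ (r - 1) * exp (- t * s) / fact (r - 1)) * indicator {0..} t \<partial>lborel)"

text \<open>The substitution \<open>t = u / s\<close> leaves the Gamma integral
  \<open>fact (r - 1)\<close>.\<close>

lemma inv_pow_pos:
  assumes "0 < s" "1 \<le> r"
  shows "inv_pow r s = ennreal (1 / s ^ r)"
proof -
  have "inv_pow r s = ennreal (1 / s) * (\<integral>\<^sup>+u. ennreal ((u / s) ^ (r - 1) * exp (- (u / s) * s) / fact (r - 1)) * indicator {0..} (u / s) \<partial>lborel)"
    unfolding inv_pow_def using assms
    by (subst nn_integral_real_affine[where c = "1 / s" and t = 0]) auto
  also have "(\<integral>\<^sup>+u. ennreal ((u / s) ^ (r - 1) * exp (- (u / s) * s) / fact (r - 1)) * indicator {0..} (u / s) \<partial>lborel)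
    = (\<integral>\<^sup>+u. ennreal (1 / (s ^ (r - 1) * fact (r - 1))) * (ennreal (u ^ (r - 1) * exp (- u)) * indicator {0..} u) \<partial>lborel)"
  proof (rule nn_integral_cong)
    fix u :: real
    show "ennreal ((u / s) ^ (r - 1) * exp (- (u / s) * s) / fact (r - 1)) * indicator {0..} (u / s)
      = ennreal (1 / (s ^ (r - 1) * fact (r - 1))) * (ennreal (u ^ (r - 1) * exp (- u)) * indicator {0..} u)"
      using assms by (auto simp: indicator_def power_divide zero_le_divide_iff simp flip: ennreal_mult)
  qed
  also have "\<dots> = ennreal (1 / (s ^ (r - 1) * fact (r - 1))) * ennreal (fact (r - 1))"
    using nn_intergal_power_times_exp_Ici[of "r - 1"] by (subst nn_integral_cmult) auto
  also have "\<dots> = ennreal (1 / s ^ (r - 1))"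
    using assms by (simp flip: ennreal_mult)
  also have "ennreal (1 / s) * \<dots> = ennreal (1 / s ^ r)"
    using assms by (cases r) (auto simp flip: ennreal_mult)
  finally show ?thesis .
qed

lemma inv_pow_zero:
  assumes "1 \<le> r"
  shows "inv_pow r 0 = \<top>"
proof -
  have "ennreal c \<le> inv_pow r 0" for c
  proof -
    \<comment> \<open>The Laplace integral decreases in \<open>s\<close>, so its value at 0 is at
      least the value at this \<open>s\<close>, which is already at least \<open>c\<close>.\<close>
    define s where "s = 1 / max c 1"
    have s: "0 < s" "c \<le> 1 / s" "1 \<le> 1 / s" by (auto simp: s_def)
    then have "c \<le> 1 / s ^ r"
      using assms self_le_power[of "1 / s" r] by (simp add: power_one_over)
    then have "ennreal c \<le> inv_pow r s"
      using s assms by (simp add: inv_pow_pos ennreal_leI)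
    also have "\<dots> \<le> inv_pow r 0"
      unfolding inv_pow_def using s
      by (intro nn_integral_mono) (auto simp: indicator_def intro!: ennreal_leI divide_right_mono mult_left_le)
    finally show ?thesis .
  qed
  note le = this
  show ?thesis
  proof (cases "inv_pow r 0")
    case (real c)
    then show ?thesis using le[of "c + 1"] by simp
  qed
qed

text \<open>By Tonelli, inverse moments reduce to the Laplace transform of the chi-square law; an
  even number of degrees of freedom makes that transform rational.\<close>

lemma nn_integral_gauss_inv_pow:
  assumes I: "finite I" "J \<subseteq> I" "card J = 2 * N"
  shows "(\<integral>\<^sup>+x. inv_pow r (\<Sum>i\<in>J. (x i)\<^sup>2) \<partial>gauss I)
    = (\<integral>\<^sup>+t. ennreal (t ^ (r - 1) / (fact (r - 1) * (1 + 2 * t) ^ N)) * indicator {0..} t \<partial>lborel)"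
proof -
  interpret G: sigma_finite_measure "gauss I" by (rule sigma_finite_gauss)
  interpret P: pair_sigma_finite "gauss I" lborel by standard
  have [measurable]: "(\<lambda>x. \<Sum>i\<in>J. (x i :: real)\<^sup>2) \<in> borel_measurable (PiM I (\<lambda>_. borel))"
    using I by (auto intro!: borel_measurable_sum borel_measurable_power measurable_component_singleton)
  have "(\<integral>\<^sup>+x. inv_pow r (\<Sum>i\<in>J. (x i)\<^sup>2) \<partial>gauss I)
    = (\<integral>\<^sup>+t. \<integral>\<^sup>+x. ennreal (t ^ (r - 1) * exp (- t * (\<Sum>i\<in>J. (x i)\<^sup>2)) / fact (r - 1)) * indicator {0..} t \<partial>gauss I \<partial>lborel)"
    unfolding inv_pow_def by (rule P.Fubini'[symmetric]) measurable
  also have "\<dots> = (\<integral>\<^sup>+t. ennreal (t ^ (r - 1) / (fact (r - 1) * (1 + 2 * t) ^ N)) * indicator {0..} t \<partial>lborel)"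
  proof (rule nn_integral_cong)
    fix t :: real
    show "(\<integral>\<^sup>+x. ennreal (t ^ (r - 1) * exp (- t * (\<Sum>i\<in>J. (x i)\<^sup>2)) / fact (r - 1)) * indicator {0..} t \<partial>gauss I)
      = ennreal (t ^ (r - 1) / (fact (r - 1) * (1 + 2 * t) ^ N)) * indicator {0..} t"
    proof (cases "0 \<le> t")
      case True
      have "(\<integral>\<^sup>+x. ennreal (t ^ (r - 1) * exp (- t * (\<Sum>i\<in>J. (x i)\<^sup>2)) / fact (r - 1)) * indicator {0..} t \<partial>gauss I)
        = (\<integral>\<^sup>+x. ennreal (t ^ (r - 1) / fact (r - 1)) * ennreal (exp (- t * (\<Sum>i\<in>J. (x i)\<^sup>2))) \<partial>gauss I)"
        using True by (intro nn_integral_cong) (simp flip: ennreal_mult)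
      also have "\<dots> = ennreal (t ^ (r - 1) / fact (r - 1)) * ennreal ((1 / sqrt (1 + 2 * t)) ^ card J)"
        unfolding nn_integral_gauss_laplace_sq[OF I(1,2) True, symmetric]
        by (rule nn_integral_cmult) measurable
      also have "(1 / sqrt (1 + 2 * t)) ^ card J = 1 / (1 + 2 * t) ^ N"
        using True by (simp add: I(3) power_mult power_divide)
      finally show ?thesis using True by (simp flip: ennreal_mult)
    qed simp
  qed
  finally show ?thesis .
qed

text \<open>With \<nu> degrees of freedom the inverse chi-square mean is
  \<open>1 / (\<nu> - 2)\<close>; here \<open>\<nu> = 4 * (p + 1)\<close>.\<close>

lemma nn_integral_gauss_inverse:
  assumes I: "finite I" "J \<subseteq> I" "card J = 4 * (p + 1)"
  shows "(\<integral>\<^sup>+x. inv_pow 1 (\<Sum>i\<in>J. (x i)\<^sup>2) \<partial>gauss I) = ennreal (1 / (4 * real p + 2))"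
proof -
  have "(\<integral>\<^sup>+x. inv_pow 1 (\<Sum>i\<in>J. (x i)\<^sup>2) \<partial>gauss I)
    = (\<integral>\<^sup>+t. ennreal (1 / (1 + 2 * t) ^ (2 * p + 2)) * indicator {0..} t \<partial>lborel)"
    using nn_integral_gauss_inv_pow[of I J "2 * p + 2" 1] I by simp
  also have "\<dots> = ennreal (0 - (- (1 / ((4 * real p + 2) * (1 + 2 * 0) ^ (2 * p + 1)))))"
  proof (rule nn_integral_FTC_atLeast[where F = "\<lambda>t. - (1 / ((4 * real p + 2) * (1 + 2 * t) ^ (2 * p + 1)))"])
    fix t :: real assume t: "0 \<le> t"
    then have pos: "0 < 1 + 2 * t" by simp
    show "((\<lambda>t. - (1 / ((4 * real p + 2) * (1 + 2 * t) ^ (2 * p + 1)))) has_real_derivative 1 / (1 + 2 * t) ^ (2 * p + 2)) (at t)"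
    proof (rule DERIV_cong)
      have eq: "(\<lambda>t. - (1 / ((4 * real p + 2) * (1 + 2 * t) ^ (2 * p + 1))))
        = (\<lambda>t. - (1 / (4 * real p + 2)) * inverse ((1 + 2 * t) ^ (2 * p + 1)))"
        by (simp add: field_simps)
      show "((\<lambda>t. - (1 / ((4 * real p + 2) * (1 + 2 * t) ^ (2 * p + 1)))) has_real_derivative
        - (1 / (4 * real p + 2)) * - (inverse ((1 + 2 * t) ^ (2 * p + 1)) * (real (2 * p + 1) * (2 * (1 + 2 * t) ^ (2 * p))) * inverse ((1 + 2 * t) ^ (2 * p + 1)))) (at t)"
        unfolding eq
      proof (intro DERIV_cmult DERIV_inverse')
        have "((\<lambda>t. 1 + 2 * t) has_real_derivative 2) (at t)"
          by (auto intro!: derivative_eq_intros)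
        from DERIV_power[OF this, of "2 * p + 1"]
        show "((\<lambda>t. (1 + 2 * t) ^ (2 * p + 1)) has_real_derivative real (2 * p + 1) * (2 * (1 + 2 * t) ^ (2 * p))) (at t)"
          by simp
      qed (use pos in simp)
      show "- (1 / (4 * real p + 2)) * - (inverse ((1 + 2 * t) ^ (2 * p + 1)) * (real (2 * p + 1) * (2 * (1 + 2 * t) ^ (2 * p))) * inverse ((1 + 2 * t) ^ (2 * p + 1)))
        = 1 / (1 + 2 * t) ^ (2 * p + 2)"
      proof -
        have alg: "- (1 / (2 * N)) * - (inverse (u * w) * (N * (2 * w)) * inverse (u * w)) = 1 / (u * (u * w))"
          if "0 < u" "0 < w" "0 < N" for u w N :: real
          using that by (simp add: field_simps)
        show ?thesis
          using alg[of "1 + 2 * t" "(1 + 2 * t) ^ (2 * p)" "real (2 * p + 1)"] pos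
          by (simp add: add.commute)
      qed
    qed
    show "0 \<le> 1 / (1 + 2 * t) ^ (2 * p + 2)" using pos by simp
  next
    have "((\<lambda>t. inverse ((1 + 2 * t) ^ (2 * p + 1))) \<longlongrightarrow> 0) (at_top :: real filter)"
    proof (rule tendsto_inverse_0_at_top)
      have "filterlim (\<lambda>t::real. 1 + 2 * t) at_top at_top" by real_asymp
      then show "filterlim (\<lambda>t::real. (1 + 2 * t) ^ (2 * p + 1)) at_top at_top"
        by (intro filterlim_pow_at_top) auto
    qed
    from tendsto_mult_right[OF this, of "- (1 / (4 * real p + 2))"]
    show "((\<lambda>t. - (1 / ((4 * real p + 2) * (1 + 2 * t) ^ (2 * p + 1)))) \<longlongrightarrow> 0) (at_top :: real filter)"
      by (simp add: field_simps)
  qed simp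
  finally show ?thesis by simp
qed

text \<open>The largest integer order with a finite inverse moment. At exactly this order the
  integrand is the derivative of a power of \<open>t / (1 + 2 * t)\<close>, up to a
  factorial.\<close>

lemma nn_integral_gauss_inv_pow_top:
  assumes I: "finite I" "J \<subseteq> I" "card J = 4 * (p + 1)"
  shows "(\<integral>\<^sup>+x. inv_pow (2 * p + 1) (\<Sum>i\<in>J. (x i)\<^sup>2) \<partial>gauss I)
    = ennreal (1 / (2 ^ (2 * p + 1) * fact (2 * p + 1)))"
proof -
  have "(\<integral>\<^sup>+x. inv_pow (2 * p + 1) (\<Sum>i\<in>J. (x i)\<^sup>2) \<partial>gauss I)
    = (\<integral>\<^sup>+t. ennreal (t ^ (2 * p) / (fact (2 * p) * (1 + 2 * t) ^ (2 * p + 2))) * indicator {0..} t \<partial>lborel)"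
    using nn_integral_gauss_inv_pow[of I J "2 * p + 2" "2 * p + 1"] I by simp
  also have "\<dots> = ennreal ((1 / 2) ^ (2 * p + 1) / fact (2 * p + 1) - (0 / (1 + 2 * 0)) ^ (2 * p + 1) / fact (2 * p + 1))"
  proof (rule nn_integral_FTC_atLeast[where F = "\<lambda>t. (t / (1 + 2 * t)) ^ (2 * p + 1) / fact (2 * p + 1)"])
    fix t :: real assume t: "0 \<le> t"
    then have pos: "0 < 1 + 2 * t" by simp
    show "((\<lambda>t. (t / (1 + 2 * t)) ^ (2 * p + 1) / fact (2 * p + 1)) has_real_derivative
      t ^ (2 * p) / (fact (2 * p) * (1 + 2 * t) ^ (2 * p + 2))) (at t)"
    proof (rule DERIV_cong)
      have "((\<lambda>t. t / (1 + 2 * t)) has_real_derivative 1 / (1 + 2 * t)\<^sup>2) (at t)"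
        using pos by (auto intro!: derivative_eq_intros simp: power2_eq_square)
      from DERIV_cdivide[OF DERIV_power[OF this, of "2 * p + 1"], of "fact (2 * p + 1)"]
      show "((\<lambda>t. (t / (1 + 2 * t)) ^ (2 * p + 1) / fact (2 * p + 1)) has_real_derivative
        real (2 * p + 1) * (1 / (1 + 2 * t)\<^sup>2 * (t / (1 + 2 * t)) ^ (2 * p)) / fact (2 * p + 1)) (at t)"
        by simp
      have "fact (2 * p + 1) = real (2 * p + 1) * fact (2 * p)"
        using fact_Suc[of "2 * p", where ?'a = real] by simp
      then have "real (2 * p + 1) / fact (2 * p + 1) = 1 / fact (2 * p)"
        by (simp only: nonzero_divide_mult_cancel_left of_nat_eq_0_iff)
      then have "real (2 * p + 1) * (1 / (1 + 2 * t)\<^sup>2 * (t / (1 + 2 * t)) ^ (2 * p)) / fact (2 * p + 1)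
        = 1 / fact (2 * p) * (1 / (1 + 2 * t)\<^sup>2 * (t / (1 + 2 * t)) ^ (2 * p))"
        by (metis times_divide_eq_left)
      also have "\<dots> = t ^ (2 * p) / (fact (2 * p) * (1 + 2 * t) ^ (2 * p + 2))"
        by (simp add: power_divide power_add power2_eq_square)
      finally show "real (2 * p + 1) * (1 / (1 + 2 * t)\<^sup>2 * (t / (1 + 2 * t)) ^ (2 * p)) / fact (2 * p + 1)
        = t ^ (2 * p) / (fact (2 * p) * (1 + 2 * t) ^ (2 * p + 2))" .
    qed
    show "0 \<le> t ^ (2 * p) / (fact (2 * p) * (1 + 2 * t) ^ (2 * p + 2))" using pos t by simp
  next
    have "((\<lambda>t::real. t / (1 + 2 * t)) \<longlongrightarrow> 1 / 2) at_top" by real_asymp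
    from tendsto_divide[OF tendsto_power[OF this] tendsto_const, of "fact (2 * p + 1)" "2 * p + 1", OF fact_nonzero]
    show "((\<lambda>t::real. (t / (1 + 2 * t)) ^ (2 * p + 1) / fact (2 * p + 1)) \<longlongrightarrow> (1 / 2) ^ (2 * p + 1) / fact (2 * p + 1)) at_top"
      .
  qed simp
  finally show ?thesis by (simp add: power_one_over field_simps)
qed

subsection \<open>Gaussian quaternion matrices\<close>

definition idx :: "nat \<Rightarrow> nat \<Rightarrow> (nat \<times> nat \<times> nat) set" where
  "idx n l = {..<4} \<times> {..<n} \<times> {..<l}"

text \<open>Reading the same coordinates with fewer rows gives the top block of the matrix; this is
  how the first \<open>k\<close> rows are extracted from a sample on \<open>idx n l\<close>.\<close>

definition mtx :: "nat \<Rightarrow> nat \<Rightarrow> (nat \<times> nat \<times> nat \<Rightarrow> real) \<Rightarrow> quat mat" where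
  "mtx n l x = Matrix.mat n l (\<lambda>(i, j). Quat (x (0, i, j)) (x (1, i, j)) (x (2, i, j)) (x (3, i, j)))"

definition coords :: "nat \<Rightarrow> nat \<Rightarrow> quat mat \<Rightarrow> nat \<times> nat \<times> nat \<Rightarrow> real" where
  "coords n l X = (\<lambda>(c, i, j)\<in>idx n l. quat_component c (X $$ (i, j)))"

lemma finite_idx [simp]: "finite (idx n l)"
  by (simp add: idx_def)

lemma card_idx [simp]: "card (idx n l) = 4 * (n * l)"
  by (simp add: idx_def)

lemma mtx_carrier [simp]: "mtx n l x \<in> carrier_mat n l"
  by (simp add: mtx_def)

lemma mtx_dim [simp]: "dim_row (mtx n l x) = n" "dim_col (mtx n l x) = l"
  by (simp_all add: mtx_def)

lemma mtx_index:
  "i < n \<Longrightarrow> j < l \<Longrightarrow> mtx n l x $$ (i, j) = Quat (x (0, i, j)) (x (1, i, j)) (x (2, i, j)) (x (3, i, j))"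
  by (simp add: mtx_def)

lemma coords_in [simp]: "coords n l X \<in> idx n l \<rightarrow>\<^sub>E UNIV"
  by (simp add: coords_def)

lemma less_4_cases: "c < 4 \<longleftrightarrow> c = 0 \<or> c = 1 \<or> c = 2 \<or> c = (3 :: nat)"
  by auto

lemma quat_component_simps [simp]:
  "quat_component 0 x = qre x" "quat_component (Suc 0) x = qim1 x"
  "quat_component 2 x = qim2 x" "quat_component 3 x = qim3 x"
  by (simp_all add: quat_component_def numeral_2_eq_2 numeral_3_eq_3)

lemma coords_apply:
  "c < 4 \<Longrightarrow> i < n \<Longrightarrow> j < l \<Longrightarrow> coords n l X (c, i, j) = quat_component c (X $$ (i, j))"
  by (simp add: coords_def idx_def)

lemma mtx_coords: "X \<in> carrier_mat n l \<Longrightarrow> mtx n l (coords n l X) = X"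
  by (rule eq_matI) (auto simp: mtx_index coords_apply)

lemma coords_mtx:
  assumes "x \<in> idx n l \<rightarrow>\<^sub>E UNIV"
  shows "coords n l (mtx n l x) = x"
proof (rule ext)
  fix k :: "nat \<times> nat \<times> nat"
  obtain c i j where k: "k = (c, i, j)" by (cases k)
  show "coords n l (mtx n l x) k = x k"
  proof (cases "k \<in> idx n l")
    case True
    then have "c < 4" "i < n" "j < l" by (auto simp: k idx_def)
    then show ?thesis by (auto simp: k coords_apply mtx_index less_4_cases)
  next
    case False
    then show ?thesis using PiE_arb[OF assms False] by (simp add: coords_def)
  qed
qed

lemma sum_less_4: "(\<Sum>c<4. f c) = f 0 + f 1 + f 2 + f (3 :: nat)"
  by (simp add: eval_nat_numeral)

lemma sum_idx_rows_cols:
  "(\<Sum>k\<in>{..<4} \<times> R \<times> C. f k) = (\<Sum>i\<in>R. \<Sum>j\<in>C. \<Sum>c<4. f (c, i, j))"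
proof -
  have "(\<Sum>k\<in>{..<4} \<times> R \<times> C. f k) = (\<Sum>c<4. \<Sum>i\<in>R. \<Sum>j\<in>C. f (c, i, j))"
    by (simp add: sum.cartesian_product)
  also have "\<dots> = (\<Sum>i\<in>R. \<Sum>c<4. \<Sum>j\<in>C. f (c, i, j))" by (rule sum.swap)
  also have "\<dots> = (\<Sum>i\<in>R. \<Sum>j\<in>C. \<Sum>c<4. f (c, i, j))" by (rule sum.cong[OF refl], rule sum.swap)
  finally show ?thesis .
qed

lemma sum_coords_mult:
  assumes "X \<in> carrier_mat n l" "Y \<in> carrier_mat n l"
  shows "(\<Sum>k\<in>idx n l. coords n l X k * coords n l Y k) = mat_inner X Y"
  unfolding mat_inner_cong_dims[OF assms(1)] idx_def sum_idx_rows_cols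
  by (intro sum.cong refl) (simp add: sum_less_4 coords_apply inner_quat_def)

lemma sum_coords_sq:
  "X \<in> carrier_mat n l \<Longrightarrow> (\<Sum>k\<in>idx n l. (coords n l X k)\<^sup>2) = (fnorm X)\<^sup>2"
  unfolding fnorm_sq by (simp add: power2_eq_square sum_coords_mult)

lemma sum_sq_mtx: "(\<Sum>k\<in>idx n l. (x k)\<^sup>2) = (fnorm (mtx n l x))\<^sup>2"
proof -
  have "(\<Sum>k\<in>idx n l. (coords n l (mtx n l x) k)\<^sup>2) = (\<Sum>k\<in>idx n l. (x k)\<^sup>2)"
    by (rule sum.cong) (auto simp: idx_def less_4_cases coords_apply mtx_index)
  then show ?thesis by (simp add: sum_coords_sq)
qed

lemma mtx_ext_add: "mtx n l (ext_add (idx n l) x y) = mtx n l x + mtx n l y"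
  by (rule eq_matI) (auto simp: mtx_index ext_add_def idx_def plus_quat_def)

lemma coords_add:
  "X \<in> carrier_mat n l \<Longrightarrow> Y \<in> carrier_mat n l \<Longrightarrow>
    coords n l (X + Y) = ext_add (idx n l) (coords n l X) (coords n l Y)"
  by (auto simp: coords_def ext_add_def idx_def fun_eq_iff less_4_cases plus_quat_def)

section \<open>Measurability of matrix-valued functions\<close>

definition meas_mat :: "'w measure \<Rightarrow> nat \<Rightarrow> nat \<Rightarrow> ('w \<Rightarrow> quat mat) \<Rightarrow> bool" where
  "meas_mat N a b F \<longleftrightarrow> (\<forall>w. F w \<in> carrier_mat a b) \<and>
     (\<forall>i<a. \<forall>j<b. (\<lambda>w. F w $$ (i, j)) \<in> borel_measurable N)"

lemma meas_mat_const: "X \<in> carrier_mat a b \<Longrightarrow> meas_mat N a b (\<lambda>_. X)"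
  by (simp add: meas_mat_def)

lemma meas_mat_mult:
  assumes "meas_mat N a b F" "meas_mat N b c G"
  shows "meas_mat N a c (\<lambda>w. F w * G w)"
  using assms unfolding meas_mat_def
  by (auto simp: mat_mult_entry[of _ a b _ c] mult_carrier_mat[of _ a b _ c] simp del: index_mult_mat(1)
    intro!: borel_measurable_sum borel_measurable_times)

lemma borel_measurable_conjugate [measurable]: "(conjugate :: quat \<Rightarrow> quat) \<in> borel_measurable borel"
proof (rule borel_measurable_continuous_onI)
  have "bounded_linear (conjugate :: quat \<Rightarrow> quat)"
    by (rule bounded_linear_intro[where K = 1])
      (simp_all add: conjugate_add_quat conjugate_scaleR_quat norm_conjugate_quat)
  then show "continuous_on UNIV (conjugate :: quat \<Rightarrow> quat)"
    by (rule linear_continuous_on)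
qed

lemma meas_mat_adjoint:
  assumes "meas_mat N a b F"
  shows "meas_mat N b a (\<lambda>w. (F w)\<^sup>\<dagger>)"
  unfolding meas_mat_def
proof (intro conjI allI impI)
  show "(F w)\<^sup>\<dagger> \<in> carrier_mat b a" for w using assms by (simp add: meas_mat_def)
  fix i j assume "i < b" "j < a"
  then have "(F w)\<^sup>\<dagger> $$ (i, j) = conjugate (F w $$ (j, i))" for w
    using assms carrier_matD[of "F w" a b] by (simp add: meas_mat_def)
  then have "(\<lambda>w. (F w)\<^sup>\<dagger> $$ (i, j)) = (\<lambda>w. conjugate (F w $$ (j, i)))" by auto
  then show "(\<lambda>w. (F w)\<^sup>\<dagger> $$ (i, j)) \<in> borel_measurable N"
    using assms \<open>i < b\<close> \<open>j < a\<close> by (auto simp: meas_mat_def intro: measurable_compose[OF _ borel_measurable_conjugate])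
qed

lemma meas_mat_add:
  assumes "meas_mat N a b F" "meas_mat N a b G"
  shows "meas_mat N a b (\<lambda>w. F w + G w)"
  unfolding meas_mat_def
proof (intro conjI allI impI)
  have c: "F w \<in> carrier_mat a b" "G w \<in> carrier_mat a b" for w using assms by (auto simp: meas_mat_def)
  show "F w + G w \<in> carrier_mat a b" for w using c by auto
  fix i j assume ij: "i < a" "j < b"
  then have "(\<lambda>w. (F w + G w) $$ (i, j)) = (\<lambda>w. F w $$ (i, j) + G w $$ (i, j))"
    using c carrier_matD[OF c(2)] by auto
  then show "(\<lambda>w. (F w + G w) $$ (i, j)) \<in> borel_measurable N"
    using assms ij by (auto simp: meas_mat_def intro!: borel_measurable_add)
qed

lemma meas_mat_scale:
  assumes "meas_mat N a b F"
  shows "meas_mat N a b (\<lambda>w. mat_scale r (F w))"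
  unfolding meas_mat_def
proof (intro conjI allI impI)
  have c: "F w \<in> carrier_mat a b" for w using assms by (auto simp: meas_mat_def)
  show "mat_scale r (F w) \<in> carrier_mat a b" for w using c by auto
  fix i j assume ij: "i < a" "j < b"
  then have "(\<lambda>w. mat_scale r (F w) $$ (i, j)) = (\<lambda>w. r *\<^sub>R F w $$ (i, j))"
    using carrier_matD[OF c] by auto
  then show "(\<lambda>w. mat_scale r (F w) $$ (i, j)) \<in> borel_measurable N"
    using assms ij by (auto simp: meas_mat_def intro!: borel_measurable_scaleR)
qed

lemma measurable_mat_inner:
  assumes "meas_mat N a b F" "meas_mat N a b G"
  shows "(\<lambda>w. mat_inner (F w) (G w)) \<in> borel_measurable N"
  using assms unfolding meas_mat_def
  by (auto simp: mat_inner_cong_dims[of _ a b] intro!: borel_measurable_sum borel_measurable_inner)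

lemma measurable_fnorm:
  "meas_mat N a b F \<Longrightarrow> (\<lambda>w. fnorm (F w)) \<in> borel_measurable N"
  unfolding fnorm_def by (intro measurable_compose[OF measurable_mat_inner borel_measurable_sqrt])

lemma Quat_basis: "Quat a b c d = a *\<^sub>R Quat 1 0 0 0 + b *\<^sub>R Quat 0 1 0 0 + c *\<^sub>R Quat 0 0 1 0 + d *\<^sub>R Quat 0 0 0 1"
  by (simp add: scaleR_quat_def plus_quat_def)

lemma meas_mat_mtx:
  assumes "k \<le> n" "l' \<le> l" "f \<in> N \<rightarrow>\<^sub>M PiM (idx n l) (\<lambda>_. borel)"
  shows "meas_mat N k l' (\<lambda>w. mtx k l' (f w))"
  unfolding meas_mat_def
proof (intro conjI allI impI)
  fix i j assume ij: "i < k" "j < l'"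
  have "(\<lambda>w. f w (c, i, j)) \<in> borel_measurable N" if "c < 4" for c
    by (rule measurable_compose[OF assms(3) measurable_component_singleton])
      (use ij assms that in \<open>auto simp: idx_def\<close>)
  then have [measurable]: "(\<lambda>w. f w (0, i, j)) \<in> borel_measurable N" "(\<lambda>w. f w (1, i, j)) \<in> borel_measurable N"
    "(\<lambda>w. f w (2, i, j)) \<in> borel_measurable N" "(\<lambda>w. f w (3, i, j)) \<in> borel_measurable N"
    by simp_all
  show "(\<lambda>w. mtx k l' (f w) $$ (i, j)) \<in> borel_measurable N"
    unfolding mtx_index[OF ij] Quat_basis[of "f _ _"] by measurable
qed simp

lemma borel_measurable_quat_component:
  assumes "c < 4"
  shows "quat_component c \<in> borel_measurable borel"
proof -
  have "quat_component c x = inner x (if c = 0 then Quat 1 0 0 0 else if c = 1 then Quat 0 1 0 0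
    else if c = 2 then Quat 0 0 1 0 else Quat 0 0 0 1)" for x
    using assms by (auto simp: less_4_cases inner_quat_def)
  then have "quat_component c = (\<lambda>x. inner x (if c = 0 then Quat 1 0 0 0 else if c = 1 then Quat 0 1 0 0
    else if c = 2 then Quat 0 0 1 0 else Quat 0 0 0 1))" by auto
  then show ?thesis by simp
qed

lemma measurable_coords:
  assumes "meas_mat N n l F"
  shows "(\<lambda>w. coords n l (F w)) \<in> N \<rightarrow>\<^sub>M PiM (idx n l) (\<lambda>_. borel)"
  unfolding coords_def
proof (rule measurable_restrict)
  fix k assume "k \<in> idx n l"
  then obtain c i j where k: "k = (c, i, j)" "c < 4" "i < n" "j < l" by (auto simp: idx_def)
  have "(\<lambda>w. quat_component c (F w $$ (i, j))) \<in> borel_measurable N"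
    using assms k by (intro measurable_compose[OF _ borel_measurable_quat_component]) (auto simp: meas_mat_def)
  then show "(\<lambda>w. (case k of (c, i, j) \<Rightarrow> quat_component c (F w $$ (i, j)))) \<in> borel_measurable N"
    by (simp add: k)
qed

lemma meas_mat_mtx_self: "k \<le> n \<Longrightarrow> meas_mat (PiM (idx n l) (\<lambda>_. borel)) k l (mtx k l)"
  using meas_mat_mtx[of k n l l "\<lambda>x. x" "PiM (idx n l) (\<lambda>_. borel)"] by simp

section \<open>Invariances of the Gaussian matrix\<close>

lemma gauss_matrix_isometry:
  assumes f: "(\<lambda>x. f (mtx n l x)) \<in> borel_measurable (PiM (idx n l) (\<lambda>_. borel))"
    and T: "meas_mat (PiM (idx n l) (\<lambda>_. borel)) n l (\<lambda>x. T (mtx n l x))"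
    and add: "\<And>X Y. X \<in> carrier_mat n l \<Longrightarrow> Y \<in> carrier_mat n l \<Longrightarrow> T (X + Y) = T X + T Y"
    and inv: "\<And>Y. Y \<in> carrier_mat n l \<Longrightarrow> T' Y \<in> carrier_mat n l \<and> T (T' Y) = Y"
    and iso: "\<And>X. X \<in> carrier_mat n l \<Longrightarrow> fnorm (T X) = fnorm X"
  shows "(\<integral>\<^sup>+x. f (T (mtx n l x)) \<partial>gauss (idx n l)) = (\<integral>\<^sup>+x. f (mtx n l x) \<partial>gauss (idx n l))"
proof -
  have TC: "T (mtx n l x) \<in> carrier_mat n l" for x using T by (simp add: meas_mat_def)
  define L where "L x = coords n l (T (mtx n l x))" for x
  have "(\<integral>\<^sup>+x. f (mtx n l (L x)) \<partial>gauss (idx n l)) = (\<integral>\<^sup>+x. f (mtx n l x) \<partial>gauss (idx n l))"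
  proof (rule nn_integral_gauss_isometry[OF finite_idx f])
    show "L \<in> PiM (idx n l) (\<lambda>_. borel) \<rightarrow>\<^sub>M PiM (idx n l) (\<lambda>_. borel)"
      unfolding L_def by (rule measurable_coords[OF T])
    show "L (ext_add (idx n l) x y) = ext_add (idx n l) (L x) (L y)" for x y
      by (simp add: L_def mtx_ext_add add coords_add TC)
    show "\<exists>x\<in>idx n l \<rightarrow>\<^sub>E UNIV. L x = y" if "y \<in> idx n l \<rightarrow>\<^sub>E UNIV" for y
      using that inv[of "mtx n l y"]
      by (intro bexI[of _ "coords n l (T' (mtx n l y))"]) (auto simp: L_def mtx_coords coords_mtx)
    show "(\<Sum>k\<in>idx n l. (L x k)\<^sup>2) = (\<Sum>k\<in>idx n l. (x k)\<^sup>2)" for x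
      by (simp add: L_def sum_coords_sq TC iso) (simp add: sum_sq_mtx)
  qed
  then show ?thesis by (simp add: L_def mtx_coords TC)
qed

lemma gauss_matrix_unitary_left:
  assumes f: "(\<lambda>x. f (mtx n l x)) \<in> borel_measurable (PiM (idx n l) (\<lambda>_. borel))"
    and U: "quat_unitary U" "U \<in> carrier_mat n n"
  shows "(\<integral>\<^sup>+x. f (U * mtx n l x) \<partial>gauss (idx n l)) = (\<integral>\<^sup>+x. f (mtx n l x) \<partial>gauss (idx n l))"
proof (rule gauss_matrix_isometry[OF f, where T' = "\<lambda>Y. U\<^sup>\<dagger> * Y"])
  show "meas_mat (PiM (idx n l) (\<lambda>_. borel)) n l (\<lambda>x. U * mtx n l x)"
    using U by (intro meas_mat_mult[of _ n n] meas_mat_const meas_mat_mtx_self) auto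
  show "U * (X + Y) = U * X + U * Y" if "X \<in> carrier_mat n l" "Y \<in> carrier_mat n l" for X Y
    using that U by (simp add: mult_add_distrib_mat[of _ n n])
  show "U\<^sup>\<dagger> * Y \<in> carrier_mat n l \<and> U * (U\<^sup>\<dagger> * Y) = Y" if "Y \<in> carrier_mat n l" for Y
    using that U by (auto simp: mat_assoc_cancel[of _ n n _ _ l] quat_unitaryD intro!: mult_carrier_mat[of _ n n])
  show "fnorm (U * X) = fnorm X" if "X \<in> carrier_mat n l" for X
    using that U by (simp add: fnorm_unitary_mult[of _ n _ l])
qed

lemma gauss_matrix_unitary_right:
  assumes f: "(\<lambda>x. f (mtx n l x)) \<in> borel_measurable (PiM (idx n l) (\<lambda>_. borel))"
    and U: "quat_unitary U" "U \<in> carrier_mat l l"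
  shows "(\<integral>\<^sup>+x. f (mtx n l x * U) \<partial>gauss (idx n l)) = (\<integral>\<^sup>+x. f (mtx n l x) \<partial>gauss (idx n l))"
proof (rule gauss_matrix_isometry[OF f, where T' = "\<lambda>Y. Y * U\<^sup>\<dagger>" and T = "\<lambda>X. X * U"])
  show "meas_mat (PiM (idx n l) (\<lambda>_. borel)) n l (\<lambda>x. mtx n l x * U)"
    using U by (intro meas_mat_mult[of _ n l] meas_mat_const meas_mat_mtx_self) auto
  show "(X + Y) * U = X * U + Y * U" if "X \<in> carrier_mat n l" "Y \<in> carrier_mat n l" for X Y
    using that U by (simp add: add_mult_distrib_mat[of _ n l])
  show "Y * U\<^sup>\<dagger> \<in> carrier_mat n l \<and> Y * U\<^sup>\<dagger> * U = Y" if "Y \<in> carrier_mat n l" for Y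
    using that U by (auto simp: assoc_mult_mat[of _ n l _ l _ l] quat_unitaryD intro!: mult_carrier_mat[of _ n l])
  show "fnorm (X * U) = fnorm X" if "X \<in> carrier_mat n l" for X
  proof -
    have "fnorm (X * U) = fnorm (U\<^sup>\<dagger> * X\<^sup>\<dagger>)"
      using that U by (simp add: fnorm_adjoint flip: quat_adjoint_mult[of _ n l _ l])
    then show ?thesis
      using that U by (simp add: fnorm_unitary_mult[of _ l _ n] quat_unitary_adjoint fnorm_adjoint)
  qed
qed

lemma gauss_matrix_neg:
  assumes f: "(\<lambda>x. f (mtx n l x)) \<in> borel_measurable (PiM (idx n l) (\<lambda>_. borel))"
  shows "(\<integral>\<^sup>+x. f (mat_scale (- 1) (mtx n l x)) \<partial>gauss (idx n l)) = (\<integral>\<^sup>+x. f (mtx n l x) \<partial>gauss (idx n l))"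
proof (rule gauss_matrix_isometry[OF f, where T' = "mat_scale (- 1)"])
  show "meas_mat (PiM (idx n l) (\<lambda>_. borel)) n l (\<lambda>x. mat_scale (- 1) (mtx n l x))"
    by (intro meas_mat_scale meas_mat_mtx_self) auto
  show "mat_scale (- 1) (X + Y) = mat_scale (- 1) X + mat_scale (- 1) Y"
    if "X \<in> carrier_mat n l" "Y \<in> carrier_mat n l" for X Y
    using that by (intro eq_matI) auto
qed (auto simp: mat_scale_scale fnorm_scale)

lemma gauss_matrix_shift:
  assumes f: "(\<lambda>x. f (mtx n l x)) \<in> borel_measurable (PiM (idx n l) (\<lambda>_. borel))"
    and A: "A \<in> carrier_mat n l"
  shows "(\<integral>\<^sup>+x. f (mtx n l x) \<partial>gauss (idx n l))
    = (\<integral>\<^sup>+x. ennreal (exp (- mat_inner A (mtx n l x) - (fnorm A)\<^sup>2 / 2)) * f (mtx n l x + A) \<partial>gauss (idx n l))"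
  unfolding nn_integral_gauss_shift[OF finite_idx f coords_in[of n l A]]
proof (rule nn_integral_cong)
  fix x assume x: "x \<in> space (gauss (idx n l))"
  have "mat_inner A (mtx n l x) = (\<Sum>k\<in>idx n l. coords n l A k * x k)"
    using sum_coords_mult[OF A, of "mtx n l x"] x by (simp add: coords_mtx)
  then show "ennreal (exp (- (\<Sum>i\<in>idx n l. coords n l A i * x i) - (\<Sum>i\<in>idx n l. (coords n l A i)\<^sup>2) / 2)) *
      f (mtx n l (ext_add (idx n l) x (coords n l A)))
    = ennreal (exp (- mat_inner A (mtx n l x) - (fnorm A)\<^sup>2 / 2)) * f (mtx n l x + A)"
    using A by (simp add: sum_coords_sq mtx_ext_add mtx_coords)
qed

lemma gauss_matrix_exp_inner:
  assumes A: "A \<in> carrier_mat n l"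
  shows "(\<integral>\<^sup>+x. ennreal (exp (mat_inner A (mtx n l x))) \<partial>gauss (idx n l)) = ennreal (exp ((fnorm A)\<^sup>2 / 2))"
proof -
  have "(\<integral>\<^sup>+x. ennreal (exp (mat_inner A (mtx n l x))) \<partial>gauss (idx n l))
    = (\<integral>\<^sup>+x. ennreal (exp (\<Sum>k\<in>idx n l. coords n l A k * x k)) \<partial>gauss (idx n l))"
    by (intro nn_integral_cong) (simp add: coords_mtx flip: sum_coords_mult[OF A mtx_carrier])
  then show ?thesis using A by (simp add: nn_integral_gauss_exp_linear sum_coords_sq)
qed

lemma gauss_matrix_even_moment:
  "(\<integral>\<^sup>+x. ennreal (fnorm (mtx n l x) ^ (2 * r)) \<partial>gauss (idx n l)) = ennreal (2 ^ r * pochhammer (2 * real (n * l)) r)"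
  unfolding power_mult
  using nn_integral_gauss_even_moment[OF finite_idx[of n l], where r = r] by (simp add: sum_sq_mtx mult.commute)

section \<open>Blocks and resampling of rows\<close>

lemma restrict_mtx: "k \<le> n \<Longrightarrow> mtx k l (restrict x (idx k l)) = mtx k l x"
  by (rule eq_matI) (auto simp: mtx_index idx_def)

lemma gauss_matrix_marginal:
  assumes f: "(\<lambda>x. f (mtx k l x)) \<in> borel_measurable (PiM (idx k l) (\<lambda>_. borel))" and k: "k \<le> n"
  shows "(\<integral>\<^sup>+x. f (mtx k l x) \<partial>gauss (idx n l)) = (\<integral>\<^sup>+x. f (mtx k l x) \<partial>gauss (idx k l))"
proof -
  have "idx k l \<subseteq> idx n l" using k by (auto simp: idx_def)
  from nn_integral_gauss_marginal[OF finite_idx this f] show ?thesis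
    using k by (simp add: restrict_mtx)
qed

text \<open>Conditioning in matrix form: the rows in \<open>P\<close> are fresh, the others frozen.
  It is used with \<open>P = {0}\<close> for one row given the rest, and with
  \<open>P = - {..<k}\<close> for the lower rows given the first \<open>k\<close>.\<close>

definition mix_rows :: "nat set \<Rightarrow> quat mat \<Rightarrow> quat mat \<Rightarrow> quat mat" where
  "mix_rows P X Y = Matrix.mat (dim_row X) (dim_col X) (\<lambda>(i, j). if i \<in> P then X $$ (i, j) else Y $$ (i, j))"

lemma mix_rows_carrier [simp]: "mix_rows P X Y \<in> carrier_mat a b \<longleftrightarrow> X \<in> carrier_mat a b"
  by (auto simp: mix_rows_def intro!: carrier_matI dest: carrier_matD)

lemma mix_rows_index [simp]:
  "i < dim_row X \<Longrightarrow> j < dim_col X \<Longrightarrow> mix_rows P X Y $$ (i, j) = (if i \<in> P then X $$ (i, j) else Y $$ (i, j))"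
  "dim_row (mix_rows P X Y) = dim_row X" "dim_col (mix_rows P X Y) = dim_col X"
  by (simp_all add: mix_rows_def)

lemma gauss_matrix_resample:
  assumes f: "(\<lambda>x. f (mtx n l x)) \<in> borel_measurable (PiM (idx n l) (\<lambda>_. borel))"
  shows "(\<integral>\<^sup>+x. f (mtx n l x) \<partial>gauss (idx n l))
    = (\<integral>\<^sup>+y. \<integral>\<^sup>+x. f (mix_rows P (mtx n l x) (mtx n l y)) \<partial>gauss (idx n l) \<partial>gauss (idx n l))"
proof -
  let ?B = "idx n l \<inter> {(c, i, j). i \<in> P}"
  have eq: "mtx n l (\<lambda>k\<in>idx n l. if k \<in> ?B then x k else y k) = mix_rows P (mtx n l x) (mtx n l y)" for x y
    by (rule eq_matI) (auto simp: mtx_index idx_def)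
  have "?B \<subseteq> idx n l" by auto
  from nn_integral_gauss_resample[OF finite_idx this f] show ?thesis unfolding eq .
qed

text \<open>Independence and the marginal laws determine the joint law of all real coordinates, so
  \<Omega> may be replaced by the canonical Gaussian matrix.\<close>

lemma quat_test_matrix_nn_integral:
  assumes M: "prob_space M" and Om: "quat_test_matrix M n l \<Omega>" and nl: "0 < n" "0 < l"
    and f: "(\<lambda>x. f (mtx n l x)) \<in> borel_measurable (PiM (idx n l) (\<lambda>_. borel))"
  shows "(\<integral>\<^sup>+w. f (\<Omega> w) \<partial>M) = (\<integral>\<^sup>+x. f (mtx n l x) \<partial>gauss (idx n l))"
    and "(\<lambda>w. f (\<Omega> w)) \<in> borel_measurable M"
proof -
  interpret prob_space M by fact
  define X where "X = (\<lambda>(c, i, j) w. quat_component c (\<Omega> w $$ (i, j)))"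
  have ind: "indep_vars (\<lambda>_. borel) X (idx n l)"
    and dist: "\<And>k. k \<in> idx n l \<Longrightarrow> distributed M lborel (X k) (\<lambda>x. ennreal (std_normal_density x))"
    and car: "\<And>w. w \<in> space M \<Longrightarrow> \<Omega> w \<in> carrier_mat n l"
    using Om by (auto simp: quat_test_matrix_def X_def idx_def)
  have "(0, 0, 0) \<in> idx n l" using nl by (simp add: idx_def)
  then have ne: "idx n l \<noteq> {}" by auto
  have rv: "X k \<in> borel_measurable M" if "k \<in> idx n l" for k
    using distributed_measurable[OF dist[OF that]] by simp
  have Xm: "(\<lambda>w. \<lambda>k\<in>idx n l. X k w) \<in> M \<rightarrow>\<^sub>M PiM (idx n l) (\<lambda>_. borel)"
    using rv by (rule measurable_restrict)
  have "distr M (PiM (idx n l) (\<lambda>_. borel)) (\<lambda>w. \<lambda>k\<in>idx n l. X k w) = PiM (idx n l) (\<lambda>k. distr M borel (X k))"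
    using indep_vars_iff_distr_eq_PiM'[OF ne rv] ind by simp
  also have "\<dots> = gauss (idx n l)"
    unfolding gauss_def
  proof (rule PiM_cong[OF refl])
    fix k assume "k \<in> idx n l"
    then show "distr M borel (X k) = density lborel (\<lambda>x. ennreal (std_normal_density x))"
      using distributed_distr_eq_density[OF dist] by (simp cong: distr_cong)
  qed
  finally have D: "distr M (PiM (idx n l) (\<lambda>_. borel)) (\<lambda>w. \<lambda>k\<in>idx n l. X k w) = gauss (idx n l)" .
  have eq: "mtx n l (\<lambda>k\<in>idx n l. X k w) = \<Omega> w" if "w \<in> space M" for w
    using car[OF that] by (intro eq_matI) (auto simp: mtx_index idx_def X_def)
  have "(\<integral>\<^sup>+x. f (mtx n l x) \<partial>gauss (idx n l)) = (\<integral>\<^sup>+w. f (mtx n l (\<lambda>k\<in>idx n l. X k w)) \<partial>M)"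
    unfolding D[symmetric] by (rule nn_integral_distr[OF Xm]) (use f in simp)
  then show "(\<integral>\<^sup>+w. f (\<Omega> w) \<partial>M) = (\<integral>\<^sup>+x. f (mtx n l x) \<partial>gauss (idx n l))"
    using eq by (simp cong: nn_integral_cong)
  have "(\<lambda>w. f (mtx n l (\<lambda>k\<in>idx n l. X k w))) \<in> borel_measurable M"
    by (rule measurable_compose[OF Xm f])
  then show "(\<lambda>w. f (\<Omega> w)) \<in> borel_measurable M"
    using eq by (simp cong: measurable_cong)
qed

subsection \<open>Right inverses of full rank matrices\<close>

lemma quat_diag_mult:
  assumes "min a c \<le> b"
  shows "quat_diag a b f * quat_diag b c g = quat_diag a c (\<lambda>i. f i * g i)"
proof (rule eq_matI)
  fix i j assume "i < dim_row (quat_diag a c (\<lambda>i. f i * g i))" "j < dim_col (quat_diag a c (\<lambda>i. f i * g i))"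
  then have ij: "i < a" "j < c" by auto
  then show "(quat_diag a b f * quat_diag b c g) $$ (i, j) = quat_diag a c (\<lambda>i. f i * g i) $$ (i, j)"
    using assms by (subst quat_diag_mult_index[of _ b c]) (auto simp: quat_diag_def quat_of_real_eq_scaleR)
qed auto

lemma quat_diag_one: "(\<And>i. 1 \<le> i \<Longrightarrow> i \<le> n \<Longrightarrow> f i = 1) \<Longrightarrow> quat_diag n n f = 1\<^sub>m n"
  by (rule eq_matI) (auto simp: quat_diag_def quat_of_real_eq_scaleR)

text \<open>If row \<open>i\<close> of the diagonal factor vanished, row \<open>i\<close> of
  \<open>U\<^sup>\<dagger>\<close> would be a nonzero left annihilator of \<open>X\<close>.\<close>

lemma full_row_rank_singular_values:
  assumes X: "X \<in> carrier_mat k l" and r: "full_row_rank X" and svd: "is_qsvd X U \<sigma> V" and i: "i < k"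
  shows "i < l" "\<sigma> (Suc i) \<noteq> 0"
proof -
  note D = is_qsvdD[OF svd X]
  define e where "e = (unit_col k i)\<^sup>\<dagger>"
  define x where "x = e * U\<^sup>\<dagger>"
  have e: "e \<in> carrier_mat 1 k" by (simp add: e_def)
  have x: "x \<in> carrier_mat 1 k" using e D by (auto simp: x_def intro!: mult_carrier_mat[of _ 1 k])
  have "\<not> (l \<le> i \<or> \<sigma> (Suc i) = 0)"
  proof
    assume z: "l \<le> i \<or> \<sigma> (Suc i) = 0"
    have "e * quat_diag k l \<sigma> = (quat_diag l k \<sigma> * unit_col k i)\<^sup>\<dagger>"
      by (simp add: e_def quat_adjoint_mult[of _ l k _ 1] quat_diag_adjoint)
    also have "quat_diag l k \<sigma> * unit_col k i = 0\<^sub>m l 1"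
      using z by (intro eq_matI) (auto simp: quat_diag_mult_index[of _ k 1] simp del: index_mult_mat(1))
    finally have e0: "e * quat_diag k l \<sigma> = 0\<^sub>m 1 l" by simp
    have "x * X = e * (U\<^sup>\<dagger> * (U * (quat_diag k l \<sigma> * V\<^sup>\<dagger>)))"
      using e D(1-4) by (subst D(5)) (simp add: x_def assoc_mult_mat[of _ 1 k _ k _ l]
        assoc_mult_mat[of _ k k _ l _ l] mult_carrier_mat[of _ k k _ l] mult_carrier_mat[of _ k l _ l])
    also have "\<dots> = e * quat_diag k l \<sigma> * V\<^sup>\<dagger>"
      using e D(1-4) by (simp add: mat_assoc_cancel[of _ k k _ _ l] quat_unitaryD mult_carrier_mat[of _ k l _ l]
        assoc_mult_mat[of _ 1 k _ l _ l])
    also have "\<dots> = 0\<^sub>m 1 l" using D(3) by (simp add: e0)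
    finally have "x = 0\<^sub>m 1 k" using r x X by (simp add: full_row_rank_def)
    moreover have "x * U = e"
      using e D(1,2) by (simp add: x_def assoc_mult_mat[of _ 1 k _ k _ k] quat_unitaryD)
    ultimately have "e = 0\<^sub>m 1 k" using D(1) by simp
    moreover have "e $$ (0, i) = 1" using i by (simp add: e_def conjugate_one_quat)
    ultimately show False using i by simp
  qed
  then show "i < l" "\<sigma> (Suc i) \<noteq> 0" by auto
qed

text \<open>The Gram matrix is inverted through the singular value decomposition, by inverting the
  squared singular values.\<close>

lemma full_row_rank_gram_inverse:
  assumes X: "X \<in> carrier_mat k l" and r: "full_row_rank X"
  obtains Z where "Z \<in> carrier_mat k k" "X * (X\<^sup>\<dagger> * Z) = 1\<^sub>m k" "Z * (X * X\<^sup>\<dagger>) = 1\<^sub>m k"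
proof -
  obtain U \<sigma> V where svd: "is_qsvd X U \<sigma> V" using qsvd_exists[OF X] by blast
  note D = is_qsvdD[OF svd X]
  note S = full_row_rank_singular_values[OF X r svd]
  define W where "W = quat_diag k k (\<lambda>i. \<sigma> i * \<sigma> i)"
  define W' where "W' = quat_diag k k (\<lambda>i. inverse (\<sigma> i * \<sigma> i))"
  define Z where "Z = U * W' * U\<^sup>\<dagger>"
  have c: "W \<in> carrier_mat k k" "W' \<in> carrier_mat k k" by (simp_all add: W_def W'_def)
  have Z: "Z \<in> carrier_mat k k" using D(1) c by (auto simp: Z_def intro!: mult_carrier_mat[of _ k k])
  have nz: "\<sigma> i \<noteq> 0" if "1 \<le> i" "i \<le> k" for i
    using S(2)[of "i - 1"] that by simp
  have WW: "W * W' = 1\<^sub>m k" "W' * W = 1\<^sub>m k"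
    unfolding W_def W'_def using nz by (auto simp: quat_diag_mult field_simps intro!: quat_diag_one)
  have kl: "k \<le> l" using S(1)[of "k - 1"] by (cases k) auto
  have "X * X\<^sup>\<dagger> = U * (quat_diag k l \<sigma> * (V\<^sup>\<dagger> * (V * (quat_diag l k \<sigma> * U\<^sup>\<dagger>))))"
    using D(1-4) unfolding D(5)
    by (simp add: quat_adjoint_mult[of _ k l _ l] quat_adjoint_mult[of _ k k _ l] quat_diag_adjoint
      assoc_mult_mat[of _ k l _ l _ k] assoc_mult_mat[of _ k k _ l _ l] assoc_mult_mat[of _ k k _ l _ k]
      assoc_mult_mat[of _ l l _ k _ k] mult_carrier_mat[of _ k k _ l] mult_carrier_mat[of _ k l _ l]
      mult_carrier_mat[of _ l l _ k] mult_carrier_mat[of _ l k _ k])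
  also have "\<dots> = U * (quat_diag k l \<sigma> * (quat_diag l k \<sigma> * U\<^sup>\<dagger>))"
    using D(1-4) by (simp add: mat_assoc_cancel[of _ l l _ _ k] quat_unitaryD mult_carrier_mat[of _ l k _ k])
  also have "quat_diag k l \<sigma> * (quat_diag l k \<sigma> * U\<^sup>\<dagger>) = W * U\<^sup>\<dagger>"
    using D(1) kl by (simp add: quat_diag_mult W_def flip: assoc_mult_mat[of _ k l _ k _ k])
  finally have XX: "X * X\<^sup>\<dagger> = U * (W * U\<^sup>\<dagger>)" .
  note simps = assoc_mult_mat[of _ k k _ k _ k] mult_carrier_mat[of _ k k _ k] mat_assoc_cancel[of _ k k _ _ k]
    quat_unitaryD WW
  show ?thesis
  proof (rule that[OF Z])
    have "X * (X\<^sup>\<dagger> * Z) = X * X\<^sup>\<dagger> * Z"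
      using X Z by (simp add: assoc_mult_mat[of _ k l _ k _ k])
    also have "\<dots> = 1\<^sub>m k" unfolding XX Z_def using D(1,2) c by (simp add: simps)
    finally show "X * (X\<^sup>\<dagger> * Z) = 1\<^sub>m k" .
    show "Z * (X * X\<^sup>\<dagger>) = 1\<^sub>m k" unfolding XX Z_def using D(1,2) c by (simp add: simps)
  qed
qed

text \<open>\<open>inv_form X g = g\<^sup>* (X X\<^sup>*)\<^sup>-\<^sup>1 g\<close>, written as a convex conjugate so that it is a supremum of
  continuous functions, also where \<open>X X\<^sup>*\<close> is singular.\<close>

definition inv_form :: "quat mat \<Rightarrow> quat mat \<Rightarrow> ennreal" where
  "inv_form X g = (SUP \<zeta>. ennreal (2 * mat_inner g (col_of (dim_row X) \<zeta>) - (fnorm (X\<^sup>\<dagger> * col_of (dim_row X) \<zeta>))\<^sup>2))"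

lemma inv_form_leI:
  assumes "X \<in> carrier_mat k l"
    and "\<And>z. z \<in> carrier_mat k 1 \<Longrightarrow> ennreal (2 * mat_inner g z - (fnorm (X\<^sup>\<dagger> * z))\<^sup>2) \<le> c"
  shows "inv_form X g \<le> c"
  unfolding inv_form_def using assms by (intro SUP_least) auto

lemma inv_form_ge:
  assumes "X \<in> carrier_mat k l" "z \<in> carrier_mat k 1"
  shows "ennreal (2 * mat_inner g z - (fnorm (X\<^sup>\<dagger> * z))\<^sup>2) \<le> inv_form X g"
  unfolding inv_form_def using assms
  by (intro SUP_upper2[of "\<lambda>i. z $$ (i, 0)"]) (auto simp: col_of_entries[unfolded One_nat_def])

text \<open>The column \<open>T\<close> solves \<open>X * T = g\<close> and lies in the range of
  \<open>X\<^sup>\<dagger>\<close>. Completing the square leaves \<open>(fnorm T)\<^sup>2 - (fnorm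
  (T - X\<^sup>\<dagger> * z))\<^sup>2\<close>, which is largest at
  \<open>z = Z * g\<close>.\<close>

lemma inv_form_full_rank:
  assumes X: "X \<in> carrier_mat k l" and Z: "Z \<in> carrier_mat k k" "X * (X\<^sup>\<dagger> * Z) = 1\<^sub>m k"
    and g: "g \<in> carrier_mat k 1"
  shows "inv_form X g = ennreal ((fnorm (X\<^sup>\<dagger> * Z * g))\<^sup>2)"
proof -
  define T where "T = X\<^sup>\<dagger> * Z * g"
  have T: "T \<in> carrier_mat l 1" using X Z g by (auto simp: T_def intro!: mult_carrier_mat[of _ l k])
  have XT: "X * T = g"
    using assoc_mult_mat[of X k l "X\<^sup>\<dagger> * Z" k g 1] X Z g
    by (simp add: T_def mult_carrier_mat[of _ l k _ k])
  have eq: "2 * mat_inner g z - (fnorm (X\<^sup>\<dagger> * z))\<^sup>2 = (fnorm T)\<^sup>2 - (fnorm (T - X\<^sup>\<dagger> * z))\<^sup>2"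
    if z: "z \<in> carrier_mat k 1" for z
  proof -
    have Xz: "X\<^sup>\<dagger> * z \<in> carrier_mat l 1" using X z by (auto intro!: mult_carrier_mat[of _ l k])
    have "mat_inner g z = mat_inner T (X\<^sup>\<dagger> * z)"
      unfolding XT[symmetric] using X T z by (rule mat_inner_mult_left)
    moreover have "(fnorm (T - X\<^sup>\<dagger> * z))\<^sup>2 = (fnorm T)\<^sup>2 - 2 * mat_inner T (X\<^sup>\<dagger> * z) + (fnorm (X\<^sup>\<dagger> * z))\<^sup>2"
      using T Xz minus_carrier_mat[OF Xz, of T] mat_inner_commute[of "X\<^sup>\<dagger> * z" l 1 T]
      by (simp add: fnorm_sq mat_inner_minus[of _ l 1])
    ultimately show ?thesis by simp
  qed
  show ?thesis
    unfolding T_def[symmetric]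
  proof (rule antisym)
    show "inv_form X g \<le> ennreal ((fnorm T)\<^sup>2)"
      using eq by (intro inv_form_leI[OF X] ennreal_leI) auto
    have Zg: "Z * g \<in> carrier_mat k 1" using Z g by (auto intro!: mult_carrier_mat[of _ k k])
    have "X\<^sup>\<dagger> * (Z * g) = T" using X Z g by (simp add: T_def assoc_mult_mat[of _ l k _ k _ 1])
    moreover have "T - T = 0\<^sub>m l 1" using T by (intro eq_matI) auto
    ultimately show "ennreal ((fnorm T)\<^sup>2) \<le> inv_form X g"
      using inv_form_ge[OF X Zg, of g] eq[OF Zg] by (simp add: fnorm_def)
  qed
qed

text \<open>Along the adjoint of a left annihilator the quadratic term vanishes, so the linear term
  is unbounded for every coordinate in which the annihilator is nonzero.\<close>

lemma full_row_rank_if_inv_form_finite: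
  assumes X: "X \<in> carrier_mat k l" and fin: "\<And>i. i < k \<Longrightarrow> inv_form X (unit_col k i) < \<top>"
  shows "full_row_rank X"
  unfolding full_row_rank_def
proof (intro ballI impI)
  fix x assume "x \<in> carrier_mat 1 (dim_row X)" and xX: "x * X = 0\<^sub>m 1 (dim_col X)"
  then have x: "x \<in> carrier_mat 1 k" using X by auto
  have Xx: "X\<^sup>\<dagger> * x\<^sup>\<dagger> = 0\<^sub>m l 1"
    using quat_adjoint_mult[OF x X] xX X by simp
  have "x $$ (0, i) = 0" if i: "i < k" for i
  proof (rule ccontr)
    assume nz: "x $$ (0, i) \<noteq> 0"
    obtain b where b: "0 \<le> b" "inv_form X (unit_col k i) = ennreal b"
      using fin[OF i] by (cases "inv_form X (unit_col k i)") auto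
    \<comment> \<open>Scaled so that the linear term becomes \<open>2 * (b + 1)\<close>, beyond the
      supposed finite value \<open>b\<close>.\<close>
    define c where "c = (b + 1) / (norm (x $$ (0, i)))\<^sup>2"
    define q where "q = Matrix.mat 1 1 (\<lambda>_. c *\<^sub>R x $$ (0, i))"
    define z where "z = x\<^sup>\<dagger> * q"
    have q: "q \<in> carrier_mat 1 1" by (simp add: q_def)
    have z: "z \<in> carrier_mat k 1" using x q by (auto simp: z_def intro!: mult_carrier_mat[of _ k 1])
    have "X\<^sup>\<dagger> * z = 0\<^sub>m l 1"
      using X x q by (simp add: z_def Xx flip: assoc_mult_mat[of _ l k _ 1 _ 1])
    then have Xz: "fnorm (X\<^sup>\<dagger> * z) = 0" by (simp add: fnorm_def)
    have zi: "z $$ (i, 0) = (b + 1) *\<^sub>R 1"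
    proof -
      have "z $$ (i, 0) = conjugate (x $$ (0, i)) * (c *\<^sub>R x $$ (0, i))"
        unfolding z_def using x q i by (subst mat_mult_entry[of _ k 1 _ 1]) (auto simp: q_def)
      then show ?thesis using nz by (simp add: mult_conjugate_quat c_def)
    qed
    have "mat_inner (unit_col k i) z = (\<Sum>j<k. if j = i then inner 1 (z $$ (j, 0)) else 0)"
      by (simp add: mat_inner_cong_dims[of _ k 1] if_distrib[of "\<lambda>x. inner x _"] cong: if_cong)
    also have "\<dots> = b + 1" using i by (simp add: zi inner_quat_def one_quat_def scaleR_quat_def)
    finally have "2 * mat_inner (unit_col k i) z - (fnorm (X\<^sup>\<dagger> * z))\<^sup>2 = 2 * (b + 1)" by (simp add: Xz)
    then have "2 * (b + 1) \<le> b"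
      using inv_form_ge[OF X z, of "unit_col k i"] b by (simp only: ennreal_le_iff)
    then show False using b by simp
  qed
  then show "x = 0\<^sub>m 1 (dim_row X)" using x X by (intro eq_matI) auto
qed

lemma inv_form_unitary:
  assumes X: "X \<in> carrier_mat k l" and U: "quat_unitary U" "U \<in> carrier_mat k k" and g: "g \<in> carrier_mat k 1"
  shows "inv_form (U * X) g \<le> inv_form X (U\<^sup>\<dagger> * g)"
proof (rule inv_form_leI)
  show "U * X \<in> carrier_mat k l" using U X by auto
  fix z :: "quat mat" assume z: "z \<in> carrier_mat k 1"
  have "mat_inner g z = mat_inner (U\<^sup>\<dagger> * g) (U\<^sup>\<dagger> * z)"
    using U g z by (simp add: mat_inner_unitary_mult[of _ k _ 1] quat_unitary_adjoint)
  moreover have "(U * X)\<^sup>\<dagger> * z = X\<^sup>\<dagger> * (U\<^sup>\<dagger> * z)"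
    using X U z by (simp add: quat_adjoint_mult[of _ k k _ l] assoc_mult_mat[of _ l k _ k _ 1])
  moreover have "U\<^sup>\<dagger> * z \<in> carrier_mat k 1" using U z by (auto intro!: mult_carrier_mat[of _ k k])
  ultimately show "ennreal (2 * mat_inner g z - (fnorm ((U * X)\<^sup>\<dagger> * z))\<^sup>2) \<le> inv_form X (U\<^sup>\<dagger> * g)"
    using inv_form_ge[OF X, of "U\<^sup>\<dagger> * z" "U\<^sup>\<dagger> * g"] by simp
qed

text \<open>The suprema that follow run over continuous functions of a sequence; restricting them to
  a fixed countable dense set keeps them measurable in the matrix.\<close>

definition dense_seqs :: "(nat \<Rightarrow> quat) set" where
  "dense_seqs = (SOME D. countable D \<and> (\<forall>X. open X \<longrightarrow> X \<noteq> {} \<longrightarrow> (\<exists>d\<in>D. d \<in> X)))"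

lemma countable_dense_seqs: "countable dense_seqs"
  and dense_seqs: "open X \<Longrightarrow> X \<noteq> {} \<Longrightarrow> \<exists>d\<in>dense_seqs. d \<in> X"
proof -
  have "\<exists>D. countable D \<and> (\<forall>X. open X \<longrightarrow> X \<noteq> {} \<longrightarrow> (\<exists>d\<in>D. d \<in> (X :: (nat \<Rightarrow> quat) set)))"
    using countable_dense_exists by blast
  from someI_ex[OF this] show "countable dense_seqs" "open X \<Longrightarrow> X \<noteq> {} \<Longrightarrow> \<exists>d\<in>dense_seqs. d \<in> X"
    unfolding dense_seqs_def[symmetric] by blast+
qed

text \<open>A value exceeding the countable supremum would persist on an open set of sequences, and
  that set meets the dense one.\<close>

lemma inv_form_dense:
  assumes X: "X \<in> carrier_mat k l" and g: "g \<in> carrier_mat k 1"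
  shows "inv_form X g = (SUP \<zeta>\<in>dense_seqs. ennreal (2 * mat_inner g (col_of k \<zeta>) - (fnorm (X\<^sup>\<dagger> * col_of k \<zeta>))\<^sup>2))"
proof (rule antisym)
  let ?h = "\<lambda>\<zeta>. 2 * mat_inner g (col_of k \<zeta>) - (fnorm (X\<^sup>\<dagger> * col_of k \<zeta>))\<^sup>2"
  have cont: "continuous_on UNIV ?h"
    using X g by (intro continuous_intros continuous_mat_inner[of k 1] continuous_fnorm[of l 1] cont_mat_const
      cont_mat_mult[of l k _ 1] cont_mat_col_of) auto
  show "inv_form X g \<le> (SUP \<zeta>\<in>dense_seqs. ennreal (?h \<zeta>))"
    unfolding inv_form_def
  proof (rule SUP_least, rule ccontr)
    fix \<xi> :: "nat \<Rightarrow> quat"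
    assume "\<not> ennreal (2 * mat_inner g (col_of (dim_row X) \<xi>) - (fnorm (X\<^sup>\<dagger> * col_of (dim_row X) \<xi>))\<^sup>2)
      \<le> (SUP \<zeta>\<in>dense_seqs. ennreal (?h \<zeta>))"
    then have lt: "(SUP \<zeta>\<in>dense_seqs. ennreal (?h \<zeta>)) < ennreal (?h \<xi>)" using X by (auto simp: not_le)
    then obtain s where s: "0 \<le> s" "(SUP \<zeta>\<in>dense_seqs. ennreal (?h \<zeta>)) = ennreal s"
      by (cases "SUP \<zeta>\<in>dense_seqs. ennreal (?h \<zeta>)") auto
    have "open {\<zeta>. s < ?h \<zeta>}" by (rule open_Collect_less[OF continuous_on_const cont])
    moreover have "\<xi> \<in> {\<zeta>. s < ?h \<zeta>}" using lt s by (simp add: ennreal_less_iff)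
    ultimately obtain d where d: "d \<in> dense_seqs" "s < ?h d" using dense_seqs[of "{\<zeta>. s < ?h \<zeta>}"] by blast
    have "ennreal (?h d) \<le> ennreal s" unfolding s(2)[symmetric] by (rule SUP_upper[OF d(1)])
    then show False using d(2) s(1) by (auto simp: ennreal_le_iff)
  qed
  show "(SUP \<zeta>\<in>dense_seqs. ennreal (?h \<zeta>)) \<le> inv_form X g"
    using inv_form_ge[OF X] by (intro SUP_least) auto
qed

lemma measurable_inv_form:
  assumes F: "meas_mat N k l F" and G: "meas_mat N k 1 G"
  shows "(\<lambda>w. inv_form (F w) (G w)) \<in> borel_measurable N"
proof -
  have "F w \<in> carrier_mat k l" "G w \<in> carrier_mat k 1" for w
    using F G by (auto simp: meas_mat_def)
  note eq = inv_form_dense[OF this]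
  show ?thesis
    unfolding eq
    by (intro borel_measurable_SUP countable_dense_seqs measurable_compose[OF _ measurable_ennreal]
      borel_measurable_diff borel_measurable_times borel_measurable_const borel_measurable_power
      measurable_mat_inner[of _ k 1] measurable_fnorm[of _ l 1] meas_mat_mult[of _ l k _ 1]
      meas_mat_adjoint F G meas_mat_const) auto
qed

section \<open>The operator norm of the sampled tail as a countable supremum\<close>

definition top_rows :: "nat \<Rightarrow> quat mat \<Rightarrow> quat mat" where
  "top_rows k Y = Matrix.mat k (dim_col Y) (\<lambda>(i, j). Y $$ (i, j))"

lemma top_rows_carrier [simp]: "Y \<in> carrier_mat n l \<Longrightarrow> top_rows k Y \<in> carrier_mat k l"
  by (auto simp: top_rows_def)

lemma top_rows_mult:
  assumes "A \<in> carrier_mat n l" "B \<in> carrier_mat l c" "k \<le> n"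
  shows "top_rows k (A * B) = top_rows k A * B"
proof (rule eq_matI)
  fix i j assume "i < dim_row (top_rows k A * B)" "j < dim_col (top_rows k A * B)"
  then have ij: "i < k" "j < c" using assms by (auto simp: top_rows_def)
  show "top_rows k (A * B) $$ (i, j) = (top_rows k A * B) $$ (i, j)"
    using assms ij top_rows_carrier[OF assms(1), of k]
    by (subst mat_mult_entry[of _ k l _ c]) (auto simp: top_rows_def mat_mult_entry[of _ n l _ c] simp del: index_mult_mat(1))
qed (auto simp: top_rows_def)

lemma meas_mat_top_rows:
  assumes F: "meas_mat N n l F" and k: "k \<le> n"
  shows "meas_mat N k l (\<lambda>w. top_rows k (F w))"
proof -
  have c: "F w \<in> carrier_mat n l" for w using F by (auto simp: meas_mat_def)
  have "top_rows k (F w) $$ (i, j) = F w $$ (i, j)" if "i < k" "j < l" for w i j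
    using that carrier_matD[OF c] by (simp add: top_rows_def)
  then show ?thesis using F k top_rows_carrier[OF c, of k] by (auto simp: meas_mat_def)
qed

text \<open>When \<open>X = top_rows k Y\<close> has full row rank, this is the operator norm of \<open>S Y X\<^sup>*(X X\<^sup>*)\<^sup>-\<^sup>1\<close>, with the
  inverse eliminated by the substitution \<open>y = X X\<^sup>* \<zeta>\<close>; a countable dense set of \<open>\<zeta>\<close> keeps it measurable.\<close>

definition tail_ratio :: "quat mat \<Rightarrow> nat \<Rightarrow> quat mat \<Rightarrow> ennreal" where
  "tail_ratio S k Y = (SUP \<zeta>\<in>dense_seqs. ennreal (fnorm (S * (Y * ((top_rows k Y)\<^sup>\<dagger> * col_of k \<zeta>)))
     / fnorm (top_rows k Y * ((top_rows k Y)\<^sup>\<dagger> * col_of k \<zeta>))))"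

lemma measurable_tail_ratio:
  assumes S: "S \<in> carrier_mat a n" and F: "meas_mat N n l F" and k: "k \<le> n"
  shows "(\<lambda>w. tail_ratio S k (F w)) \<in> borel_measurable N"
proof -
  note top = meas_mat_top_rows[OF F k]
  show ?thesis
    unfolding tail_ratio_def
    by (intro borel_measurable_SUP countable_dense_seqs measurable_compose[OF _ measurable_ennreal]
      borel_measurable_divide measurable_fnorm[of _ a 1] measurable_fnorm[of _ k 1]
      meas_mat_mult[of _ a n _ 1] meas_mat_mult[of _ n l _ 1] meas_mat_mult[of _ l k _ 1] meas_mat_mult[of _ k l _ 1]
      meas_mat_adjoint top F meas_mat_const S) auto
qed

lemma tail_ratio_le:
  assumes S: "S \<in> carrier_mat a n" and Y: "Y \<in> carrier_mat n l" and X: "X = top_rows k Y"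
    and Z: "Z \<in> carrier_mat k k" "Z * (X * X\<^sup>\<dagger>) = 1\<^sub>m k"
    and bd: "\<And>y. y \<in> carrier_mat k 1 \<Longrightarrow> fnorm (S * (Y * (X\<^sup>\<dagger> * Z * y))) \<le> c * fnorm y" and "0 \<le> c"
  shows "tail_ratio S k Y \<le> ennreal c"
  unfolding tail_ratio_def X[symmetric]
proof (rule SUP_least)
  fix \<zeta> :: "nat \<Rightarrow> quat"
  define y where "y = X * (X\<^sup>\<dagger> * col_of k \<zeta>)"
  have Xc: "X \<in> carrier_mat k l" using Y by (simp add: X)
  have y: "y \<in> carrier_mat k 1"
    using Xc by (auto simp: y_def intro!: mult_carrier_mat[of _ k l] mult_carrier_mat[of _ l k])
  have "Z * y = Z * (X * X\<^sup>\<dagger>) * col_of k \<zeta>"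
    using Xc Z(1) by (simp add: y_def assoc_mult_mat[of _ k k _ k _ 1] assoc_mult_mat[of _ k l _ k _ 1]
      mult_carrier_mat[of _ k l _ k])
  then have "Z * y = col_of k \<zeta>" by (simp add: Z(2) left_mult_one_mat[of _ k 1])
  then have "X\<^sup>\<dagger> * Z * y = X\<^sup>\<dagger> * col_of k \<zeta>"
    using Xc Z(1) y by (simp add: assoc_mult_mat[of _ l k _ k _ 1])
  then have "fnorm (S * (Y * (X\<^sup>\<dagger> * col_of k \<zeta>))) \<le> c * fnorm y" using bd[OF y] by simp
  \<comment> \<open>For \<open>y = 0\<close> the quotient is 0 by the convention for division, which
    \<open>0 \<le> c\<close> covers.\<close>
  then have "fnorm (S * (Y * (X\<^sup>\<dagger> * col_of k \<zeta>))) / fnorm y \<le> c"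
    using \<open>0 \<le> c\<close> fnorm_nonneg[of y] by (cases "fnorm y = 0") (auto simp: divide_le_eq order_less_le)
  then show "ennreal (fnorm (S * (Y * (X\<^sup>\<dagger> * col_of k \<zeta>))) / fnorm (X * (X\<^sup>\<dagger> * col_of k \<zeta>))) \<le> ennreal c"
    unfolding y_def by (rule ennreal_leI)
qed

text \<open>The substitution \<open>y = X * X\<^sup>\<dagger> * \<zeta>\<close> reaches every
  \<open>y\<close>. A violation at \<open>\<zeta> = Z * y\<close> persists on an open set, hence
  occurs at a member of the dense set.\<close>

lemma tail_ratio_ge:
  assumes S: "S \<in> carrier_mat a n" and Y: "Y \<in> carrier_mat n l" and X: "X = top_rows k Y"
    and Z: "Z \<in> carrier_mat k k" "X * (X\<^sup>\<dagger> * Z) = 1\<^sub>m k" "Z * (X * X\<^sup>\<dagger>) = 1\<^sub>m k"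
    and y: "y \<in> carrier_mat k 1" and f: "tail_ratio S k Y = ennreal f" "0 \<le> f"
  shows "fnorm (S * (Y * (X\<^sup>\<dagger> * Z * y))) \<le> f * fnorm y"
proof (rule ccontr)
  have Xc: "X \<in> carrier_mat k l" using Y by (simp add: X)
  let ?h1 = "\<lambda>\<zeta>. fnorm (S * (Y * (X\<^sup>\<dagger> * col_of k \<zeta>)))" and ?h2 = "\<lambda>\<zeta>. fnorm (X * (X\<^sup>\<dagger> * col_of k \<zeta>))"
  let ?O = "{\<zeta>. f * ?h2 \<zeta> < ?h1 \<zeta>}"
  assume n: "\<not> fnorm (S * (Y * (X\<^sup>\<dagger> * Z * y))) \<le> f * fnorm y"
  have zc: "Z * y \<in> carrier_mat k 1" using Z y by (auto intro!: mult_carrier_mat[of _ k k])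
  have "col_of k (\<lambda>i. (Z * y) $$ (i, 0)) = Z * y" using zc by (rule col_of_entries)
  moreover have "X\<^sup>\<dagger> * (Z * y) = X\<^sup>\<dagger> * Z * y" using Xc Z y by (simp add: assoc_mult_mat[of _ l k _ k _ 1])
  moreover have "X * (X\<^sup>\<dagger> * Z * y) = y"
    using assoc_mult_mat[of X k l "X\<^sup>\<dagger> * Z" k y 1] Xc Z y
    by (simp add: mult_carrier_mat[of _ l k _ k])
  ultimately have "(\<lambda>i. (Z * y) $$ (i, 0)) \<in> ?O" using n by simp
  moreover have "open ?O"
    using S Y Xc by (intro open_Collect_less continuous_intros continuous_fnorm[of a 1] continuous_fnorm[of k 1]
      cont_mat_mult[of a n _ 1] cont_mat_mult[of n l _ 1] cont_mat_mult[of l k _ 1] cont_mat_mult[of k l _ 1]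
      cont_mat_const cont_mat_col_of) auto
  ultimately obtain d where d: "d \<in> dense_seqs" "f * ?h2 d < ?h1 d" using dense_seqs[of ?O] by blast
  \<comment> \<open>A vanishing denominator would force the column of \<open>d\<close> to be 0, as
    the Gram matrix is invertible; both sides of the strict inequality would then be 0.\<close>
  have "?h2 d \<noteq> 0"
  proof
    assume h: "?h2 d = 0"
    have c: "X * (X\<^sup>\<dagger> * col_of k d) \<in> carrier_mat k 1"
      using Xc by (auto intro!: mult_carrier_mat[of _ k l] mult_carrier_mat[of _ l k])
    have "col_of k d = Z * (X * X\<^sup>\<dagger>) * col_of k d" by (simp add: Z(3) left_mult_one_mat[of _ k 1])
    also have "\<dots> = Z * (X * (X\<^sup>\<dagger> * col_of k d))"
      using Xc Z(1) by (simp add: assoc_mult_mat[of _ k k _ k _ 1] assoc_mult_mat[of _ k l _ k _ 1]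
        mult_carrier_mat[of _ k l _ k])
    also have "X * (X\<^sup>\<dagger> * col_of k d) = 0\<^sub>m k 1" using h c fnorm_eq_0_iff by blast
    finally have "col_of k d = 0\<^sub>m k 1" using Z(1) by simp
    then have "?h1 d = 0" using S Y Xc by (simp add: fnorm_def)
    with d(2) h show False by simp
  qed
  then have "0 < ?h2 d" using fnorm_nonneg[of "X * (X\<^sup>\<dagger> * col_of k d)"] by linarith
  then have "f < ?h1 d / ?h2 d" using d(2) by (simp add: pos_less_divide_eq)
  moreover have "ennreal (?h1 d / ?h2 d) \<le> ennreal f"
    unfolding f(1)[symmetric] tail_ratio_def X[symmetric] by (rule SUP_upper[OF d(1)])
  ultimately show False using f(2) by (simp add: ennreal_le_iff)
qed

subsection \<open>Deterministic error bounds\<close>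

text \<open>Bernoulli's inequality rescaled. This tangent drives both the power mean inequality and
  \<open>young_power\<close>.\<close>

lemma power_ge_tangent:
  fixes t \<mu> :: real
  assumes "0 \<le> t" "0 \<le> \<mu>" "1 \<le> N"
  shows "\<mu> ^ N + real N * \<mu> ^ (N - 1) * (t - \<mu>) \<le> t ^ N"
proof (cases "\<mu> = 0")
  case True
  then show ?thesis using assms by (cases "N = 1") (auto simp: power_0_left)
next
  case False
  then have mu: "0 < \<mu>" using assms by simp
  have "1 + real N * (t / \<mu> - 1) \<le> (1 + (t / \<mu> - 1)) ^ N"
    using assms mu by (intro Bernoulli_inequality) simp
  then have "\<mu> ^ N * (1 + real N * (t / \<mu> - 1)) \<le> \<mu> ^ N * (t / \<mu>) ^ N"
    using mu by (intro mult_left_mono) auto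
  also have "\<mu> ^ N * (t / \<mu>) ^ N = t ^ N" using mu by (simp add: power_divide)
  also have "\<mu> ^ N * (1 + real N * (t / \<mu> - 1)) = \<mu> ^ N + real N * \<mu> ^ (N - 1) * (t - \<mu>)"
    using assms mu by (cases N) (auto simp: field_simps)
  finally show ?thesis .
qed

text \<open>Tangents are taken at the weighted sum \<mu>. The total weight may be below 1, because
  the weights will be squared coordinates of a vector of norm at most 1, some of them dropped; the
  missing mass behaves like mass at 0.\<close>

lemma power_mean_sum:
  fixes w t :: "'i \<Rightarrow> real"
  assumes "\<And>i. i \<in> I \<Longrightarrow> 0 \<le> w i" "\<And>i. i \<in> I \<Longrightarrow> 0 \<le> t i" "(\<Sum>i\<in>I. w i) \<le> 1" "1 \<le> N"
  shows "(\<Sum>i\<in>I. w i * t i) ^ N \<le> (\<Sum>i\<in>I. w i * t i ^ N)"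
proof -
  define \<mu> where "\<mu> = (\<Sum>i\<in>I. w i * t i)"
  define W where "W = (\<Sum>i\<in>I. w i)"
  have mu: "0 \<le> \<mu>" using assms by (auto simp: \<mu>_def intro!: sum_nonneg)
  have "(\<Sum>i\<in>I. w i * (x + c * (t i - y))) = x * W + c * (\<mu> - y * W)" for x c y
    by (simp add: W_def \<mu>_def algebra_simps sum.distrib sum_subtractf sum_distrib_left)
  from this[symmetric]
  have "\<mu> ^ N * W + real N * \<mu> ^ (N - 1) * (\<mu> - \<mu> * W)
    = (\<Sum>i\<in>I. w i * (\<mu> ^ N + real N * \<mu> ^ (N - 1) * (t i - \<mu>)))" .
  also have "\<dots> \<le> (\<Sum>i\<in>I. w i * t i ^ N)"
    using assms mu by (intro sum_mono mult_left_mono power_ge_tangent) auto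
  finally have "\<mu> ^ N * W + real N * \<mu> ^ (N - 1) * (\<mu> - \<mu> * W) \<le> (\<Sum>i\<in>I. w i * t i ^ N)" .
  moreover have "\<mu> ^ N * 1 \<le> \<mu> ^ N * W + real N * \<mu> ^ (N - 1) * (\<mu> - \<mu> * W)"
  proof -
    have "\<mu> ^ (N - 1) * \<mu> = \<mu> ^ N" using assms(4) by (cases N) auto
    then have "\<mu> ^ N * W + real N * \<mu> ^ (N - 1) * (\<mu> - \<mu> * W) = \<mu> ^ N * (W + real N * (1 - W))"
      by (metis (no_types, opaque_lifting) distrib_left mult.assoc mult.commute mult.right_neutral right_diff_distrib')
    moreover have "1 - W \<le> real N * (1 - W)"
      using assms(3,4) mult_right_mono[of 1 "real N" "1 - W"] by (simp add: W_def)
    ultimately show ?thesis using mu mult_left_mono[of 1 "W + real N * (1 - W)" "\<mu> ^ N"] by simp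
  qed
  ultimately show ?thesis by (simp add: \<mu>_def)
qed

text \<open>An orthogonal projection is at work: the squared residual is the squared norm of
  \<open>u\<close> minus that of \<open>Q\<^sup>\<dagger> * u\<close>.\<close>

lemma range_finder_residual_le:
  assumes Q: "Q \<in> carrier_mat m l" "Q\<^sup>\<dagger> * Q = 1\<^sub>m l" and u: "u \<in> carrier_mat m 1"
  shows "fnorm (Q * Q\<^sup>\<dagger> * u - u) \<le> fnorm u"
proof (rule power2_le_imp_le)
  define a where "a = Q\<^sup>\<dagger> * u"
  have a: "a \<in> carrier_mat l 1" using Q u by (auto simp: a_def intro!: mult_carrier_mat[of _ l m])
  have Qa: "Q * Q\<^sup>\<dagger> * u = Q * a" "Q * a \<in> carrier_mat m 1"
    using Q u a by (auto simp: a_def assoc_mult_mat[of _ m l _ m _ 1])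
  have 1: "mat_inner (Q * a) u = (fnorm a)\<^sup>2"
    using mat_inner_mult_left[OF Q(1) a u] by (simp add: fnorm_sq flip: a_def)
  have 2: "mat_inner (Q * a) (Q * a) = (fnorm a)\<^sup>2"
    using fnorm_isometry_mult[OF Q a] by (simp flip: fnorm_sq)
  have "(fnorm (Q * a - u))\<^sup>2 = (fnorm u)\<^sup>2 - (fnorm a)\<^sup>2"
    using minus_carrier_mat[OF u, of "Q * a"] Qa u mat_inner_commute[OF u Qa(2)]
    by (simp add: fnorm_sq[of "Q * a - u"] fnorm_sq[of u] mat_inner_minus[of _ m 1] 1 2)
  then show "(fnorm (Q * Q\<^sup>\<dagger> * u - u))\<^sup>2 \<le> (fnorm u)\<^sup>2" by (simp add: Qa)
qed simp

text \<open>The projection fixes \<open>B * W * v\<close> for every \<open>v\<close>, so the error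
  at \<open>x\<close> is the residual of \<open>B * (x - W * v)\<close> and at most its norm. The
  column \<open>v\<close> is chosen to cancel the leading \<open>k\<close> coordinates, after which
  only the tail singular values act.\<close>

lemma rqsvd_error_le:
  assumes B: "B \<in> carrier_mat m n" and svd: "is_qsvd B U \<sigma> V" and k: "1 \<le> k" "k < n" "n \<le> m"
    and W: "W \<in> carrier_mat n l" and Q: "range_finder (B * W) Q"
    and Y: "Y = V\<^sup>\<dagger> * W" and X: "X = top_rows k Y"
    and T: "T \<in> carrier_mat l k" "X * T = 1\<^sub>m k"
    and S: "S = quat_diag n n (\<lambda>i. if i \<le> k then 0 else \<sigma> i)"
    and f: "\<And>y. y \<in> carrier_mat k 1 \<Longrightarrow> fnorm (S * (Y * (T * y))) \<le> f * fnorm y" and "0 \<le> f"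
  shows "quat_spectral_norm (rqsvd_approx Q B - B) \<le> \<sigma> (k + 1) + f"
proof -
  note D = is_qsvdD[OF svd B]
  have Qc: "Q \<in> carrier_mat m l" "Q\<^sup>\<dagger> * Q = 1\<^sub>m l" and rng: "quat_range (B * W) \<subseteq> quat_range Q"
    using Q B W by (auto simp: range_finder_def)
  have QQ: "Q * Q\<^sup>\<dagger> \<in> carrier_mat m m" using Qc by auto
  have E: "rqsvd_approx Q B - B \<in> carrier_mat m n"
    using B by (auto simp: rqsvd_approx_def)
  obtain x where x: "x \<in> carrier_mat n 1" "fnorm x = 1"
    and nx: "fnorm ((rqsvd_approx Q B - B) * x) = quat_spectral_norm (rqsvd_approx Q B - B)"
    using spectral_norm_attained[OF E] k by auto
  define z where "z = V\<^sup>\<dagger> * x"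
  define z1 where "z1 = top_rows k z"
  \<comment> \<open>Since \<open>X * T = 1\<^sub>m k\<close>, the first \<open>k\<close> coordinates
    of \<open>Y * v\<close> are those of \<open>z\<close>.\<close>
  define v where "v = T * z1"
  define u where "u = B * (x - W * v)"
  have z: "z \<in> carrier_mat n 1" "fnorm z = 1"
    using D x by (auto simp: z_def fnorm_unitary_mult[of _ n _ 1] quat_unitary_adjoint intro!: mult_carrier_mat[of _ n n])
  have z1: "z1 \<in> carrier_mat k 1" using z by (simp add: z1_def)
  have v: "v \<in> carrier_mat l 1" using T z1 by (auto simp: v_def)
  have Yc: "Y \<in> carrier_mat n l" using D W by (auto simp: Y)
  have Wv: "W * v \<in> carrier_mat n 1" using W v by auto
  have u: "u \<in> carrier_mat m 1" using B minus_carrier_mat[OF Wv, of x] by (auto simp: u_def)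
  have "B * (W * v) = B * W * v" using B W v by (simp add: assoc_mult_mat[of _ m n _ l _ 1])
  \<comment> \<open>Range inclusion speaks of vectors; it is transferred here to one-column
    matrices.\<close>
  have "\<exists>c \<in> carrier_mat l 1. B * W * v = Q * c"
  proof -
    have "B * W *\<^sub>v col v 0 \<in> quat_range (B * W)" using v W by (auto simp: quat_range_def intro!: exI[of _ "col v 0"])
    then obtain c where c: "c \<in> carrier_vec l" "B * W *\<^sub>v col v 0 = Q *\<^sub>v c"
      using rng Qc by (auto simp: quat_range_def)
    have "B * W * v = Q * Matrix.mat l 1 (\<lambda>(i, j). c $ i)"
    proof (rule eq_matI)
      fix i j assume "i < dim_row (Q * Matrix.mat l 1 (\<lambda>(i, j). c $ i))" "j < dim_col (Q * Matrix.mat l 1 (\<lambda>(i, j). c $ i))"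
      then have ij: "i < m" "j = 0" using Qc by auto
      have "(C * v) $$ (i, 0) = (C *\<^sub>v col v 0) $ i" if "C \<in> carrier_mat m l" for C
        using that ij v by simp
      from this[of "B * W"] have "(B * W * v) $$ (i, 0) = (B * W *\<^sub>v col v 0) $ i"
        using B W by (simp del: index_mult_mat(1) index_mult_mat_vec)
      also have "\<dots> = (Q *\<^sub>v c) $ i" by (simp only: c)
      also have "\<dots> = (Q * Matrix.mat l 1 (\<lambda>(i, j). c $ i)) $$ (i, 0)"
        using ij Qc c(1) by (auto simp: scalar_prod_def intro!: sum.cong)
      finally show "(B * W * v) $$ (i, j) = (Q * Matrix.mat l 1 (\<lambda>(i, j). c $ i)) $$ (i, j)" by (simp add: ij)
    qed (use B Qc v in auto)
    then show ?thesis by (intro bexI[of _ "Matrix.mat l 1 (\<lambda>(i, j). c $ i)"]) auto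
  qed
  then obtain c where c: "c \<in> carrier_mat l 1" "B * (W * v) = Q * c"
    using \<open>B * (W * v) = B * W * v\<close> by auto
  have fixed: "Q * Q\<^sup>\<dagger> * (B * (W * v)) = B * (W * v)"
    unfolding c(2) using Qc c(1) by (simp add: assoc_mult_mat[of _ m l _ m _ 1] mat_assoc_cancel[of _ l m _ _ 1])
  have Bx: "B * x \<in> carrier_mat m 1" "B * (W * v) \<in> carrier_mat m 1" using B x Wv by auto
  have ueq: "u = B * x - B * (W * v)"
    using B x Wv by (simp add: u_def mult_minus_distrib_mat[of _ m n _ 1])
  have "(rqsvd_approx Q B - B) * x = Q * Q\<^sup>\<dagger> * (B * x) - B * x"
    using B x QQ by (simp add: rqsvd_approx_def minus_mult_distrib_mat[of _ m n _ _ 1] assoc_mult_mat[of _ m m _ n _ 1])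
  also have "\<dots> = (Q * Q\<^sup>\<dagger> * (B * x) - Q * Q\<^sup>\<dagger> * (B * (W * v))) - (B * x - B * (W * v))"
  proof -
    have cancel: "P - b = (P - d) - (b - d)" if "P \<in> carrier_mat m 1" "b \<in> carrier_mat m 1" "d \<in> carrier_mat m 1" for P b d :: "quat mat"
      using that by (intro eq_matI) auto
    show ?thesis unfolding fixed
      using Bx QQ by (intro cancel) (auto intro!: mult_carrier_mat[of _ m m])
  qed
  also have "\<dots> = Q * Q\<^sup>\<dagger> * u - u"
    unfolding ueq using Bx QQ by (simp add: mult_minus_distrib_mat[of _ m m _ 1])
  finally have "quat_spectral_norm (rqsvd_approx Q B - B) \<le> fnorm u"
    using range_finder_residual_le[OF Qc u] nx by simp
  also have "fnorm u = fnorm (quat_diag m n \<sigma> * (z - Y * v))"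
  proof -
    have "V\<^sup>\<dagger> * (x - W * v) = z - Y * v"
      using D(3) x W v Wv by (simp add: z_def Y mult_minus_distrib_mat[of _ n n _ 1] assoc_mult_mat[of _ n n _ l _ 1])
    then show ?thesis
      using qsvd_fnorm[OF svd B minus_carrier_mat[OF Wv, of x]] by (simp add: u_def)
  qed
  also have "\<dots> = fnorm (S * (z - Y * v))"
  proof -
    \<comment> \<open>The first \<open>k\<close> coordinates of \<open>d\<close> vanish, so the full
      diagonal factor and its truncation \<open>S\<close> act on it with the same norm.\<close>
    define d where "d = z - Y * v"
    have Yv: "Y * v \<in> carrier_mat n 1" using Yc v by auto
    have d: "d \<in> carrier_mat n 1" using minus_carrier_mat[OF Yv, of z] by (simp add: d_def)
    have "top_rows k (Y * v) = X * T * z1"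
      using top_rows_mult[OF Yc v, of k] k T(1) z1 Yc
      by (simp add: v_def X assoc_mult_mat[of _ k l _ k _ 1])
    then have "top_rows k (Y * v) = z1" using z1 by (simp add: T(2))
    then have d0: "d $$ (i, 0) = 0" if "i < k" for i
    proof -
      have "top_rows k (Y * v) $$ (i, 0) = z1 $$ (i, 0)" using \<open>top_rows k (Y * v) = z1\<close> by simp
      then have "(Y * v) $$ (i, 0) = z $$ (i, 0)"
        using that carrier_matD(2)[OF v] carrier_matD(2)[OF z(1)]
        by (simp add: z1_def top_rows_def del: index_mult_mat(1))
      then show ?thesis
        unfolding d_def using that k carrier_matD[OF Yv] by (subst index_minus_mat) auto
    qed
    have "(fnorm (quat_diag m n \<sigma> * d))\<^sup>2 = (fnorm (S * d))\<^sup>2"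
      unfolding S fnorm_quat_diag_mult[OF d] using k d0
      by (intro sum.cong) (auto simp: not_less_eq_eq[symmetric])
    then show ?thesis unfolding d_def[symmetric] by (rule power2_eq_imp_eq) simp_all
  qed
  also have "\<dots> \<le> fnorm (S * z) + fnorm (S * (Y * v))"
  proof -
    have "S \<in> carrier_mat n n" by (simp add: S)
    moreover have "Y * v \<in> carrier_mat n 1" using Yc v by auto
    ultimately show ?thesis
      using z fnorm_triangle_minus[of "S * z" n 1 "S * (Y * v)"]
      by (simp add: mult_minus_distrib_mat[of _ n n _ 1])
  qed
  also have "fnorm (S * z) \<le> \<sigma> (k + 1)"
  proof (rule power2_le_imp_le)
    have "(fnorm (S * z))\<^sup>2 \<le> (\<Sum>i<n. (\<sigma> (k + 1))\<^sup>2 * (norm (z $$ (i, 0)))\<^sup>2)"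
      unfolding S fnorm_quat_diag_mult[OF z(1)] min.idem
    proof (intro sum_mono mult_right_mono)
      fix i assume "i \<in> {..<n}"
      then show "(if Suc i \<le> k then 0 else \<sigma> (Suc i))\<^sup>2 \<le> (\<sigma> (k + 1))\<^sup>2"
        using D(6)[of "Suc i"] D(7)[of "k + 1" "Suc i"] k by (auto intro!: power_mono)
    qed auto
    also have "\<dots> = (\<sigma> (k + 1))\<^sup>2"
      using fnorm_sq_col[OF z(1)] z(2) by (simp flip: sum_distrib_left)
    finally show "(fnorm (S * z))\<^sup>2 \<le> (\<sigma> (k + 1))\<^sup>2" .
    show "0 \<le> \<sigma> (k + 1)" using D(6)[of "k + 1"] k by simp
  qed
  also have "fnorm (S * (Y * v)) \<le> f * fnorm z1" unfolding v_def by (rule f[OF z1])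
  also have "f * fnorm z1 \<le> f"
  proof -
    have "(fnorm z1)\<^sup>2 = (\<Sum>i<k. (norm (z $$ (i, 0)))\<^sup>2)"
      unfolding fnorm_sq_col[OF z1] using carrier_matD(2)[OF z(1)] by (simp add: z1_def top_rows_def)
    also have "\<dots> \<le> (fnorm z)\<^sup>2"
      unfolding fnorm_sq_col[OF z(1)] using k by (intro sum_mono2) auto
    finally have "(fnorm z1)\<^sup>2 \<le> (fnorm z)\<^sup>2" .
    then have "fnorm z1 \<le> 1" using z(2) power2_le_imp_le[of "fnorm z1" 1] by simp
    then show ?thesis using \<open>0 \<le> f\<close> by (simp add: mult_left_le)
  qed
  finally show ?thesis by simp
qed

text \<open>Both unitary factors are unchanged. In particular \<open>V\<close> is, so the rank
  condition on the sample is the same for every \<open>q\<close>.\<close>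

lemma qsvd_power:
  assumes A: "A \<in> carrier_mat m n" and svd: "is_qsvd A U \<sigma> V" and nm: "n \<le> m"
  shows "is_qsvd ((A * A\<^sup>\<dagger>) ^\<^sub>m q * A) U (\<lambda>i. \<sigma> i ^ (2 * q + 1)) V"
proof -
  note D = is_qsvdD[OF svd A]
  have AA: "A * A\<^sup>\<dagger> \<in> carrier_mat m m" using A by auto
  have pw: "(A * A\<^sup>\<dagger>) ^\<^sub>m q \<in> carrier_mat m m" for q using AA by simp
  have "(A * A\<^sup>\<dagger>) ^\<^sub>m q * A = U * quat_diag m n (\<lambda>i. \<sigma> i ^ (2 * q + 1)) * V\<^sup>\<dagger>"
  proof (induction q)
    case 0
    then show ?case using A D(5) by simp
  next
    case (Suc q)
    let ?D = "quat_diag m n (\<lambda>i. \<sigma> i ^ (2 * q + 1))"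
    have c: "U \<in> carrier_mat m m" "V \<in> carrier_mat n n" "V\<^sup>\<dagger> \<in> carrier_mat n n" "U\<^sup>\<dagger> \<in> carrier_mat m m"
      "quat_diag m n \<sigma> \<in> carrier_mat m n" "quat_diag n m \<sigma> \<in> carrier_mat n m" "?D \<in> carrier_mat m n"
      using D by auto
    have AtA: "A\<^sup>\<dagger> * A = V * (quat_diag n n (\<lambda>i. \<sigma> i * \<sigma> i) * V\<^sup>\<dagger>)"
    proof -
      have "A\<^sup>\<dagger> = V * (quat_diag n m \<sigma> * U\<^sup>\<dagger>)"
        using c by (subst D(5)) (simp add: quat_adjoint_mult[of _ m n _ n] quat_adjoint_mult[of _ m m _ n]
          quat_diag_adjoint mult_carrier_mat[of _ m m _ n])
      moreover have "A = U * (quat_diag m n \<sigma> * V\<^sup>\<dagger>)"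
        using c by (subst D(5)) (simp add: assoc_mult_mat[of _ m m _ n _ n])
      ultimately have "A\<^sup>\<dagger> * A = V * (quat_diag n m \<sigma> * U\<^sup>\<dagger>) * (U * (quat_diag m n \<sigma> * V\<^sup>\<dagger>))" by simp
      also have "\<dots> = V * (quat_diag n m \<sigma> * (U\<^sup>\<dagger> * (U * (quat_diag m n \<sigma> * V\<^sup>\<dagger>))))"
        using c by (simp add: assoc_mult_mat[of _ n n _ m _ n] assoc_mult_mat[of _ n m _ m _ n]
          mult_carrier_mat[of _ n m _ m] mult_carrier_mat[of _ m m _ n] mult_carrier_mat[of _ m n _ n])
      also have "U\<^sup>\<dagger> * (U * (quat_diag m n \<sigma> * V\<^sup>\<dagger>)) = quat_diag m n \<sigma> * V\<^sup>\<dagger>"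
        using c D(2) by (intro mat_assoc_cancel[of _ m m _ _ n]) (auto simp: quat_unitaryD intro!: mult_carrier_mat[of _ m n])
      also have "quat_diag n m \<sigma> * (quat_diag m n \<sigma> * V\<^sup>\<dagger>) = quat_diag n n (\<lambda>i. \<sigma> i * \<sigma> i) * V\<^sup>\<dagger>"
        using c nm by (simp add: quat_diag_mult flip: assoc_mult_mat[of _ n m _ n _ n])
      finally show ?thesis .
    qed
    have "(A * A\<^sup>\<dagger>) ^\<^sub>m Suc q * A = (A * A\<^sup>\<dagger>) ^\<^sub>m q * A * (A\<^sup>\<dagger> * A)"
      using A pw[of q] by (simp add: assoc_mult_mat[of _ m m _ m _ n] assoc_mult_mat[of _ m n _ m _ n]
        assoc_mult_mat[of _ m m _ n _ n] mult_carrier_mat[of _ n m _ n])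
    also have "\<dots> = U * ?D * V\<^sup>\<dagger> * (V * (quat_diag n n (\<lambda>i. \<sigma> i * \<sigma> i) * V\<^sup>\<dagger>))"
      unfolding Suc.IH AtA ..
    also have "\<dots> = U * (?D * (V\<^sup>\<dagger> * (V * (quat_diag n n (\<lambda>i. \<sigma> i * \<sigma> i) * V\<^sup>\<dagger>))))"
      using c by (simp add: assoc_mult_mat[of _ m n _ n _ n] assoc_mult_mat[of _ m m _ n _ n]
        mult_carrier_mat[of _ n n _ n] mult_carrier_mat[of _ m n _ n] mult_carrier_mat[of _ m m _ n])
    also have "V\<^sup>\<dagger> * (V * (quat_diag n n (\<lambda>i. \<sigma> i * \<sigma> i) * V\<^sup>\<dagger>)) = quat_diag n n (\<lambda>i. \<sigma> i * \<sigma> i) * V\<^sup>\<dagger>"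
      using c D(4) by (intro mat_assoc_cancel[of _ n n _ _ n]) (auto simp: quat_unitaryD intro!: mult_carrier_mat[of _ n n])
    also have "?D * (quat_diag n n (\<lambda>i. \<sigma> i * \<sigma> i) * V\<^sup>\<dagger>) = quat_diag m n (\<lambda>i. \<sigma> i ^ (2 * Suc q + 1)) * V\<^sup>\<dagger>"
      using c nm by (simp add: quat_diag_mult mult_ac flip: assoc_mult_mat[of _ m n _ n _ n])
    finally show ?case using c by (simp add: assoc_mult_mat[of _ m m _ n _ n])
  qed
  moreover have "(A * A\<^sup>\<dagger>) ^\<^sub>m q * A \<in> carrier_mat m n" using A pw by auto
  moreover have "0 \<le> \<sigma> i ^ (2 * q + 1)" if "1 \<le> i" "i \<le> min m n" for i
    using D(6)[OF that] by (rule zero_le_power)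
  moreover have "\<sigma> j ^ (2 * q + 1) \<le> \<sigma> i ^ (2 * q + 1)" if "1 \<le> i" "i \<le> j" "j \<le> min m n" for i j
    using D(6)[of j] D(7)[OF that] that by (intro power_mono) auto
  ultimately show ?thesis
    unfolding is_qsvd_def monotone_on_def using D(1-4) by auto
qed

text \<open>With \<open>R = Q * Q\<^sup>\<dagger> - 1\<^sub>m m\<close> self-adjoint, the norm of
  \<open>R * A\<close> is attained as an inner product with \<open>A\<^sup>\<dagger> * w\<close> for
  some \<open>w\<close> in the range of \<open>R\<close> with norm at most 1. In the basis
  \<open>U\<close> the squared norm of \<open>A\<^sup>\<dagger> * w\<close> is a weighted mean of
  squared singular values, and the power mean inequality passes to those of
  \<open>B\<close>.\<close>

lemma rqsvd_power_error_le:
  assumes A: "A \<in> carrier_mat m n" and svd: "is_qsvd A U \<sigma> V" and n: "1 \<le> n" "n \<le> m"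
    and Q: "Q \<in> carrier_mat m l" "Q\<^sup>\<dagger> * Q = 1\<^sub>m l"
    and B: "B = (A * A\<^sup>\<dagger>) ^\<^sub>m q * A"
  shows "quat_spectral_norm (rqsvd_approx Q A - A) ^ (2 * q + 1) \<le> quat_spectral_norm (rqsvd_approx Q B - B)"
proof -
  let ?N = "2 * q + 1"
  have AA: "A * A\<^sup>\<dagger> \<in> carrier_mat m m" using A by auto
  have Bc: "B \<in> carrier_mat m n" unfolding B by (rule mult_carrier_mat[OF pow_carrier_mat[OF AA] A])
  have svdB: "is_qsvd B U (\<lambda>i. \<sigma> i ^ ?N) V"
    unfolding B by (rule qsvd_power[OF A svd n(2)])
  note D = is_qsvdD[OF svd A] and DB = is_qsvdD[OF svdB Bc]
  define R where "R = Q * Q\<^sup>\<dagger> - 1\<^sub>m m"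
  have QQ: "Q * Q\<^sup>\<dagger> \<in> carrier_mat m m" using Q by auto
  have R: "R \<in> carrier_mat m m" by (auto simp: R_def)
  have RM: "rqsvd_approx Q C - C = R * C" if "C \<in> carrier_mat m n" for C
    using that QQ by (simp add: R_def rqsvd_approx_def minus_mult_distrib_mat[of _ m m _ _ n])
  have Rx: "R * x = Q * Q\<^sup>\<dagger> * x - x" if "x \<in> carrier_mat m 1" for x
    using that QQ by (simp add: R_def minus_mult_distrib_mat[of _ m m _ _ 1])
  have Radj: "R\<^sup>\<dagger> = R"
  proof -
    have qq: "(Q * Q\<^sup>\<dagger>)\<^sup>\<dagger> = Q * Q\<^sup>\<dagger>" using Q by (simp add: quat_adjoint_mult[of _ m l _ m])
    have "conjugate ((Q * Q\<^sup>\<dagger>) $$ (j, i)) = (Q * Q\<^sup>\<dagger>) $$ (i, j)" if "i < m" "j < m" for i j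
      using quat_adjoint_index[of i "Q * Q\<^sup>\<dagger>" j] carrier_matD[OF Q(1)] that unfolding qq by (simp del: index_mult_mat(1) quat_adjoint_index)
    then show ?thesis
      using QQ by (intro eq_matI) (auto simp: R_def diff_conv_add_uminus conjugate_add_quat conjugate_minus_quat
        conjugate_one_quat conjugate_zero_quat simp del: add_uminus_conv_diff index_mult_mat(1))
  qed
  have RA: "R * A \<in> carrier_mat m n" and RB: "R * B \<in> carrier_mat m n" using R A Bc by auto
  define a where "a = quat_spectral_norm (R * A)"
  obtain x where x: "x \<in> carrier_mat n 1" "fnorm x = 1" "fnorm (R * A * x) = a"
    using spectral_norm_attained[OF RA] n by (auto simp: a_def)
  have "a ^ ?N \<le> quat_spectral_norm (R * B)"
  proof (cases "a = 0")
    case True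
    obtain x' where "fnorm (R * B * x') = quat_spectral_norm (R * B)"
      using spectral_norm_attained[OF RB] n by auto
    then show ?thesis using True fnorm_nonneg[of "R * B * x'"] by simp
  next
    case False
    then have a: "0 < a" using x(3) fnorm_nonneg[of "R * A * x"] by simp
    have RAx: "R * A * x \<in> carrier_mat m 1" using RA x by auto
    \<comment> \<open>The direction of the largest error. Applying \<open>R\<close> once more costs
      no norm and moves the projection onto the side of \<open>A\<^sup>\<dagger>\<close>.\<close>
    define y where "y = mat_scale (1 / a) (R * A * x)"
    have y: "y \<in> carrier_mat m 1" "fnorm y = 1"
      using RAx a x(3) by (auto simp: y_def fnorm_scale)
    define w where "w = R * y"
    have w: "w \<in> carrier_mat m 1" "fnorm w \<le> 1"
      using R y range_finder_residual_le[OF Q y(1)] by (auto simp: w_def Rx)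
    have "a = mat_inner (R * A * x) y"
      unfolding y_def using a RAx x(3) by (simp add: mat_inner_scale[of _ m 1] power2_eq_square flip: fnorm_sq)
    also have "\<dots> = mat_inner x (A\<^sup>\<dagger> * w)"
      using mat_inner_mult_left[OF R _ y(1), of "A * x"] mat_inner_mult_left[OF A x(1), of "R * y"] R A x(1) y(1)
      by (simp add: Radj w_def assoc_mult_mat[of _ m m _ n _ 1] mult_carrier_mat[of _ m n _ "Suc 0"]
        mult_carrier_mat[of _ m m _ "Suc 0"])
    also have "\<dots> \<le> fnorm (A\<^sup>\<dagger> * w)"
      using mat_inner_Cauchy_Schwarz[of x n 1 "A\<^sup>\<dagger> * w"] A w x by auto
    finally have aw: "a \<le> fnorm (A\<^sup>\<dagger> * w)" .
    have adj_norm: "(fnorm (C\<^sup>\<dagger> * w))\<^sup>2 = (\<Sum>i<n. (\<tau> (Suc i))\<^sup>2 * (norm ((U\<^sup>\<dagger> * w) $$ (i, 0)))\<^sup>2)"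
      if C: "C \<in> carrier_mat m n" and "is_qsvd C U \<tau> V" for C \<tau>
    proof -
      note DC = is_qsvdD[OF that(2,1)]
      have Uw: "U\<^sup>\<dagger> * w \<in> carrier_mat m 1" using DC w by (auto intro!: mult_carrier_mat[of _ m m])
      have "C\<^sup>\<dagger> * w = V * (quat_diag n m \<tau> * (U\<^sup>\<dagger> * w))"
        using DC(1-4) w by (subst DC(5)) (simp add: quat_adjoint_mult[of _ m n _ n] quat_adjoint_mult[of _ m m _ n]
          quat_diag_adjoint mult_carrier_mat[of _ m m _ n] mult_carrier_mat[of _ n m _ m] assoc_mult_mat[of _ n n _ m _ 1]
          assoc_mult_mat[of _ n m _ m _ 1])
      then have "fnorm (C\<^sup>\<dagger> * w) = fnorm (quat_diag n m \<tau> * (U\<^sup>\<dagger> * w))"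
        using fnorm_unitary_mult[OF DC(4,3), of "quat_diag n m \<tau> * (U\<^sup>\<dagger> * w)" 1] Uw
        by (simp add: mult_carrier_mat[of _ n m _ "Suc 0"])
      then show ?thesis using fnorm_quat_diag_mult[OF Uw, of n \<tau>] n by (simp add: min_absorb1)
    qed
    have Uw: "U\<^sup>\<dagger> * w \<in> carrier_mat m 1" using D w by (auto intro!: mult_carrier_mat[of _ m m])
    \<comment> \<open>Coordinates from \<open>n\<close> on are discarded, so the weights sum to at
      most 1 only.\<close>
    have "(\<Sum>i<n. (norm ((U\<^sup>\<dagger> * w) $$ (i, 0)))\<^sup>2) \<le> (\<Sum>i<m. (norm ((U\<^sup>\<dagger> * w) $$ (i, 0)))\<^sup>2)"
      using n by (intro sum_mono2) auto
    also have "\<dots> = (fnorm w)\<^sup>2"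
      using fnorm_sq_col[OF Uw] fnorm_unitary_mult[OF quat_unitary_adjoint[OF D(2)], of m w 1] D(1) w by simp
    also have "\<dots> \<le> 1" using w by (simp add: power_le_one)
    finally have wt: "(\<Sum>i<n. (norm ((U\<^sup>\<dagger> * w) $$ (i, 0)))\<^sup>2) \<le> 1" .
    have "(a ^ ?N)\<^sup>2 = (a\<^sup>2) ^ ?N" by (simp only: power_mult[symmetric] mult.commute)
    also have "\<dots> \<le> ((fnorm (A\<^sup>\<dagger> * w))\<^sup>2) ^ ?N" using aw a by (intro power_mono) auto
    also have "\<dots> = (\<Sum>i<n. (norm ((U\<^sup>\<dagger> * w) $$ (i, 0)))\<^sup>2 * (\<sigma> (Suc i))\<^sup>2) ^ ?N"
      by (simp only: adj_norm[OF A svd] mult.commute)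
    also have "\<dots> \<le> (\<Sum>i<n. (norm ((U\<^sup>\<dagger> * w) $$ (i, 0)))\<^sup>2 * ((\<sigma> (Suc i))\<^sup>2) ^ ?N)"
      by (rule power_mean_sum) (use wt in auto)
    also have "\<dots> = (fnorm (B\<^sup>\<dagger> * w))\<^sup>2"
      unfolding adj_norm[OF Bc svdB] by (intro sum.cong refl) (simp only: power_mult[symmetric] mult.commute)
    finally have "a ^ ?N \<le> fnorm (B\<^sup>\<dagger> * w)" by (rule power2_le_imp_le) simp
    moreover have "fnorm (B\<^sup>\<dagger> * w) \<le> quat_spectral_norm (R * B)"
    proof -
      define b where "b = fnorm (B\<^sup>\<dagger> * w)"
      have Bw: "B\<^sup>\<dagger> * w \<in> carrier_mat n 1" using Bc w by auto
      have "b\<^sup>2 = mat_inner (B\<^sup>\<dagger> * w) (B\<^sup>\<dagger> * w)" by (simp add: b_def fnorm_sq)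
      also have "\<dots> = mat_inner w (B * (B\<^sup>\<dagger> * w))"
        using mat_inner_mult_left[of "B\<^sup>\<dagger>" n m w 1 "B\<^sup>\<dagger> * w"] Bc w Bw by simp
      also have "\<dots> = mat_inner y (R * (B * (B\<^sup>\<dagger> * w)))"
        unfolding w_def using mat_inner_mult_left[OF R y(1), of "B * (B\<^sup>\<dagger> * (R * y))"] Bc Bw by (simp add: Radj w_def)
      also have "R * (B * (B\<^sup>\<dagger> * w)) = R * B * (B\<^sup>\<dagger> * w)"
        using R Bc Bw by (simp add: assoc_mult_mat[of _ m m _ n _ 1])
      also have "mat_inner y \<dots> \<le> fnorm y * fnorm (R * B * (B\<^sup>\<dagger> * w))"
        using mat_inner_Cauchy_Schwarz[OF y(1), of "R * B * (B\<^sup>\<dagger> * w)"] RB Bw by auto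
      also have "\<dots> \<le> quat_spectral_norm (R * B) * b"
        using spectral_norm_bound[OF RB _ _ Bw] n y(2) by (simp add: b_def)
      finally have le: "b\<^sup>2 \<le> quat_spectral_norm (R * B) * b" .
      obtain x' where "fnorm (R * B * x') = quat_spectral_norm (R * B)"
        using spectral_norm_attained[OF RB] n by auto
      then have "0 \<le> quat_spectral_norm (R * B)" using fnorm_nonneg by metis
      with le show ?thesis
        unfolding b_def[symmetric] using fnorm_nonneg[of "B\<^sup>\<dagger> * w"]
        by (cases "b = 0") (auto simp: power2_eq_square b_def mult_le_cancel_right order_less_le)
    qed
    ultimately show ?thesis by simp
  qed
  then show ?thesis by (simp add: RM[OF A] RM[OF Bc] a_def)
qed

subsection \<open>The spectral norm of a Gaussian matrix between two fixed factors\<close>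

lemma mat_inner_adjoint:
  assumes "X \<in> carrier_mat a b" "Y \<in> carrier_mat a b"
  shows "mat_inner (X\<^sup>\<dagger>) (Y\<^sup>\<dagger>) = mat_inner X Y"
  using assms unfolding mat_inner_def by (auto simp: inner_conjugate_quat intro: sum.swap)

text \<open>A bilinear form in \<open>a\<close> and \<open>b\<close> becomes a linear functional of
  \<open>G\<close> with a coefficient matrix of rank one, ready for Gaussian exponential
  moments.\<close>

lemma mat_inner_outer:
  assumes a: "a \<in> carrier_mat n 1" and b: "b \<in> carrier_mat l 1" and G: "G \<in> carrier_mat n l"
  shows "mat_inner a (G * b) = mat_inner (a * b\<^sup>\<dagger>) G"
proof -
  have "mat_inner a (G * b) = mat_inner (b\<^sup>\<dagger> * G\<^sup>\<dagger>) (a\<^sup>\<dagger>)"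
    using a b G mat_inner_adjoint[of "G * b" n 1 a] mat_inner_commute[of a n 1 "G * b"]
    by (simp add: quat_adjoint_mult[of _ n l _ 1] mult_carrier_mat[of _ n l _ "Suc 0"])
  also have "\<dots> = mat_inner (G\<^sup>\<dagger>) (b * a\<^sup>\<dagger>)"
    using mat_inner_mult_left[of "b\<^sup>\<dagger>" 1 l "G\<^sup>\<dagger>" n "a\<^sup>\<dagger>"] a b G by simp
  also have "\<dots> = mat_inner (G\<^sup>\<dagger>) ((a * b\<^sup>\<dagger>)\<^sup>\<dagger>)"
    using a b by (simp add: quat_adjoint_mult[of _ n 1 _ l])
  also have "\<dots> = mat_inner (a * b\<^sup>\<dagger>) G"
    using a b G mat_inner_adjoint[of G n l "a * b\<^sup>\<dagger>"] mat_inner_commute[of G n l "a * b\<^sup>\<dagger>"]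
    by (simp add: mult_carrier_mat[of _ n "Suc 0" _ l])
  finally show ?thesis .
qed

lemma fnorm_outer:
  assumes a: "a \<in> carrier_mat n 1" and b: "b \<in> carrier_mat l 1"
  shows "fnorm (a * b\<^sup>\<dagger>) = fnorm a * fnorm b"
proof (rule power2_eq_imp_eq)
  have ab: "a * b\<^sup>\<dagger> \<in> carrier_mat n l" using a b by auto
  have "(fnorm (a * b\<^sup>\<dagger>))\<^sup>2 = mat_inner a ((a * b\<^sup>\<dagger>) * b)"
    using mat_inner_outer[OF a b ab] by (simp add: fnorm_sq)
  also have "(a * b\<^sup>\<dagger>) * b = mat_scale ((fnorm b)\<^sup>2) a"
    using a b by (simp add: assoc_mult_mat[of _ n 1 _ l _ 1] adjoint_mult_self_col mult_mat_scale[of _ n 1 _ 1]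
      right_mult_one_mat[of _ n 1, unfolded One_nat_def])
  finally show "(fnorm (a * b\<^sup>\<dagger>))\<^sup>2 = (fnorm a * fnorm b)\<^sup>2"
    using a by (simp add: mat_inner_scale[of _ n 1] fnorm_sq power_mult_distrib)
qed simp_all

text \<open>Jensen's inequality through the tangent of \<open>exp (- w)\<close> at the mean; its
  negative part is moved to the other side so that all integrands are nonnegative.\<close>

lemma (in prob_space) nn_integral_exp_neg_ge:
  assumes W: "W \<in> borel_measurable M" "\<And>x. 0 \<le> W x" and m: "(\<integral>\<^sup>+x. ennreal (W x) \<partial>M) = ennreal m" "0 \<le> m"
  shows "ennreal (exp (- m)) \<le> (\<integral>\<^sup>+x. ennreal (exp (- W x)) \<partial>M)"
proof -
  have "exp (- m) * (1 + m) \<le> exp (- w) + exp (- m) * w" for w :: real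
  proof -
    have "exp (- m) * (1 + (m - w)) \<le> exp (- m) * exp (m - w)"
      by (intro mult_left_mono exp_ge_add_one_self) auto
    then show ?thesis by (simp add: algebra_simps flip: exp_add)
  qed
  then have "(\<integral>\<^sup>+x. ennreal (exp (- m) * (1 + m)) \<partial>M) \<le> (\<integral>\<^sup>+x. ennreal (exp (- W x)) + ennreal (exp (- m)) * ennreal (W x) \<partial>M)"
    using W by (intro nn_integral_mono) (simp add: ennreal_leI flip: ennreal_mult ennreal_plus)
  also have "\<dots> = (\<integral>\<^sup>+x. ennreal (exp (- W x)) \<partial>M) + ennreal (exp (- m)) * ennreal m"
    using W by (simp add: nn_integral_add nn_integral_cmult m)
  finally have "ennreal (exp (- m)) + ennreal (exp (- m) * m) \<le> (\<integral>\<^sup>+x. ennreal (exp (- W x)) \<partial>M) + ennreal (exp (- m) * m)"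
    using m by (simp add: emeasure_space_1 algebra_simps flip: ennreal_mult ennreal_plus)
  then show ?thesis
    using m by (subst (asm) (1 2) add.commute) (simp add: ennreal_add_left_cancel_le)
qed

text \<open>One half of a PAC-Bayesian argument: the Gaussian prior is tilted to mean \<open>b u\<close>; averaging over the sign
  of the noise removes the terms linear in it, and Jensen's inequality does the rest.\<close>

lemma gauss_quadratic_tilt:
  assumes S: "S \<in> carrier_mat a n" and c: "c \<in> carrier_mat n 1" and u: "u \<in> carrier_mat n 1" "fnorm u = 1"
    and su: "fnorm (S * u) \<le> s" and \<rho>: "(\<integral>\<^sup>+x. ennreal ((fnorm (S * mtx n 1 x))\<^sup>2) \<partial>gauss (idx n 1)) = ennreal (\<rho>\<^sup>2)"
    and "0 \<le> \<kappa>"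
  shows "ennreal (exp (b * mat_inner c u - b\<^sup>2 / 2 - \<kappa> * (\<rho>\<^sup>2 + b\<^sup>2 * s\<^sup>2)))
    \<le> (\<integral>\<^sup>+x. ennreal (exp (mat_inner c (mtx n 1 x) - \<kappa> * (fnorm (S * mtx n 1 x))\<^sup>2)) \<partial>gauss (idx n 1))"
proof -
  let ?I = "idx n 1"
  let ?B = "PiM ?I (\<lambda>_. borel :: real measure)"
  interpret prob_space "gauss ?I" by (rule prob_space_gauss)
  define F where "F X = ennreal (exp (mat_inner c X - \<kappa> * (fnorm (S * X))\<^sup>2))" for X
  \<comment> \<open>The exponent after the Cameron-Martin shift by \<open>b u\<close>. The constant
    \<open>K\<close> is what remains once the terms odd in the noise cancel and its quadratic term
    is split off.\<close>
  define E where "E X = - mat_inner (mat_scale b u) X - b\<^sup>2 / 2 + (mat_inner c (X + mat_scale b u) - \<kappa> * (fnorm (S * (X + mat_scale b u)))\<^sup>2)" for X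
  define K where "K = b * mat_inner c u - b\<^sup>2 / 2 - \<kappa> * (b\<^sup>2 * s\<^sup>2)"
  have bu: "mat_scale b u \<in> carrier_mat n 1" "fnorm (mat_scale b u) = \<bar>b\<bar>" using u by (auto simp: fnorm_scale)
  have mS: "(\<lambda>x. (fnorm (S * mtx n 1 x))\<^sup>2) \<in> borel_measurable ?B"
    using S by (intro borel_measurable_power measurable_fnorm[of _ a 1] meas_mat_mult[of _ a n _ 1] meas_mat_const meas_mat_mtx_self) auto
  have mF: "(\<lambda>x. F (mtx n 1 x)) \<in> borel_measurable ?B"
    unfolding F_def using S c
    by (intro measurable_compose[OF _ measurable_ennreal] borel_measurable_exp[THEN measurable_compose[rotated]]
      borel_measurable_diff borel_measurable_times borel_measurable_const mS
      measurable_mat_inner[of _ n 1] meas_mat_const meas_mat_mtx_self) auto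
  have mE: "(\<lambda>x. ennreal (exp (E (mtx n 1 x)))) \<in> borel_measurable ?B"
    unfolding E_def using S c bu
    by (intro measurable_compose[OF _ measurable_ennreal] borel_measurable_exp[THEN measurable_compose[rotated]]
      borel_measurable_diff borel_measurable_add borel_measurable_uminus borel_measurable_times borel_measurable_const
      borel_measurable_power measurable_fnorm[of _ a 1] meas_mat_mult[of _ a n _ 1] meas_mat_add
      measurable_mat_inner[of _ n 1] meas_mat_const meas_mat_mtx_self) auto
  have shift: "(\<integral>\<^sup>+x. F (mtx n 1 x) \<partial>gauss ?I) = (\<integral>\<^sup>+x. ennreal (exp (E (mtx n 1 x))) \<partial>gauss ?I)"
    by (rule trans[OF gauss_matrix_shift[OF mF bu(1)]], unfold bu(2) E_def F_def, intro nn_integral_cong)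
      (simp flip: ennreal_mult exp_add)
  have avg: "2 * exp (K - \<kappa> * (fnorm (S * X))\<^sup>2) \<le> exp (E X) + exp (E (mat_scale (- 1) X))" if X: "X \<in> carrier_mat n 1" for X
  proof -
    have SX: "S * X \<in> carrier_mat a 1" "S * mat_scale b u \<in> carrier_mat a 1" using S X bu by auto
    have p1: "(fnorm (S * (X + mat_scale b u)))\<^sup>2 = (fnorm (S * X))\<^sup>2 + 2 * mat_inner (S * X) (S * mat_scale b u) + (fnorm (S * mat_scale b u))\<^sup>2"
      using S X bu SX by (simp add: mult_add_distrib_mat[of _ a n _ 1] fnorm_add_sq[of _ a 1])
    have p2: "(fnorm (S * (mat_scale (- 1) X + mat_scale b u)))\<^sup>2 = (fnorm (S * X))\<^sup>2 - 2 * mat_inner (S * X) (S * mat_scale b u) + (fnorm (S * mat_scale b u))\<^sup>2"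
      using S X bu SX by (simp add: mult_add_distrib_mat[of _ a n _ 1] fnorm_add_sq[of _ a 1] mult_mat_scale[of S a n X 1]
        fnorm_scale mat_inner_scale[of "S * X" a 1])
    have "E X + E (mat_scale (- 1) X) = 2 * (b * mat_inner c u - b\<^sup>2 / 2 - \<kappa> * ((fnorm (S * X))\<^sup>2 + (fnorm (S * mat_scale b u))\<^sup>2))"
      unfolding E_def p1 p2 using X c u bu
      by (simp add: mat_inner_add[of _ n 1] mat_inner_scale[of _ n 1] algebra_simps)
    moreover have "(fnorm (S * mat_scale b u))\<^sup>2 \<le> b\<^sup>2 * s\<^sup>2"
    proof -
      have "fnorm (S * mat_scale b u) = \<bar>b\<bar> * fnorm (S * u)"
        using S u by (simp add: mult_mat_scale[of _ a n _ 1] fnorm_scale)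
      then show ?thesis using su by (auto simp: power_mult_distrib intro!: mult_left_mono power_mono)
    qed
    then have "\<kappa> * (fnorm (S * mat_scale b u))\<^sup>2 \<le> \<kappa> * (b\<^sup>2 * s\<^sup>2)" using \<open>0 \<le> \<kappa>\<close> by (rule mult_left_mono)
    ultimately have le: "K - \<kappa> * (fnorm (S * X))\<^sup>2 \<le> (E X + E (mat_scale (- 1) X)) / 2"
      by (simp add: K_def algebra_simps)
    have am: "2 * exp ((p + q) / 2) \<le> exp p + exp q" for p q :: real
    proof -
      have "exp p = (exp (p / 2))\<^sup>2" "exp q = (exp (q / 2))\<^sup>2" "exp ((p + q) / 2) = exp (p / 2) * exp (q / 2)"
        by (simp_all add: power2_eq_square add_divide_distrib flip: exp_add)
      then show ?thesis
        using sum_squares_bound[of "exp (p / 2)" "exp (q / 2)"] by simp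
    qed
    have "exp (K - \<kappa> * (fnorm (S * X))\<^sup>2) \<le> exp ((E X + E (mat_scale (- 1) X)) / 2)" using le by simp
    then show ?thesis using am[of "E X" "E (mat_scale (- 1) X)"] by linarith
  qed
  have neg: "(\<integral>\<^sup>+x. ennreal (exp (E (mat_scale (- 1) (mtx n 1 x)))) \<partial>gauss ?I) = (\<integral>\<^sup>+x. ennreal (exp (E (mtx n 1 x))) \<partial>gauss ?I)"
    by (rule gauss_matrix_neg[OF mE])
  have mEn: "(\<lambda>x. ennreal (exp (E (mat_scale (- 1) (mtx n 1 x))))) \<in> borel_measurable ?B"
    unfolding E_def using S c bu
    by (intro measurable_compose[OF _ measurable_ennreal] borel_measurable_exp[THEN measurable_compose[rotated]]
      borel_measurable_diff borel_measurable_add borel_measurable_uminus borel_measurable_times borel_measurable_const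
      borel_measurable_power measurable_fnorm[of _ a 1] meas_mat_mult[of _ a n _ 1] meas_mat_add meas_mat_scale
      measurable_mat_inner[of _ n 1] meas_mat_const meas_mat_mtx_self) auto
  have "ennreal 2 * (\<integral>\<^sup>+x. ennreal (exp (K - \<kappa> * (fnorm (S * mtx n 1 x))\<^sup>2)) \<partial>gauss ?I)
    = (\<integral>\<^sup>+x. ennreal 2 * ennreal (exp (K - \<kappa> * (fnorm (S * mtx n 1 x))\<^sup>2)) \<partial>gauss ?I)"
    using mS by (intro nn_integral_cmult[symmetric]) simp
  also have "\<dots> \<le> (\<integral>\<^sup>+x. ennreal (exp (E (mtx n 1 x))) + ennreal (exp (E (mat_scale (- 1) (mtx n 1 x)))) \<partial>gauss ?I)"
  proof (rule nn_integral_mono)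
    fix x
    show "ennreal 2 * ennreal (exp (K - \<kappa> * (fnorm (S * mtx n 1 x))\<^sup>2))
      \<le> ennreal (exp (E (mtx n 1 x))) + ennreal (exp (E (mat_scale (- 1) (mtx n 1 x))))"
      using ennreal_leI[OF avg[OF mtx_carrier, of x]]
      by (simp only: ennreal_mult' ennreal_plus exp_ge_zero zero_le_numeral)
  qed
  also have "\<dots> = (\<integral>\<^sup>+x. ennreal (exp (E (mtx n 1 x))) \<partial>gauss ?I)
      + (\<integral>\<^sup>+x. ennreal (exp (E (mat_scale (- 1) (mtx n 1 x)))) \<partial>gauss ?I)"
    by (rule nn_integral_add) (use mE mEn in simp_all)
  also have "\<dots> = ennreal 2 * (\<integral>\<^sup>+x. ennreal (exp (E (mtx n 1 x))) \<partial>gauss ?I)"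
    unfolding neg by (simp add: mult_2)
  finally have ge: "(\<integral>\<^sup>+x. ennreal (exp (K - \<kappa> * (fnorm (S * mtx n 1 x))\<^sup>2)) \<partial>gauss ?I) \<le> (\<integral>\<^sup>+x. ennreal (exp (E (mtx n 1 x))) \<partial>gauss ?I)"
    by (simp add: ennreal_mult_le_mult_iff)
  have "ennreal (exp (- (\<kappa> * \<rho>\<^sup>2))) \<le> (\<integral>\<^sup>+x. ennreal (exp (- (\<kappa> * (fnorm (S * mtx n 1 x))\<^sup>2))) \<partial>gauss ?I)"
  proof (rule nn_integral_exp_neg_ge)
    show "(\<lambda>x. \<kappa> * (fnorm (S * mtx n 1 x))\<^sup>2) \<in> borel_measurable (gauss ?I)" using mS by simp
    show "(\<integral>\<^sup>+x. ennreal (\<kappa> * (fnorm (S * mtx n 1 x))\<^sup>2) \<partial>gauss ?I) = ennreal (\<kappa> * \<rho>\<^sup>2)"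
    proof -
      have "(\<integral>\<^sup>+x. ennreal (\<kappa> * (fnorm (S * mtx n 1 x))\<^sup>2) \<partial>gauss ?I)
        = (\<integral>\<^sup>+x. ennreal \<kappa> * ennreal ((fnorm (S * mtx n 1 x))\<^sup>2) \<partial>gauss ?I)"
        using \<open>0 \<le> \<kappa>\<close> by (simp add: ennreal_mult)
      also have "\<dots> = ennreal \<kappa> * (\<integral>\<^sup>+x. ennreal ((fnorm (S * mtx n 1 x))\<^sup>2) \<partial>gauss ?I)"
        by (rule nn_integral_cmult) (use mS in simp)
      finally show ?thesis using \<open>0 \<le> \<kappa>\<close> unfolding \<rho> by (simp add: ennreal_mult)
    qed
  qed (use \<open>0 \<le> \<kappa>\<close> in auto)
  then have "ennreal (exp K) * ennreal (exp (- (\<kappa> * \<rho>\<^sup>2))) \<le> ennreal (exp K) * (\<integral>\<^sup>+x. ennreal (exp (- (\<kappa> * (fnorm (S * mtx n 1 x))\<^sup>2))) \<partial>gauss ?I)"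
    by (rule mult_left_mono) simp
  also have "\<dots> = (\<integral>\<^sup>+x. ennreal (exp K) * ennreal (exp (- (\<kappa> * (fnorm (S * mtx n 1 x))\<^sup>2))) \<partial>gauss ?I)"
    using mS by (intro nn_integral_cmult[symmetric]) simp
  also have "\<dots> = (\<integral>\<^sup>+x. ennreal (exp (K - \<kappa> * (fnorm (S * mtx n 1 x))\<^sup>2)) \<partial>gauss ?I)"
    by (intro nn_integral_cong) (simp flip: ennreal_mult exp_add)
  finally have "ennreal (exp K) * ennreal (exp (- (\<kappa> * \<rho>\<^sup>2))) \<le> (\<integral>\<^sup>+x. F (mtx n 1 x) \<partial>gauss ?I)"
    using ge unfolding shift by (rule order.trans)
  moreover have "ennreal (exp K) * ennreal (exp (- (\<kappa> * \<rho>\<^sup>2))) = ennreal (exp (b * mat_inner c u - b\<^sup>2 / 2 - \<kappa> * (\<rho>\<^sup>2 + b\<^sup>2 * s\<^sup>2)))"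
    by (simp add: K_def algebra_simps flip: ennreal_mult exp_add)
  ultimately show ?thesis by (simp add: F_def)
qed

text \<open>The one-sided tilt is used twice. For fixed first vector, tilting the second one to mean
  \<open>b v\<close> leaves an exponent of the same linear-minus-quadratic shape in the first, which
  is then tilted to mean \<open>b u\<close>. Each tilt costs \<open>b\<^sup>2 / 2\<close>.\<close>

lemma gauss_bilinear_tilt:
  assumes S: "S \<in> carrier_mat a n" and T: "T \<in> carrier_mat l k" and N: "N \<in> carrier_mat n k"
    and u: "u \<in> carrier_mat n 1" "fnorm u = 1" and v: "v \<in> carrier_mat k 1" "fnorm v = 1"
    and su: "fnorm (S * u) \<le> s" and tv: "fnorm (T * v) \<le> t"
    and \<rho>: "(\<integral>\<^sup>+x. ennreal ((fnorm (S * mtx n 1 x))\<^sup>2) \<partial>gauss (idx n 1)) = ennreal (\<rho>\<^sup>2)"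
    and \<tau>: "(\<integral>\<^sup>+x. ennreal ((fnorm (T * mtx k 1 x))\<^sup>2) \<partial>gauss (idx k 1)) = ennreal (\<tau>\<^sup>2)"
    and "0 \<le> \<kappa>"
  shows "ennreal (exp (b\<^sup>2 * \<mu> * mat_inner u (N * v) - b\<^sup>2 - \<kappa> * (\<tau>\<^sup>2 + b\<^sup>2 * t\<^sup>2) * (\<rho>\<^sup>2 + b\<^sup>2 * s\<^sup>2)))
    \<le> (\<integral>\<^sup>+x. \<integral>\<^sup>+y. ennreal (exp (\<mu> * mat_inner (mtx n 1 x) (N * mtx k 1 y)
          - \<kappa> * (fnorm (S * mtx n 1 x))\<^sup>2 * (fnorm (T * mtx k 1 y))\<^sup>2)) \<partial>gauss (idx k 1) \<partial>gauss (idx n 1))"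
proof -
  \<comment> \<open>A bound for the second moment of \<open>T\<close> at a Gaussian vector of mean
    \<open>b v\<close>; it scales the quadratic term left for the second tilt.\<close>
  define q where "q = \<tau>\<^sup>2 + b\<^sup>2 * t\<^sup>2"
  have q: "0 \<le> q" by (simp add: q_def)
  define c where "c = mat_scale (b * \<mu>) (N * v)"
  have Nv: "N * v \<in> carrier_mat n 1" using N v by auto
  have c: "c \<in> carrier_mat n 1" using Nv by (simp add: c_def)
  have "ennreal (exp (b * mat_inner c u - b\<^sup>2 / 2 - (\<kappa> * q) * (\<rho>\<^sup>2 + b\<^sup>2 * s\<^sup>2)))
    \<le> (\<integral>\<^sup>+x. ennreal (exp (mat_inner c (mtx n 1 x) - (\<kappa> * q) * (fnorm (S * mtx n 1 x))\<^sup>2)) \<partial>gauss (idx n 1))"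
    using q \<open>0 \<le> \<kappa>\<close> by (intro gauss_quadratic_tilt[OF S c u su \<rho>]) simp
  then have "ennreal (exp (- (b\<^sup>2 / 2))) * ennreal (exp (b * mat_inner c u - b\<^sup>2 / 2 - (\<kappa> * q) * (\<rho>\<^sup>2 + b\<^sup>2 * s\<^sup>2)))
    \<le> ennreal (exp (- (b\<^sup>2 / 2))) * (\<integral>\<^sup>+x. ennreal (exp (mat_inner c (mtx n 1 x) - (\<kappa> * q) * (fnorm (S * mtx n 1 x))\<^sup>2)) \<partial>gauss (idx n 1))"
    by (rule mult_left_mono) simp
  also have "\<dots> = (\<integral>\<^sup>+x. ennreal (exp (- (b\<^sup>2 / 2))) * ennreal (exp (mat_inner c (mtx n 1 x) - (\<kappa> * q) * (fnorm (S * mtx n 1 x))\<^sup>2)) \<partial>gauss (idx n 1))"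
  proof (rule nn_integral_cmult[symmetric])
    have "(\<lambda>x. ennreal (exp (mat_inner c (mtx n 1 x) - (\<kappa> * q) * (fnorm (S * mtx n 1 x))\<^sup>2))) \<in> borel_measurable (PiM (idx n 1) (\<lambda>_. borel))"
      using S c
      by (intro measurable_compose[OF _ measurable_ennreal] borel_measurable_exp[THEN measurable_compose[rotated]]
        borel_measurable_diff borel_measurable_times borel_measurable_const borel_measurable_power
        measurable_fnorm[of _ a 1] meas_mat_mult[of _ a n _ 1]
        measurable_mat_inner[of _ n 1] meas_mat_const meas_mat_mtx_self) auto
    then show "(\<lambda>x. ennreal (exp (mat_inner c (mtx n 1 x) - (\<kappa> * q) * (fnorm (S * mtx n 1 x))\<^sup>2))) \<in> borel_measurable (gauss (idx n 1))"
      by simp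
  qed
  also have "\<dots> \<le> (\<integral>\<^sup>+x. \<integral>\<^sup>+y. ennreal (exp (\<mu> * mat_inner (mtx n 1 x) (N * mtx k 1 y)
          - \<kappa> * (fnorm (S * mtx n 1 x))\<^sup>2 * (fnorm (T * mtx k 1 y))\<^sup>2)) \<partial>gauss (idx k 1) \<partial>gauss (idx n 1))"
  proof (rule nn_integral_mono)
    fix x
    define X where "X = mtx n 1 x"
    have X: "X \<in> carrier_mat n 1" by (simp add: X_def)
    define d where "d = mat_scale \<mu> (N\<^sup>\<dagger> * X)"
    have d: "d \<in> carrier_mat k 1" using N X by (auto simp: d_def)
    have di: "mat_inner d y = \<mu> * mat_inner X (N * y)" if "y \<in> carrier_mat k 1" for y
      using mat_inner_mult_left[of "N\<^sup>\<dagger>" k n X 1 y] N X that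
      by (simp add: d_def mat_inner_scale[of _ k 1] mult_carrier_mat[of _ k n _ "Suc 0"])
    have "ennreal (exp (b * mat_inner d v - b\<^sup>2 / 2 - (\<kappa> * (fnorm (S * X))\<^sup>2) * (\<tau>\<^sup>2 + b\<^sup>2 * t\<^sup>2)))
      \<le> (\<integral>\<^sup>+y. ennreal (exp (mat_inner d (mtx k 1 y) - (\<kappa> * (fnorm (S * X))\<^sup>2) * (fnorm (T * mtx k 1 y))\<^sup>2)) \<partial>gauss (idx k 1))"
      using \<open>0 \<le> \<kappa>\<close> by (intro gauss_quadratic_tilt[OF T d v tv \<tau>]) simp
    also have "\<dots> = (\<integral>\<^sup>+y. ennreal (exp (\<mu> * mat_inner X (N * mtx k 1 y) - \<kappa> * (fnorm (S * X))\<^sup>2 * (fnorm (T * mtx k 1 y))\<^sup>2)) \<partial>gauss (idx k 1))"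
      by (simp add: di)
    also have "b * mat_inner d v - b\<^sup>2 / 2 - (\<kappa> * (fnorm (S * X))\<^sup>2) * (\<tau>\<^sup>2 + b\<^sup>2 * t\<^sup>2)
      = - (b\<^sup>2 / 2) + (mat_inner c X - \<kappa> * q * (fnorm (S * X))\<^sup>2)"
      using X Nv mat_inner_commute[OF Nv X] by (simp add: di[OF v(1)] c_def mat_inner_scale[of _ n 1] q_def)
    finally show "ennreal (exp (- (b\<^sup>2 / 2))) * ennreal (exp (mat_inner c (mtx n 1 x) - \<kappa> * q * (fnorm (S * mtx n 1 x))\<^sup>2))
      \<le> (\<integral>\<^sup>+y. ennreal (exp (\<mu> * mat_inner (mtx n 1 x) (N * mtx k 1 y)
          - \<kappa> * (fnorm (S * mtx n 1 x))\<^sup>2 * (fnorm (T * mtx k 1 y))\<^sup>2)) \<partial>gauss (idx k 1))"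
      by (simp add: X_def flip: ennreal_mult exp_add)
  qed
  also have "ennreal (exp (- (b\<^sup>2 / 2))) * ennreal (exp (b * mat_inner c u - b\<^sup>2 / 2 - (\<kappa> * q) * (\<rho>\<^sup>2 + b\<^sup>2 * s\<^sup>2)))
    = ennreal (exp (b\<^sup>2 * \<mu> * mat_inner u (N * v) - b\<^sup>2 - \<kappa> * (\<tau>\<^sup>2 + b\<^sup>2 * t\<^sup>2) * (\<rho>\<^sup>2 + b\<^sup>2 * s\<^sup>2)))"
    using Nv u mat_inner_commute[OF Nv u(1)]
    by (simp add: c_def mat_inner_scale[of _ n 1] q_def power2_eq_square algebra_simps flip: ennreal_mult exp_add)
  finally show ?thesis .
qed

lemma meas_mat_mix_rows:
  assumes "meas_mat N a b F" "meas_mat N a b G"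
  shows "meas_mat N a b (\<lambda>w. mix_rows P (F w) (G w))"
  unfolding meas_mat_def
proof (intro conjI allI impI)
  have c: "F w \<in> carrier_mat a b" for w using assms by (auto simp: meas_mat_def)
  show "mix_rows P (F w) (G w) \<in> carrier_mat a b" for w using c by auto
  fix i j assume ij: "i < a" "j < b"
  then have "(\<lambda>w. mix_rows P (F w) (G w) $$ (i, j)) = (\<lambda>w. if i \<in> P then F w $$ (i, j) else G w $$ (i, j))"
    using carrier_matD[OF c] by auto
  then show "(\<lambda>w. mix_rows P (F w) (G w) $$ (i, j)) \<in> borel_measurable N"
    using assms ij by (cases "i \<in> P") (auto simp: meas_mat_def)
qed

lemma top_rows_mix_rows:
  assumes "X \<in> carrier_mat n l" "Y \<in> carrier_mat n l" "k \<le> n"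
  shows "top_rows k (mix_rows (- {..<k}) X Y) = top_rows k Y"
  using assms by (intro eq_matI) (auto simp: top_rows_def)

lemma gauss_exp_bilinear:
  assumes S: "S \<in> carrier_mat n n" "S\<^sup>\<dagger> = S" and ker: "\<And>u i. u \<in> carrier_mat n 1 \<Longrightarrow> i < k \<Longrightarrow> (S * u) $$ (i, 0) = 0"
    and kn: "k \<le> n" and Y: "Y \<in> carrier_mat n l" and \<xi>: "\<xi> \<in> carrier_mat n 1" and b: "b \<in> carrier_mat l 1"
  shows "(\<integral>\<^sup>+x. ennreal (exp (\<mu> * mat_inner \<xi> (S * (mix_rows (- {..<k}) (mtx n l x) Y * b))
      - \<mu>\<^sup>2 / 2 * (fnorm (S * \<xi>))\<^sup>2 * (fnorm b)\<^sup>2)) \<partial>gauss (idx n l)) = 1"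
proof -
  define a where "a = S * \<xi>"
  define A where "A = mat_scale \<mu> (a * b\<^sup>\<dagger>)"
  define c where "c = \<mu>\<^sup>2 / 2 * (fnorm a)\<^sup>2 * (fnorm b)\<^sup>2"
  have a: "a \<in> carrier_mat n 1" using S \<xi> by (auto simp: a_def)
  have ab: "a * b\<^sup>\<dagger> \<in> carrier_mat n l" using a b by auto
  have A: "A \<in> carrier_mat n l" using ab by (simp add: A_def)
  have "\<mu> * mat_inner \<xi> (S * (mix_rows (- {..<k}) (mtx n l x) Y * b)) = mat_inner A (mtx n l x)" for x
  proof -
    define G where "G = mix_rows (- {..<k}) (mtx n l x) Y"
    have G: "G \<in> carrier_mat n l" by (simp add: G_def)
    have Gb: "G * b \<in> carrier_mat n 1" using G b by auto
    have "mat_inner \<xi> (S * (G * b)) = mat_inner a (G * b)"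
      using mat_inner_mult_left[OF S(1) \<xi> Gb] by (simp add: S(2) a_def)
    also have "\<dots> = mat_inner (a * b\<^sup>\<dagger>) G" by (rule mat_inner_outer[OF a b G])
    also have "\<dots> = mat_inner (a * b\<^sup>\<dagger>) (mtx n l x)"
      unfolding mat_inner_cong_dims[OF ab]
    proof (intro sum.cong refl)
      fix i j assume ij: "i \<in> {..<n}" "j \<in> {..<l}"
      show "inner ((a * b\<^sup>\<dagger>) $$ (i, j)) (G $$ (i, j)) = inner ((a * b\<^sup>\<dagger>) $$ (i, j)) (mtx n l x $$ (i, j))"
      proof (cases "i < k")
        case True
        then have "a $$ (i, 0) = 0" using ker[OF \<xi>] by (simp add: a_def)
        then have "(a * b\<^sup>\<dagger>) $$ (i, j) = 0"
          using ij a b by (subst mat_mult_entry[of _ n 1 _ l]) auto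
        then show ?thesis by simp
      next
        case False
        then show ?thesis using ij by (simp add: G_def)
      qed
    qed
    finally show ?thesis using ab by (simp add: A_def G_def mat_inner_scale[of _ n l])
  qed
  then have "(\<integral>\<^sup>+x. ennreal (exp (\<mu> * mat_inner \<xi> (S * (mix_rows (- {..<k}) (mtx n l x) Y * b))
      - \<mu>\<^sup>2 / 2 * (fnorm (S * \<xi>))\<^sup>2 * (fnorm b)\<^sup>2)) \<partial>gauss (idx n l))
    = (\<integral>\<^sup>+x. ennreal (exp (- c)) * ennreal (exp (mat_inner A (mtx n l x))) \<partial>gauss (idx n l))"
    by (intro nn_integral_cong) (simp add: c_def a_def flip: ennreal_mult exp_add)
  also have "\<dots> = ennreal (exp (- c)) * ennreal (exp ((fnorm A)\<^sup>2 / 2))"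
    unfolding gauss_matrix_exp_inner[OF A, symmetric]
  proof (rule nn_integral_cmult)
    have "(\<lambda>x. mat_inner A (mtx n l x)) \<in> borel_measurable (PiM (idx n l) (\<lambda>_. borel))"
      using A by (intro measurable_mat_inner[of _ n l] meas_mat_const meas_mat_mtx_self) auto
    then show "(\<lambda>x. ennreal (exp (mat_inner A (mtx n l x)))) \<in> borel_measurable (gauss (idx n l))" by simp
  qed
  also have "(fnorm A)\<^sup>2 / 2 = c"
    using a b by (simp add: A_def c_def fnorm_scale fnorm_outer power_mult_distrib)
  finally show ?thesis by (simp flip: ennreal_mult exp_add)
qed

lemma measurable_exp_tilt:
  assumes S: "S \<in> carrier_mat n n" and T: "T \<in> carrier_mat l k"
    and G: "meas_mat N n l G" and \<xi>: "meas_mat N n 1 \<xi>" and \<eta>: "meas_mat N k 1 \<eta>"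
  shows "(\<lambda>w. ennreal (exp (\<mu> * mat_inner (\<xi> w) (S * (G w * (T * \<eta> w)))
    - \<kappa> * (fnorm (S * \<xi> w))\<^sup>2 * (fnorm (T * \<eta> w))\<^sup>2))) \<in> borel_measurable N"
proof -
  have T\<eta>: "meas_mat N l 1 (\<lambda>w. T * \<eta> w)" by (rule meas_mat_mult[OF meas_mat_const[OF T] \<eta>])
  have S\<xi>: "meas_mat N n 1 (\<lambda>w. S * \<xi> w)" by (rule meas_mat_mult[OF meas_mat_const[OF S] \<xi>])
  have SGT: "meas_mat N n 1 (\<lambda>w. S * (G w * (T * \<eta> w)))"
    by (rule meas_mat_mult[OF meas_mat_const[OF S] meas_mat_mult[OF G T\<eta>]])
  note [measurable] = measurable_mat_inner[OF \<xi> SGT] measurable_fnorm[OF T\<eta>] measurable_fnorm[OF S\<xi>]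
  show ?thesis by measurable
qed

text \<open>A Chevet-type bound. The normalised exponential moment \<open>Zf\<close> has mean 1 over
  the Gaussian rows, while tilting bounds it below for every unit \<open>v\<close> at once. The
  supremum over \<open>v\<close> is thus taken before integrating, and
  \<open>exp z \<ge> 1 + z\<close> makes the comparison linear.\<close>

lemma tail_ratio_expectation:
  assumes S: "S \<in> carrier_mat n n" "S\<^sup>\<dagger> = S" and ker: "\<And>u i. u \<in> carrier_mat n 1 \<Longrightarrow> i < k \<Longrightarrow> (S * u) $$ (i, 0) = 0"
    and kn: "1 \<le> k" "k \<le> n" and Y: "Y \<in> carrier_mat n l" and X: "X = top_rows k Y"
    and Z: "Z \<in> carrier_mat k k" "Z * (X * X\<^sup>\<dagger>) = 1\<^sub>m k" and T: "T = X\<^sup>\<dagger> * Z"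
    and s: "0 < s" "\<And>u. u \<in> carrier_mat n 1 \<Longrightarrow> fnorm (S * u) \<le> s * fnorm u"
    and t: "0 < t" "\<And>v. v \<in> carrier_mat k 1 \<Longrightarrow> fnorm (T * v) \<le> t * fnorm v"
    and \<rho>: "0 < \<rho>" "(\<integral>\<^sup>+x. ennreal ((fnorm (S * mtx n 1 x))\<^sup>2) \<partial>gauss (idx n 1)) = ennreal (\<rho>\<^sup>2)"
    and \<tau>: "0 < \<tau>" "(\<integral>\<^sup>+x. ennreal ((fnorm (T * mtx k 1 x))\<^sup>2) \<partial>gauss (idx k 1)) = ennreal (\<tau>\<^sup>2)"
  shows "(\<integral>\<^sup>+x. tail_ratio S k (mix_rows (- {..<k}) (mtx n l x) Y) \<partial>gauss (idx n l)) \<le> ennreal (3 / 2 * (t * \<rho> + s * \<tau>))"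
proof -
  let ?Gx = "gauss (idx n l)" and ?Gu = "gauss (idx n 1)" and ?Gv = "gauss (idx k 1)"
  interpret Gx: prob_space ?Gx by (rule prob_space_gauss)
  interpret Gu: prob_space ?Gu by (rule prob_space_gauss)
  interpret Gv: prob_space ?Gv by (rule prob_space_gauss)
  interpret ux: pair_sigma_finite ?Gu ?Gx by standard
  interpret vx: pair_sigma_finite ?Gv ?Gx by standard
  \<comment> \<open>The common squared length of the two tilts. It makes both shifted second moments
    multiples of \<open>t * \<rho> + s * \<tau>\<close>, so that with \<mu> below the quadratic
    penalty is exactly \<open>\<beta> / 2\<close>. Together with the cost \<beta> of the two shifts
    this produces the factor 3/2.\<close>
  define \<beta> where "\<beta> = \<tau> * \<rho> / (s * t)"
  define \<mu> where "\<mu> = 1 / (t * \<rho> + s * \<tau>)"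
  define G where "G x = mix_rows (- {..<k}) (mtx n l x) Y" for x
  define h where "h x \<xi> \<eta> = ennreal (exp (\<mu> * mat_inner (mtx n 1 \<xi>) (S * (G x * (T * mtx k 1 \<eta>)))
      - \<mu>\<^sup>2 / 2 * (fnorm (S * mtx n 1 \<xi>))\<^sup>2 * (fnorm (T * mtx k 1 \<eta>))\<^sup>2))" for x \<xi> \<eta>
  \<comment> \<open>A function of the rows alone: the auxiliary pair of Gaussian vectors is
    integrated out.\<close>
  define Zf where "Zf x = (\<integral>\<^sup>+\<xi>. \<integral>\<^sup>+\<eta>. h x \<xi> \<eta> \<partial>?Gv \<partial>?Gu)" for x
  have pos: "0 < t * \<rho> + s * \<tau>" using s t \<rho> \<tau> by (simp add: add_pos_pos)
  have beta: "0 < \<beta>" using s t \<rho> \<tau> by (simp add: \<beta>_def)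
  have mu: "0 < \<mu>" using pos by (simp add: \<mu>_def)
  have Xc: "X \<in> carrier_mat k l" using Y by (simp add: X)
  have Tc: "T \<in> carrier_mat l k" using Xc Z by (auto simp: T)
  have Gc: "G x \<in> carrier_mat n l" for x by (simp add: G_def)
  have topG: "top_rows k (G x) = X" for x
    unfolding G_def X by (rule top_rows_mix_rows[OF mtx_carrier Y kn(2)])
  have hm: "(\<lambda>w. h (f w) (g w) (e w)) \<in> borel_measurable N"
    if "f \<in> N \<rightarrow>\<^sub>M PiM (idx n l) (\<lambda>_. borel)" "g \<in> N \<rightarrow>\<^sub>M PiM (idx n 1) (\<lambda>_. borel)" "e \<in> N \<rightarrow>\<^sub>M PiM (idx k 1) (\<lambda>_. borel)"
    for f g e and N :: "'b measure"
    unfolding h_def G_def using that Y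
    by (intro measurable_exp_tilt[OF S(1) Tc] meas_mat_mix_rows meas_mat_const meas_mat_mtx) auto
  have [measurable]: "Zf \<in> borel_measurable ?Gx"
  proof -
    have "(\<lambda>w. h (fst (fst w)) (snd (fst w)) (snd w)) \<in> borel_measurable ((?Gx \<Otimes>\<^sub>M ?Gu) \<Otimes>\<^sub>M ?Gv)"
      by (rule hm) measurable
    then have "(\<lambda>w. \<integral>\<^sup>+\<eta>. h (fst w) (snd w) \<eta> \<partial>?Gv) \<in> borel_measurable (?Gx \<Otimes>\<^sub>M ?Gu)"
      by (intro Gv.borel_measurable_nn_integral) (simp add: case_prod_beta)
    then show ?thesis
      unfolding Zf_def by (intro Gu.borel_measurable_nn_integral) (simp add: case_prod_beta)
  qed
  have EZ: "(\<integral>\<^sup>+x. Zf x \<partial>?Gx) = 1"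
  proof -
    have "(\<lambda>w. h (snd (fst w)) (fst (fst w)) (snd w)) \<in> borel_measurable ((?Gu \<Otimes>\<^sub>M ?Gx) \<Otimes>\<^sub>M ?Gv)"
      by (rule hm) measurable
    then have "(\<lambda>w. \<integral>\<^sup>+\<eta>. h (snd w) (fst w) \<eta> \<partial>?Gv) \<in> borel_measurable (?Gu \<Otimes>\<^sub>M ?Gx)"
      by (intro Gv.borel_measurable_nn_integral) (simp add: case_prod_beta)
    then have "(\<integral>\<^sup>+x. Zf x \<partial>?Gx) = (\<integral>\<^sup>+\<xi>. \<integral>\<^sup>+x. \<integral>\<^sup>+\<eta>. h x \<xi> \<eta> \<partial>?Gv \<partial>?Gx \<partial>?Gu)"
      unfolding Zf_def by (intro ux.Fubini') (simp add: case_prod_beta)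
    also have "\<dots> = (\<integral>\<^sup>+\<xi>. \<integral>\<^sup>+\<eta>. \<integral>\<^sup>+x. h x \<xi> \<eta> \<partial>?Gx \<partial>?Gv \<partial>?Gu)"
    proof (rule nn_integral_cong)
      fix \<xi> assume "\<xi> \<in> space ?Gu"
      then have m\<xi>: "(\<lambda>_. \<xi>) \<in> (?Gv \<Otimes>\<^sub>M ?Gx) \<rightarrow>\<^sub>M PiM (idx n 1) (\<lambda>_. borel)"
        by (intro measurable_const) (simp add: space_PiM)
      have "snd \<in> (?Gv \<Otimes>\<^sub>M ?Gx) \<rightarrow>\<^sub>M PiM (idx n l) (\<lambda>_. borel)" "fst \<in> (?Gv \<Otimes>\<^sub>M ?Gx) \<rightarrow>\<^sub>M PiM (idx k 1) (\<lambda>_. borel)"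
        by measurable
      from hm[OF this(1) m\<xi> this(2)]
      have "(\<lambda>w. h (snd w) \<xi> (fst w)) \<in> borel_measurable (?Gv \<Otimes>\<^sub>M ?Gx)" .
      then show "(\<integral>\<^sup>+x. \<integral>\<^sup>+\<eta>. h x \<xi> \<eta> \<partial>?Gv \<partial>?Gx) = (\<integral>\<^sup>+\<eta>. \<integral>\<^sup>+x. h x \<xi> \<eta> \<partial>?Gx \<partial>?Gv)"
        by (intro vx.Fubini') (simp add: case_prod_beta)
    qed
    also have "\<dots> = (\<integral>\<^sup>+\<xi>. \<integral>\<^sup>+\<eta>. 1 \<partial>?Gv \<partial>?Gu)"
      unfolding h_def G_def using Tc
      by (intro nn_integral_cong gauss_exp_bilinear[OF S ker kn(2) Y]) auto
    also have "\<dots> = 1" using Gu.emeasure_space_1 Gv.emeasure_space_1 by simp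
    finally show ?thesis .
  qed
  have key: "ennreal (\<beta> * \<mu> * fnorm (S * (G x * (T * v))) + 1) \<le> Zf x + ennreal (3 / 2 * \<beta>)"
    if v: "v \<in> carrier_mat k 1" "fnorm v = 1" for x v
  proof -
    have GT: "G x * T \<in> carrier_mat n k" using Gc[of x] Tc by (rule mult_carrier_mat)
    define N where "N = S * (G x * T)"
    have N: "N \<in> carrier_mat n k" using S GT by (auto simp: N_def)
    have Nv: "N * y = S * (G x * (T * y))" if "y \<in> carrier_mat k 1" for y
      using that S Gc[of x] Tc GT by (simp add: N_def assoc_mult_mat[of _ n n _ k _ 1] assoc_mult_mat[of _ n l _ k _ 1])
    have Nvc: "N * v \<in> carrier_mat n 1" using N v by auto
    obtain u where u: "u \<in> carrier_mat n 1" "fnorm u = 1" "mat_inner u (N * v) = fnorm (N * v)"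
    proof (cases "fnorm (N * v) = 0")
      case True
      then have "N * v = 0\<^sub>m n 1" using Nvc fnorm_eq_0_iff by blast
      then show ?thesis using that[of "unit_col n 0"] kn True by simp
    next
      case False
      then show ?thesis
        using that[of "mat_scale (1 / fnorm (N * v)) (N * v)"] Nvc
        by (simp add: fnorm_scale mat_inner_scale[of _ n 1] power2_eq_square flip: fnorm_sq)
    qed
    \<comment> \<open>The tilt length is \<open>sqrt \<beta>\<close>, and
      \<open>\<mu>\<^sup>2 / 2\<close> is the coefficient that normalises \<open>h\<close>. As
      \<open>u\<close> points along \<open>N * v\<close>, the bilinear form equals the norm of
      \<open>N * v\<close>.\<close>
    have "ennreal (exp ((sqrt \<beta>)\<^sup>2 * \<mu> * mat_inner u (N * v) - (sqrt \<beta>)\<^sup>2 - \<mu>\<^sup>2 / 2 * (\<tau>\<^sup>2 + (sqrt \<beta>)\<^sup>2 * t\<^sup>2) * (\<rho>\<^sup>2 + (sqrt \<beta>)\<^sup>2 * s\<^sup>2)))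
      \<le> (\<integral>\<^sup>+\<xi>. \<integral>\<^sup>+\<eta>. ennreal (exp (\<mu> * mat_inner (mtx n 1 \<xi>) (N * mtx k 1 \<eta>)
          - \<mu>\<^sup>2 / 2 * (fnorm (S * mtx n 1 \<xi>))\<^sup>2 * (fnorm (T * mtx k 1 \<eta>))\<^sup>2)) \<partial>?Gv \<partial>?Gu)"
      using s(2)[OF u(1)] t(2)[OF v(1)] u v by (intro gauss_bilinear_tilt[OF S(1) Tc N _ _ _ _ _ _ \<rho>(2) \<tau>(2)]) auto
    also have "\<dots> = Zf x" by (simp add: Zf_def h_def Nv)
    also have "(sqrt \<beta>)\<^sup>2 = \<beta>" using beta by simp
    also have "\<mu>\<^sup>2 / 2 * (\<tau>\<^sup>2 + \<beta> * t\<^sup>2) * (\<rho>\<^sup>2 + \<beta> * s\<^sup>2) = \<beta> / 2"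
    proof -
      have e1: "\<tau>\<^sup>2 + \<beta> * t\<^sup>2 = \<tau> / s * (t * \<rho> + s * \<tau>)"
        and e2: "\<rho>\<^sup>2 + \<beta> * s\<^sup>2 = \<rho> / t * (t * \<rho> + s * \<tau>)"
        using s t by (simp_all add: \<beta>_def field_simps power2_eq_square)
      have e3: "\<mu> * (t * \<rho> + s * \<tau>) = 1" using pos by (simp add: \<mu>_def)
      have "\<mu>\<^sup>2 / 2 * (a * w) * (c * w) = (\<mu> * w)\<^sup>2 / 2 * (a * c)" for a c w
        by (simp add: power2_eq_square)
      then have "\<mu>\<^sup>2 / 2 * (\<tau>\<^sup>2 + \<beta> * t\<^sup>2) * (\<rho>\<^sup>2 + \<beta> * s\<^sup>2)
        = (\<mu> * (t * \<rho> + s * \<tau>))\<^sup>2 / 2 * (\<tau> / s * (\<rho> / t))"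
        unfolding e1 e2 .
      then show ?thesis unfolding e3 by (simp add: \<beta>_def mult.commute)
    qed
    finally have le: "ennreal (exp (\<beta> * \<mu> * fnorm (N * v) - \<beta> - \<beta> / 2)) \<le> Zf x" by (simp add: u)
    have "1 + (\<beta> * \<mu> * fnorm (N * v) - 3 / 2 * \<beta>) \<le> exp (\<beta> * \<mu> * fnorm (N * v) - \<beta> - \<beta> / 2)"
      using exp_ge_add_one_self[of "\<beta> * \<mu> * fnorm (N * v) - \<beta> - \<beta> / 2"] by simp
    then have "ennreal (\<beta> * \<mu> * fnorm (N * v) + 1) \<le> ennreal (exp (\<beta> * \<mu> * fnorm (N * v) - \<beta> - \<beta> / 2) + 3 / 2 * \<beta>)"
      by (intro ennreal_leI) linarith
    also have "\<dots> = ennreal (exp (\<beta> * \<mu> * fnorm (N * v) - \<beta> - \<beta> / 2)) + ennreal (3 / 2 * \<beta>)"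
      using beta by (intro ennreal_plus) auto
    also have "\<dots> \<le> Zf x + ennreal (3 / 2 * \<beta>)" using le by (rule add_right_mono)
    finally show ?thesis using Nv[OF v(1)] by simp
  qed
  \<comment> \<open>Where \<open>Zf x\<close> is finite, \<open>key\<close> gives one constant valid
    for all unit \<open>v\<close>, hence for the supremum; where it is infinite nothing is
    claimed.\<close>
  have pw: "ennreal (\<beta> * \<mu>) * tail_ratio S k (G x) + 1 \<le> Zf x + ennreal (3 / 2 * \<beta>)" for x
  proof (cases "Zf x")
    case (real z)
    define c where "c = (z + 3 / 2 * \<beta> - 1) / (\<beta> * \<mu>)"
    have key': "\<beta> * \<mu> * fnorm (S * (G x * (T * v))) + 1 \<le> z + 3 / 2 * \<beta>" if "v \<in> carrier_mat k 1" "fnorm v = 1" for v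
      using key[OF that, of x] real beta mu by (simp add: ennreal_le_iff flip: ennreal_plus)
    then have c: "fnorm (S * (G x * (T * v))) \<le> c" if "v \<in> carrier_mat k 1" "fnorm v = 1" for v
      using key'[OF that] beta mu by (simp add: c_def le_divide_eq mult.commute)
    have c0: "0 \<le> c" using order.trans[OF fnorm_nonneg c[of "unit_col k 0"]] kn by simp
    have SG: "S * (G x * T) \<in> carrier_mat n k" using S Gc[of x] Tc by auto
    have asc: "S * (G x * T) * v = S * (G x * (T * v))" if "v \<in> carrier_mat k 1" for v
      using that S Gc[of x] Tc
      by (simp add: assoc_mult_mat[of _ n n _ k _ 1] assoc_mult_mat[of _ n l _ k _ 1] mult_carrier_mat[of _ n l _ k])
    have "tail_ratio S k (G x) \<le> ennreal c"
    proof (rule tail_ratio_le[OF S(1) Gc topG[symmetric] Z _ c0])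
      fix y :: "quat mat" assume y: "y \<in> carrier_mat k 1"
      have "fnorm (S * (G x * T) * y) \<le> c * fnorm y"
        by (rule fnorm_le_of_unit_bound[OF SG y]) (simp add: asc c)
      then show "fnorm (S * (G x * (X\<^sup>\<dagger> * Z * y))) \<le> c * fnorm y" by (simp add: asc[OF y] flip: T)
    qed
    then have "ennreal (\<beta> * \<mu>) * tail_ratio S k (G x) + 1 \<le> ennreal (\<beta> * \<mu>) * ennreal c + 1"
      by (intro add_right_mono mult_left_mono) auto
    also have "\<dots> = ennreal (\<beta> * \<mu> * c + 1)"
      using beta mu c0 by (simp add: ennreal_mult)
    also have "\<beta> * \<mu> * c + 1 = z + 3 / 2 * \<beta>" using beta mu by (simp add: c_def)
    finally show ?thesis using real beta by simp
  qed simp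
  have mt: "(\<lambda>x. tail_ratio S k (G x)) \<in> borel_measurable (PiM (idx n l) (\<lambda>_. borel))"
    unfolding G_def
    by (rule measurable_tail_ratio[OF S(1) meas_mat_mix_rows[OF meas_mat_mtx_self[OF order_refl] meas_mat_const[OF Y]] kn(2)])
  have "ennreal (\<beta> * \<mu>) * (\<integral>\<^sup>+x. tail_ratio S k (G x) \<partial>?Gx) + 1 = (\<integral>\<^sup>+x. ennreal (\<beta> * \<mu>) * tail_ratio S k (G x) + 1 \<partial>?Gx)"
    using mt Gx.emeasure_space_1 by (simp add: nn_integral_add nn_integral_cmult)
  also have "\<dots> \<le> (\<integral>\<^sup>+x. Zf x + ennreal (3 / 2 * \<beta>) \<partial>?Gx)" using pw by (intro nn_integral_mono)
  also have "\<dots> = ennreal (3 / 2 * \<beta>) + 1"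
    using Gx.emeasure_space_1 by (simp add: nn_integral_add EZ add.commute)
  finally have "ennreal (\<beta> * \<mu>) * (\<integral>\<^sup>+x. tail_ratio S k (G x) \<partial>?Gx) \<le> ennreal (3 / 2 * \<beta>)"
    by (subst (asm) (1 2) add.commute) (simp add: ennreal_add_left_cancel_le)
  also have "3 / 2 * \<beta> = \<beta> * \<mu> * (3 / 2 * (t * \<rho> + s * \<tau>))"
  proof -
    have "\<beta> * \<mu> * (3 / 2 * w) = 3 / 2 * \<beta> * (\<mu> * w)" for w by simp
    moreover have "\<mu> * (t * \<rho> + s * \<tau>) = 1" using pos by (simp add: \<mu>_def)
    ultimately show ?thesis by (metis mult.right_neutral)
  qed
  also have "ennreal \<dots> = ennreal (\<beta> * \<mu>) * ennreal (3 / 2 * (t * \<rho> + s * \<tau>))"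
    using beta mu pos by (intro ennreal_mult) auto
  finally show ?thesis
    using beta mu by (simp add: ennreal_mult_le_mult_iff G_def)
qed

subsection \<open>Moments of the pseudoinverse of a Gaussian matrix\<close>

lemma measurable_inv_pow [measurable]: "inv_pow r \<in> borel_measurable borel"
  unfolding inv_pow_def by measurable

text \<open>Rotation invariance turns \<open>c\<close> into a real multiple of the first coordinate
  column, and the real inner product then sees a single normal variable.\<close>

lemma gauss_inner_even_moment:
  assumes c: "c \<in> carrier_mat k 1" and "1 \<le> r"
  shows "(\<integral>\<^sup>+x. ennreal (mat_inner c (mtx k 1 x) ^ (2 * r)) \<partial>gauss (idx k 1))
    = ennreal (fnorm c ^ (2 * r) * (2 ^ r * pochhammer (1 / 2) r))"
proof (cases "fnorm c = 0")
  case True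
  then have "c = 0\<^sub>m k 1" using c fnorm_eq_0_iff by blast
  then show ?thesis using assms(2) True by (simp add: power_0_left)
next
  case False
  define u where "u = mat_scale (1 / fnorm c) c"
  have u: "u \<in> carrier_mat k 1" "fnorm u = 1" using c False by (auto simp: u_def fnorm_scale)
  have k: "0 < k" using u by (cases k) (auto simp: fnorm_def mat_inner_def)
  obtain U where U: "U \<in> carrier_mat k k" "quat_unitary U" "U * unit_col k 0 = u"
    using exists_unitary_first_col[OF u] .
  have cu: "c = mat_scale (fnorm c) u" using False by (simp add: u_def mat_scale_scale)
  have eq: "mat_inner c (U * mtx k 1 x) = fnorm c * x (0, 0, 0)" for x
  proof -
    have "mat_inner c (U * mtx k 1 x) = fnorm c * mat_inner (U * unit_col k 0) (U * mtx k 1 x)"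
      using u U by (subst cu) (simp add: mat_inner_scale[of _ k 1] mult_carrier_mat[of _ k k _ "Suc 0"])
    also have "mat_inner (U * unit_col k 0) (U * mtx k 1 x) = mat_inner (unit_col k 0) (mtx k 1 x)"
      using mat_inner_unitary_mult[OF U(2,1), of "unit_col k 0" 1 "mtx k 1 x"] by simp
    also have "\<dots> = (\<Sum>j<k. if j = 0 then inner 1 (mtx k 1 x $$ (j, 0)) else 0)"
      by (simp add: mat_inner_cong_dims[of _ k 1] if_distrib[of "\<lambda>x. inner x _"] cong: if_cong)
    also have "\<dots> = x (0, 0, 0)" using k by (simp add: mtx_index inner_quat_def one_quat_def)
    finally show ?thesis .
  qed
  have m: "(\<lambda>x. ennreal (mat_inner c (mtx k 1 x) ^ (2 * r))) \<in> borel_measurable (PiM (idx k 1) (\<lambda>_. borel))"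
    using c by (intro measurable_compose[OF _ measurable_ennreal] borel_measurable_power
      measurable_mat_inner[of _ k 1] meas_mat_const meas_mat_mtx_self) auto
  have "(\<integral>\<^sup>+x. ennreal (mat_inner c (mtx k 1 x) ^ (2 * r)) \<partial>gauss (idx k 1))
    = (\<integral>\<^sup>+x. ennreal (mat_inner c (U * mtx k 1 x) ^ (2 * r)) \<partial>gauss (idx k 1))"
    by (rule gauss_matrix_unitary_left[OF m U(2,1), symmetric])
  also have "\<dots> = (\<integral>\<^sup>+x. (\<lambda>y. ennreal (fnorm c ^ (2 * r)) * ennreal ((y\<^sup>2) ^ r)) (x (0, 0, 0)) \<partial>gauss (idx k 1))"
    unfolding eq by (intro nn_integral_cong) (simp add: power_mult_distrib power_mult flip: ennreal_mult)
  also have "\<dots> = (\<integral>\<^sup>+y. ennreal (fnorm c ^ (2 * r)) * ennreal ((y\<^sup>2) ^ r) \<partial>density lborel (\<lambda>x. ennreal (std_normal_density x)))"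
    using k by (intro nn_integral_gauss_component) (auto simp: idx_def)
  also have "\<dots> = ennreal (fnorm c ^ (2 * r)) * ennreal (2 ^ r * pochhammer (1 / 2) r)"
    unfolding std_normal_even_moment[symmetric] by (rule nn_integral_cmult) measurable
  finally show ?thesis by (simp add: pochhammer_nonneg flip: ennreal_mult)
qed

text \<open>For \<open>u\<close> along the image of a maximal direction,
  \<open>fnorm (T * g)\<close> is at least the absolute value of a centred normal variable whose
  standard deviation is \<open>fnorm (T\<^sup>\<dagger> * u)\<close>, at least \<open>t\<close>. The
  extra factor is the standard normal moment of order \<open>2 * r\<close>.\<close>

lemma operator_norm_moment_le:
  assumes T: "T \<in> carrier_mat l k" and "0 < l" "0 < k" "1 \<le> r" and t: "t = quat_spectral_norm T"
  shows "ennreal (t ^ (2 * r) * (2 ^ r * pochhammer (1 / 2) r))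
    \<le> (\<integral>\<^sup>+x. ennreal (fnorm (T * mtx k 1 x) ^ (2 * r)) \<partial>gauss (idx k 1))"
proof -
  obtain v where v: "v \<in> carrier_mat k 1" "fnorm v = 1" "fnorm (T * v) = t"
    using spectral_norm_attained[OF T assms(2,3)] t by metis
  have t0: "0 \<le> t" using fnorm_nonneg[of "T * v"] v by simp
  \<comment> \<open>For \<open>t = 0\<close> this is the zero column, hence only a norm bound by
    1.\<close>
  define u where "u = mat_scale (1 / t) (T * v)"
  have Tv: "T * v \<in> carrier_mat l 1" using T v by auto
  have u: "u \<in> carrier_mat l 1" "fnorm u \<le> 1" using Tv v t0 by (auto simp: u_def fnorm_scale)
  define c where "c = T\<^sup>\<dagger> * u"
  have c: "c \<in> carrier_mat k 1" using T u by (auto simp: c_def)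
  have ci: "mat_inner c y = mat_inner u (T * y)" if "y \<in> carrier_mat k 1" for y
    using mat_inner_mult_left[of "T\<^sup>\<dagger>" k l u 1 y] T u that by (simp add: c_def)
  have "t \<le> mat_inner c v"
    using Tv v by (cases "t = 0") (auto simp: ci u_def mat_inner_scale[of _ l 1] power2_eq_square simp flip: fnorm_sq)
  also have "\<dots> \<le> fnorm c" using mat_inner_Cauchy_Schwarz[OF c v(1)] v by simp
  finally have tc: "t ^ (2 * r) \<le> fnorm c ^ (2 * r)" using t0 by (rule power_mono)
  have poch: "0 \<le> (pochhammer (1 / 2) r :: real)" by (simp add: pochhammer_nonneg)
  have "ennreal (t ^ (2 * r) * (2 ^ r * pochhammer (1 / 2) r)) \<le> ennreal (fnorm c ^ (2 * r) * (2 ^ r * pochhammer (1 / 2) r))"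
    using tc poch by (intro ennreal_leI mult_right_mono) auto
  also have "\<dots> = (\<integral>\<^sup>+x. ennreal (mat_inner c (mtx k 1 x) ^ (2 * r)) \<partial>gauss (idx k 1))"
    by (rule gauss_inner_even_moment[OF c assms(4), symmetric])
  also have "\<dots> \<le> (\<integral>\<^sup>+x. ennreal (fnorm (T * mtx k 1 x) ^ (2 * r)) \<partial>gauss (idx k 1))"
  proof (intro nn_integral_mono ennreal_leI)
    fix x
    have "\<bar>mat_inner c (mtx k 1 x)\<bar> \<le> fnorm u * fnorm (T * mtx k 1 x)"
      using mat_inner_Cauchy_Schwarz[OF u(1), of "T * mtx k 1 x"] T by (simp add: ci mult_carrier_mat[of _ l k])
    also have "\<dots> \<le> fnorm (T * mtx k 1 x)" by (rule mult_left_le_one_le[OF fnorm_nonneg fnorm_nonneg u(2)])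
    finally have "\<bar>mat_inner c (mtx k 1 x)\<bar> ^ (2 * r) \<le> fnorm (T * mtx k 1 x) ^ (2 * r)" by (intro power_mono) auto
    then show "mat_inner c (mtx k 1 x) ^ (2 * r) \<le> fnorm (T * mtx k 1 x) ^ (2 * r)"
      by (simp add: power_even_abs)
  qed
  finally show ?thesis .
qed

lemma qsvd_adjoint_mult:
  assumes svd: "is_qsvd A U \<sigma> V" and A: "A \<in> carrier_mat m n"
  shows "U\<^sup>\<dagger> * A = quat_diag m n \<sigma> * V\<^sup>\<dagger>"
proof -
  note D = is_qsvdD[OF svd A]
  show ?thesis
    using D(1-4) by (subst D(5)) (simp add: assoc_mult_mat[of _ m m _ n _ n]
      mat_assoc_cancel[of _ m m _ _ n] quat_unitaryD mult_carrier_mat[of _ m n _ n])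
qed

text \<open>The distance of the first row from the span of the other \<open>k - 1\<close> rows: rotate that span into the first
  \<open>k - 1\<close> coordinates.\<close>

lemma inv_form_first_row_le:
  assumes k: "1 \<le> k" and Y: "Y \<in> carrier_mat k l" and "0 \<le> \<gamma>" "1 \<le> r"
  obtains U where "U \<in> carrier_mat l l" "quat_unitary U"
    "\<And>X. X \<in> carrier_mat k l \<Longrightarrow> inv_form (mix_rows {0} X Y) (mat_scale \<gamma> (unit_col k 0)) ^ r
      \<le> ennreal (\<gamma> ^ (2 * r)) * inv_pow r (\<Sum>j=k-1..<l. (norm ((X * U) $$ (0, j)))\<^sup>2)"
proof -
  \<comment> \<open>The conjugated rows below the first, as columns. They come from \<open>Y\<close>
    alone, so the rotation found here stays fixed while the first row is resampled.\<close>
  define C where "C = Matrix.mat l (k - 1) (\<lambda>(i, j). conjugate (Y $$ (Suc j, i)))"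
  have C: "C \<in> carrier_mat l (k - 1)" by (simp add: C_def)
  obtain U \<sigma> V where svd: "is_qsvd C U \<sigma> V" using qsvd_exists[OF C] by blast
  note D = is_qsvdD[OF svd C]
  have UC: "U\<^sup>\<dagger> * C = quat_diag l (k - 1) \<sigma> * V\<^sup>\<dagger>"
    by (rule qsvd_adjoint_mult[OF svd C])
  \<comment> \<open>The diagonal factor has only \<open>k - 1\<close> columns, so rows from index
    \<open>k - 1\<close> on vanish, whatever the rank of \<open>C\<close>.\<close>
  have UC0: "(U\<^sup>\<dagger> * C) $$ (j, i) = 0" if "k - 1 \<le> j" "j < l" "i < k - 1" for i j
    unfolding UC using that D(3) by (subst quat_diag_mult_index[of _ "k - 1" "k - 1"]) auto
  show ?thesis
  proof (rule that[OF D(1,2)])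
    fix X :: "quat mat" assume X: "X \<in> carrier_mat k l"
    define M where "M = mix_rows {0} X Y"
    have M: "M \<in> carrier_mat k l" using X by (simp add: M_def)
    define MU where "MU = M * U"
    have MU: "MU \<in> carrier_mat k l" using M D by (auto simp: MU_def)
    define d where "d = (\<Sum>j=k-1..<l. (norm ((X * U) $$ (0, j)))\<^sup>2)"
    have d0: "0 \<le> d" by (auto simp: d_def intro!: sum_nonneg)
    have MU_first: "MU $$ (0, j) = (X * U) $$ (0, j)" if "j < l" for j
      unfolding MU_def using that k M X D(1)
      by (simp add: mat_mult_entry[of _ k l _ l] M_def del: index_mult_mat(1))
    have MU_rest: "MU $$ (i, j) = 0" if "0 < i" "i < k" "k - 1 \<le> j" "j < l" for i j
    proof -
      have "MU $$ (i, j) = (\<Sum>a<l. Y $$ (i, a) * U $$ (a, j))"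
        unfolding MU_def using that M X D(1)
        by (subst mat_mult_entry[of _ k l _ l]) (auto simp: M_def intro!: sum.cong)
      also have "\<dots> = conjugate ((U\<^sup>\<dagger> * C) $$ (j, i - 1))"
      proof -
        have "(U\<^sup>\<dagger> * C) $$ (j, i - 1) = (\<Sum>a<l. conjugate (U $$ (a, j)) * conjugate (Y $$ (i, a)))"
          using that C D(1) by (subst mat_mult_entry[of _ l l _ "k - 1"]) (auto simp: C_def intro!: sum.cong)
        then show ?thesis by (simp add: conjugate_sum_quat conjugate_mult_quat)
      qed
      finally show ?thesis using UC0[of j "i - 1"] that by (simp add: conjugate_zero_quat del: index_mult_mat(1))
    qed
    \<comment> \<open>In the rotated columns from \<open>k - 1\<close> on only the first row of
      \<open>M\<close> is nonzero, so only the first entry of \<open>z\<close> contributes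
      there.\<close>
    have lower: "(norm (z $$ (0, 0)))\<^sup>2 * d \<le> (fnorm (M\<^sup>\<dagger> * z))\<^sup>2" if z: "z \<in> carrier_mat k 1" for z
    proof -
      have MUz: "MU\<^sup>\<dagger> * z \<in> carrier_mat l 1" using MU z by auto
      have "MU\<^sup>\<dagger> * z = U\<^sup>\<dagger> * (M\<^sup>\<dagger> * z)"
        using M D(1) z by (simp add: MU_def quat_adjoint_mult[of _ k l _ l] assoc_mult_mat[of _ l l _ k _ 1])
      then have "fnorm (M\<^sup>\<dagger> * z) = fnorm (MU\<^sup>\<dagger> * z)"
        using fnorm_unitary_mult[OF quat_unitary_adjoint[OF D(2)], of l "M\<^sup>\<dagger> * z" 1] D(1) M z by simp
      then have "(fnorm (M\<^sup>\<dagger> * z))\<^sup>2 = (\<Sum>j<l. (norm ((MU\<^sup>\<dagger> * z) $$ (j, 0)))\<^sup>2)"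
        by (simp only: fnorm_sq_col[OF MUz])
      also have "\<dots> \<ge> (\<Sum>j=k-1..<l. (norm ((MU\<^sup>\<dagger> * z) $$ (j, 0)))\<^sup>2)"
        by (intro sum_mono2) auto
      also have "(\<Sum>j=k-1..<l. (norm ((MU\<^sup>\<dagger> * z) $$ (j, 0)))\<^sup>2) = (\<Sum>j=k-1..<l. (norm (z $$ (0, 0)))\<^sup>2 * (norm ((X * U) $$ (0, j)))\<^sup>2)"
      proof (rule sum.cong[OF refl])
        fix j assume j: "j \<in> {k-1..<l}"
        have "(MU\<^sup>\<dagger> * z) $$ (j, 0) = (\<Sum>i<k. conjugate (MU $$ (i, j)) * z $$ (i, 0))"
          using j MU z by (subst mat_mult_entry[of _ l k _ 1]) auto
        also have "\<dots> = (\<Sum>i\<in>{0}. conjugate (MU $$ (i, j)) * z $$ (i, 0))"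
          using j k MU_rest by (intro sum.mono_neutral_right) (auto simp: conjugate_zero_quat)
        finally show "(norm ((MU\<^sup>\<dagger> * z) $$ (j, 0)))\<^sup>2 = (norm (z $$ (0, 0)))\<^sup>2 * (norm ((X * U) $$ (0, j)))\<^sup>2"
          using j MU_first[of j] by (simp add: norm_mult norm_conjugate_quat power_mult_distrib mult.commute del: index_mult_mat(1))
      qed
      finally show ?thesis by (simp add: d_def sum_distrib_left)
    qed
    have inner: "mat_inner (mat_scale \<gamma> (unit_col k 0)) z \<le> \<gamma> * norm (z $$ (0, 0))" if z: "z \<in> carrier_mat k 1" for z
    proof -
      have "mat_inner (unit_col k 0) z = (\<Sum>j<k. if j = 0 then inner 1 (z $$ (j, 0)) else 0)"
        by (simp add: mat_inner_cong_dims[of _ k 1] if_distrib[of "\<lambda>x. inner x _"] cong: if_cong)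
      also have "\<dots> = inner 1 (z $$ (0, 0))" using k by simp
      also have "\<dots> \<le> norm (z $$ (0, 0))" using Cauchy_Schwarz_ineq2[of 1 "z $$ (0, 0)"] by simp
      finally show ?thesis using z \<open>0 \<le> \<gamma>\<close> by (simp add: mat_inner_scale[of _ k 1] mult_left_mono)
    qed
    have "inv_form M (mat_scale \<gamma> (unit_col k 0)) ^ r \<le> ennreal (\<gamma> ^ (2 * r)) * inv_pow r d"
    proof (cases "d = 0")
      \<comment> \<open>For \<open>d = 0\<close> the right side is infinite unless \<gamma> is 0, in
        which case the left side vanishes.\<close>
      case True
      show ?thesis
      proof (cases "\<gamma> = 0")
        case True
        have "inv_form M (mat_scale \<gamma> (unit_col k 0)) \<le> 0"
        proof (rule inv_form_leI[OF M])
          fix z :: "quat mat" assume "z \<in> carrier_mat k 1"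
          then show "ennreal (2 * mat_inner (mat_scale \<gamma> (unit_col k 0)) z - (fnorm (M\<^sup>\<dagger> * z))\<^sup>2) \<le> 0"
            using True by (simp add: mat_inner_scale[of _ k 1] ennreal_neg)
        qed
        then show ?thesis using \<open>1 \<le> r\<close> by (simp add: power_0_left)
      next
        case False
        then show ?thesis using \<open>d = 0\<close> \<open>0 \<le> \<gamma>\<close> \<open>1 \<le> r\<close> by (simp add: inv_pow_zero ennreal_mult_top)
      qed
    next
      case False
      then have dpos: "0 < d" using d0 by simp
      have "inv_form M (mat_scale \<gamma> (unit_col k 0)) \<le> ennreal (\<gamma>\<^sup>2 / d)"
      proof (rule inv_form_leI[OF M], rule ennreal_leI)
        fix z :: "quat mat" assume z: "z \<in> carrier_mat k 1"
        define a where "a = norm (z $$ (0, 0))"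
        have "2 * mat_inner (mat_scale \<gamma> (unit_col k 0)) z - (fnorm (M\<^sup>\<dagger> * z))\<^sup>2 \<le> 2 * (\<gamma> * a) - a\<^sup>2 * d"
          using inner[OF z] lower[OF z] by (simp add: a_def)
        \<comment> \<open>The maximum of a concave parabola in \<open>a\<close>.\<close>
        also have "\<dots> \<le> \<gamma>\<^sup>2 / d"
        proof -
          have "0 \<le> (\<gamma> - a * d)\<^sup>2" by simp
          then show ?thesis using dpos by (simp add: field_simps power2_eq_square)
        qed
        finally show "2 * mat_inner (mat_scale \<gamma> (unit_col k 0)) z - (fnorm (M\<^sup>\<dagger> * z))\<^sup>2 \<le> \<gamma>\<^sup>2 / d" .
      qed
      then have "inv_form M (mat_scale \<gamma> (unit_col k 0)) ^ r \<le> ennreal (\<gamma>\<^sup>2 / d) ^ r"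
        by (intro power_mono) auto
      also have "\<dots> = ennreal (\<gamma> ^ (2 * r) * (1 / d ^ r))"
        using dpos by (simp add: ennreal_power power_divide power_mult)
      also have "\<dots> = ennreal (\<gamma> ^ (2 * r)) * inv_pow r d"
        using dpos \<open>0 \<le> \<gamma>\<close> \<open>1 \<le> r\<close> by (simp add: inv_pow_pos ennreal_mult flip: ennreal_mult)
      finally show ?thesis .
    qed
    then show "inv_form (mix_rows {0} X Y) (mat_scale \<gamma> (unit_col k 0)) ^ r
      \<le> ennreal (\<gamma> ^ (2 * r)) * inv_pow r (\<Sum>j=k-1..<l. (norm ((X * U) $$ (0, j)))\<^sup>2)"
      by (simp only: M_def d_def)
  qed
qed

text \<open>Rotation on the left replaces \<open>g\<close> by its norm times the first coordinate
  column. Given the other rows, the first row rotated on the right is again Gaussian, so only its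
  last \<open>l - k + 1\<close> quaternion coordinates enter.\<close>

lemma inv_form_moment_le:
  assumes k: "1 \<le> k" "k \<le> l" and g: "g \<in> carrier_mat k 1" and r: "1 \<le> r"
    and K: "(\<integral>\<^sup>+x. inv_pow r (\<Sum>i\<in>{..<4} \<times> {0} \<times> {k-1..<l}. (x i)\<^sup>2) \<partial>gauss (idx k l)) = K"
  shows "(\<integral>\<^sup>+x. inv_form (mtx k l x) g ^ r \<partial>gauss (idx k l)) \<le> ennreal (fnorm g ^ (2 * r)) * K"
proof -
  let ?I = "idx k l"
  interpret prob_space "gauss ?I" by (rule prob_space_gauss)
  define \<gamma> where "\<gamma> = fnorm g"
  define e where "e = mat_scale \<gamma> (unit_col k 0)"
  have e: "e \<in> carrier_mat k 1" by (simp add: e_def)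
  have "\<exists>U. U \<in> carrier_mat k k \<and> quat_unitary U \<and> U\<^sup>\<dagger> * g = e"
  proof (cases "\<gamma> = 0")
    case True
    then have "g = 0\<^sub>m k 1" using g fnorm_eq_0_iff unfolding \<gamma>_def by blast
    moreover have "e = 0\<^sub>m k 1" using True by (intro eq_matI) (auto simp: e_def)
    ultimately show ?thesis by (intro exI[of _ "1\<^sub>m k"]) auto
  next
    case False
    have u: "mat_scale (1 / \<gamma>) g \<in> carrier_mat k 1" "fnorm (mat_scale (1 / \<gamma>) g) = 1"
      using g False by (auto simp: fnorm_scale \<gamma>_def)
    obtain U where U: "U \<in> carrier_mat k k" "quat_unitary U" "U * unit_col k 0 = mat_scale (1 / \<gamma>) g"
      using exists_unitary_first_col[OF u] .
    have "U * e = g"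
      using U(1) False by (simp add: e_def mult_mat_scale[of _ k k _ 1] U(3) mat_scale_scale)
    then have "U\<^sup>\<dagger> * g = e"
      using mat_assoc_cancel[of "U\<^sup>\<dagger>" k k U e 1] U(1,2) e by (auto simp: quat_unitaryD)
    then show ?thesis using U by blast
  qed
  then obtain U where U: "U \<in> carrier_mat k k" "quat_unitary U" "U\<^sup>\<dagger> * g = e" by blast
  have mf: "(\<lambda>x. inv_form (mtx k l x) a ^ r) \<in> borel_measurable (PiM ?I (\<lambda>_. borel))" if "a \<in> carrier_mat k 1" for a
    using that by (intro borel_measurable_power_ennreal measurable_inv_form[of _ k l] meas_mat_mtx_self meas_mat_const) auto
  have "(\<integral>\<^sup>+x. inv_form (mtx k l x) g ^ r \<partial>gauss ?I) = (\<integral>\<^sup>+x. inv_form (U * mtx k l x) g ^ r \<partial>gauss ?I)"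
    by (rule gauss_matrix_unitary_left[OF mf[OF g] U(2,1), symmetric])
  also have "\<dots> \<le> (\<integral>\<^sup>+x. inv_form (mtx k l x) e ^ r \<partial>gauss ?I)"
    using inv_form_unitary[OF mtx_carrier U(2,1) g] by (intro nn_integral_mono power_mono) (auto simp: U(3))
  also have "\<dots> = (\<integral>\<^sup>+y. \<integral>\<^sup>+x. inv_form (mix_rows {0} (mtx k l x) (mtx k l y)) e ^ r \<partial>gauss ?I \<partial>gauss ?I)"
    by (rule gauss_matrix_resample[OF mf[OF e]])
  also have "\<dots> \<le> (\<integral>\<^sup>+y. ennreal (\<gamma> ^ (2 * r)) * K \<partial>gauss ?I)"
  proof (rule nn_integral_mono)
    fix y
    have "0 \<le> \<gamma>" by (simp add: \<gamma>_def)
    obtain W where W: "W \<in> carrier_mat l l" "quat_unitary W"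
      and le: "\<And>X. X \<in> carrier_mat k l \<Longrightarrow> inv_form (mix_rows {0} X (mtx k l y)) e ^ r
        \<le> ennreal (\<gamma> ^ (2 * r)) * inv_pow r (\<Sum>j=k-1..<l. (norm ((X * W) $$ (0, j)))\<^sup>2)"
      unfolding e_def by (rule inv_form_first_row_le[OF k(1) mtx_carrier[of k l y] \<open>0 \<le> \<gamma>\<close> r]) blast
    have row: "(\<Sum>j=k-1..<l. (norm (mtx k l x $$ (0, j)))\<^sup>2) = (\<Sum>i\<in>{..<4} \<times> {0} \<times> {k-1..<l}. (x i)\<^sup>2)" for x
      unfolding sum_idx_rows_cols using k by (auto simp: mtx_index norm_quat_sq sum_less_4 intro!: sum.cong)
    have mr: "(\<lambda>x. inv_pow r (\<Sum>j=k-1..<l. (norm (mtx k l x $$ (0, j)))\<^sup>2)) \<in> borel_measurable (PiM ?I (\<lambda>_. borel))"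
      using meas_mat_mtx_self[of k k l] k
      by (intro measurable_compose[OF _ measurable_inv_pow] borel_measurable_sum borel_measurable_power
        borel_measurable_norm[THEN measurable_compose[rotated]]) (auto simp: meas_mat_def)
    have "(\<integral>\<^sup>+x. inv_form (mix_rows {0} (mtx k l x) (mtx k l y)) e ^ r \<partial>gauss ?I)
      \<le> (\<integral>\<^sup>+x. ennreal (\<gamma> ^ (2 * r)) * inv_pow r (\<Sum>j=k-1..<l. (norm ((mtx k l x * W) $$ (0, j)))\<^sup>2) \<partial>gauss ?I)"
      by (intro nn_integral_mono le) simp
    also have "\<dots> = (\<integral>\<^sup>+x. ennreal (\<gamma> ^ (2 * r)) * inv_pow r (\<Sum>j=k-1..<l. (norm (mtx k l x $$ (0, j)))\<^sup>2) \<partial>gauss ?I)"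
      using mr W
      by (intro gauss_matrix_unitary_right[where f = "\<lambda>X. ennreal (\<gamma> ^ (2 * r)) * inv_pow r (\<Sum>j=k-1..<l. (norm (X $$ (0, j)))\<^sup>2)"]
        borel_measurable_times_ennreal) auto
    also have "\<dots> = ennreal (\<gamma> ^ (2 * r)) * K"
      using mr unfolding K[symmetric] row[symmetric] by (intro nn_integral_cmult) simp
    finally show "(\<integral>\<^sup>+x. inv_form (mix_rows {0} (mtx k l x) (mtx k l y)) e ^ r \<partial>gauss ?I) \<le> ennreal (\<gamma> ^ (2 * r)) * K" .
  qed
  also have "\<dots> = ennreal (\<gamma> ^ (2 * r)) * K" using emeasure_space_1 by simp
  finally show ?thesis by (simp add: \<gamma>_def)
qed

text \<open>Tonelli lets the moment over the matrix be taken first, at a fixed test vector. The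
  second factor is the moment of order \<open>2 * r\<close> of the norm of a Gaussian vector with
  \<open>4 * k\<close> real coordinates.\<close>

lemma inv_form_gauss_moment_le:
  assumes k: "1 \<le> k" and kl: "l = k + p" and r: "1 \<le> r"
    and K: "(\<integral>\<^sup>+x. inv_pow r (\<Sum>i\<in>{..<4} \<times> {0} \<times> {k-1..<l}. (x i)\<^sup>2) \<partial>gauss (idx k l)) = ennreal K" "0 \<le> K"
    and kn: "k \<le> n"
  shows "(\<integral>\<^sup>+y. \<integral>\<^sup>+x. inv_form (mtx k l y) (mtx k 1 x) ^ r \<partial>gauss (idx k 1) \<partial>gauss (idx n l))
    \<le> ennreal (K * (2 ^ r * pochhammer (2 * real k) r))"
    and "(\<lambda>y. \<integral>\<^sup>+x. inv_form (mtx k l y) (mtx k 1 x) ^ r \<partial>gauss (idx k 1)) \<in> borel_measurable (gauss (idx n l))"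
proof -
  interpret A: prob_space "gauss (idx n l)" by (rule prob_space_gauss)
  interpret B: prob_space "gauss (idx k 1)" by (rule prob_space_gauss)
  interpret BA: pair_sigma_finite "gauss (idx k 1)" "gauss (idx n l)" by standard
  have m: "(\<lambda>w. inv_form (mtx k l (f w)) (mtx k 1 (g w)) ^ r) \<in> borel_measurable N"
    if "f \<in> N \<rightarrow>\<^sub>M PiM (idx n l) (\<lambda>_. borel)" "g \<in> N \<rightarrow>\<^sub>M PiM (idx k 1) (\<lambda>_. borel)" for f g and N :: "'b measure"
    using that kn by (intro borel_measurable_power_ennreal measurable_inv_form[of _ k l] meas_mat_mtx) auto
  have m1: "(\<lambda>w. inv_form (mtx k l (fst w)) (mtx k 1 (snd w)) ^ r) \<in> borel_measurable (gauss (idx n l) \<Otimes>\<^sub>M gauss (idx k 1))"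
    by (rule m) measurable
  then show "(\<lambda>y. \<integral>\<^sup>+x. inv_form (mtx k l y) (mtx k 1 x) ^ r \<partial>gauss (idx k 1)) \<in> borel_measurable (gauss (idx n l))"
    by (intro B.borel_measurable_nn_integral) (simp add: case_prod_beta)
  have m2: "(\<lambda>w. inv_form (mtx k l (snd w)) (mtx k 1 (fst w)) ^ r) \<in> borel_measurable (gauss (idx k 1) \<Otimes>\<^sub>M gauss (idx n l))"
    by (rule m) measurable
  have "(\<integral>\<^sup>+y. \<integral>\<^sup>+x. inv_form (mtx k l y) (mtx k 1 x) ^ r \<partial>gauss (idx k 1) \<partial>gauss (idx n l))
    = (\<integral>\<^sup>+x. \<integral>\<^sup>+y. inv_form (mtx k l y) (mtx k 1 x) ^ r \<partial>gauss (idx n l) \<partial>gauss (idx k 1))"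
    using m2 by (intro BA.Fubini') (simp add: case_prod_beta)
  also have "\<dots> = (\<integral>\<^sup>+x. \<integral>\<^sup>+y. inv_form (mtx k l y) (mtx k 1 x) ^ r \<partial>gauss (idx k l) \<partial>gauss (idx k 1))"
    by (intro nn_integral_cong gauss_matrix_marginal[where f = "\<lambda>Y. inv_form Y (mtx k 1 _) ^ r"] kn
      borel_measurable_power_ennreal measurable_inv_form[of _ k l] meas_mat_mtx_self meas_mat_const) auto
  also have "\<dots> \<le> (\<integral>\<^sup>+x. ennreal (fnorm (mtx k 1 x) ^ (2 * r)) * ennreal K \<partial>gauss (idx k 1))"
    using kl by (intro nn_integral_mono inv_form_moment_le k r K) auto
  also have "\<dots> = (\<integral>\<^sup>+x. ennreal (fnorm (mtx k 1 x) ^ (2 * r)) \<partial>gauss (idx k 1)) * ennreal K"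
  proof (rule nn_integral_multc)
    have "(\<lambda>x. fnorm (mtx k 1 x)) \<in> borel_measurable (PiM (idx k 1) (\<lambda>_. borel))"
      by (intro measurable_fnorm[of _ k 1] meas_mat_mtx_self) auto
    then show "(\<lambda>x. ennreal (fnorm (mtx k 1 x) ^ (2 * r))) \<in> borel_measurable (gauss (idx k 1))" by simp
  qed
  also have "\<dots> = ennreal (2 ^ r * pochhammer (2 * real k) r) * ennreal K"
    unfolding gauss_matrix_even_moment by simp
  also have "\<dots> = ennreal (K * (2 ^ r * pochhammer (2 * real k) r))"
    using K(2) k by (simp add: pochhammer_nonneg mult.commute flip: ennreal_mult)
  finally show "(\<integral>\<^sup>+y. \<integral>\<^sup>+x. inv_form (mtx k l y) (mtx k 1 x) ^ r \<partial>gauss (idx k 1) \<partial>gauss (idx n l))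
    \<le> ennreal (K * (2 ^ r * pochhammer (2 * real k) r))" .
qed

subsection \<open>The expected error\<close>

text \<open>The factor 4 counts the real components of a quaternion entry.\<close>

lemma gauss_diag_second_moment:
  "(\<integral>\<^sup>+x. ennreal ((fnorm (quat_diag n n \<tau> * mtx n 1 x))\<^sup>2) \<partial>gauss (idx n 1)) = ennreal (4 * (\<Sum>i<n. (\<tau> (Suc i))\<^sup>2))"
proof -
  let ?I = "idx n 1"
  have one: "(\<integral>\<^sup>+x. ennreal ((x k)\<^sup>2) \<partial>gauss ?I) = 1" if "k \<in> ?I" for k
    using nn_integral_gauss_component[OF finite_idx that, of "\<lambda>x. ennreal (x\<^sup>2)"] std_normal_even_moment[of 1] by simp
  have m: "(\<lambda>x. ennreal (a * (x k)\<^sup>2)) \<in> borel_measurable (gauss ?I)" if "k \<in> ?I" for k a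
    using that by measurable
  have "(\<integral>\<^sup>+x. ennreal ((fnorm (quat_diag n n \<tau> * mtx n 1 x))\<^sup>2) \<partial>gauss ?I)
    = (\<integral>\<^sup>+x. (\<Sum>i<n. \<Sum>c<4. ennreal ((\<tau> (Suc i))\<^sup>2 * (x (c, i, 0))\<^sup>2)) \<partial>gauss ?I)"
    unfolding fnorm_quat_diag_mult[OF mtx_carrier] min.idem
    by (intro nn_integral_cong) (simp add: mtx_index norm_quat_sq sum_less_4 distrib_left sum_nonneg flip: ennreal_plus)
  also have "\<dots> = (\<Sum>i<n. \<Sum>c<4. \<integral>\<^sup>+x. ennreal ((\<tau> (Suc i))\<^sup>2 * (x (c, i, 0))\<^sup>2) \<partial>gauss ?I)"
    by (subst nn_integral_sum, intro borel_measurable_sum m, force simp: idx_def,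
      intro sum.cong refl nn_integral_sum m) (auto simp: idx_def)
  also have "\<dots> = (\<Sum>i<n. \<Sum>c<(4::nat). ennreal ((\<tau> (Suc i))\<^sup>2))"
  proof (intro sum.cong refl)
    fix i c :: nat assume "i \<in> {..<n}" "c \<in> {..<4}"
    then have k: "(c, i, 0) \<in> ?I" by (simp add: idx_def)
    have "(\<integral>\<^sup>+x. ennreal ((\<tau> (Suc i))\<^sup>2 * (x (c, i, 0))\<^sup>2) \<partial>gauss ?I)
      = ennreal ((\<tau> (Suc i))\<^sup>2) * (\<integral>\<^sup>+x. ennreal ((x (c, i, 0))\<^sup>2) \<partial>gauss ?I)"
      using m[OF k, of 1] by (subst nn_integral_cmult[symmetric]) (auto simp: ennreal_mult')
    then show "(\<integral>\<^sup>+x. ennreal ((\<tau> (Suc i))\<^sup>2 * (x (c, i, 0))\<^sup>2) \<partial>gauss ?I) = ennreal ((\<tau> (Suc i))\<^sup>2)"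
      unfolding one[OF k] by simp
  qed
  also have "\<dots> = ennreal (4 * (\<Sum>i<n. (\<tau> (Suc i))\<^sup>2))"
    by (simp add: sum_distrib_left ennreal_mult' flip: sum_ennreal)
  finally show ?thesis .
qed

text \<open>A single term of the exponential series; this is where \<open>exp 1\<close> in the final
  constant comes from.\<close>

lemma power_self_le_exp_fact: "real n ^ n \<le> exp (real n) * fact n"
proof -
  have "real n ^ n /\<^sub>R fact n \<le> exp (real n)"
    using sum_le_suminf[OF summable_exp_generic[of "real n"], of "{n}"] by (simp add: exp_def)
  then show ?thesis by (simp add: field_simps)
qed

text \<open>The left side bounds the moment of order \<open>2 * (2 * p + 1)\<close> of the norm of
  the pseudoinverse: inverse chi-square moment times the moment of the test vector, over that of one
  normal variable. With \<open>r = 2 * p + 1\<close> it collapses to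
  \<open>2 ^ r * pochhammer (2 * k) r / fact (2 * r)\<close>, where each factor of the rising
  factorial is at most \<open>2 * k + 2 * p\<close>.\<close>

lemma pinv_moment_constant_le:
  assumes "1 \<le> k"
  shows "1 / (2 ^ (2 * p + 1) * fact (2 * p + 1)) * (2 ^ (2 * p + 1) * pochhammer (2 * real k) (2 * p + 1))
      / (2 ^ (2 * p + 1) * pochhammer (1 / 2) (2 * p + 1))
    \<le> (exp 1 * sqrt (4 * real k + 4 * real p + 2) / (2 * real p + 2)) ^ (2 * (2 * p + 1))"
proof -
  define r where "r = 2 * p + 1"
  have r: "real r = 2 * real p + 1" by (simp add: r_def)
  have poch: "pochhammer (2 * real k) r \<le> (2 * real k + 2 * real p) ^ r"
  proof -
    have "pochhammer (2 * real k) r = (\<Prod>i<r. 2 * real k + real i)"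
      by (simp add: pochhammer_prod atLeast0LessThan)
    also have "\<dots> \<le> (\<Prod>i<r. 2 * real k + 2 * real p)"
      using r by (intro prod_mono) auto
    finally show ?thesis by simp
  qed
  have "(fact (2 * r) :: real) = 2 ^ (2 * r) * pochhammer (1 / 2) r * fact r" by (rule fact_double)
  then have "1 / (2 ^ r * fact r) * (2 ^ r * pochhammer (2 * real k) r) / (2 ^ r * pochhammer (1 / 2) r)
      = pochhammer (2 * real k) r * 2 ^ r / fact (2 * r)"
  proof -
    have "(2::real) ^ (2 * r) = 2 ^ r * 2 ^ r" by (simp add: mult_2 power_add)
    moreover have "0 < (pochhammer (1 / 2) r :: real)" by (rule pochhammer_pos) simp
    ultimately show ?thesis
      using \<open>fact (2 * r) = 2 ^ (2 * r) * pochhammer (1 / 2) r * fact r\<close> by (simp add: field_simps)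
  qed
  also have "\<dots> \<le> (2 * real k + 2 * real p) ^ r * 2 ^ r / fact (2 * r)"
    using poch by (intro divide_right_mono mult_right_mono) auto
  also have "\<dots> = (4 * real k + 4 * real p) ^ r / fact (2 * r)"
    by (simp add: algebra_simps flip: power_mult_distrib)
  also have "\<dots> \<le> (4 * real k + 4 * real p + 2) ^ r * (exp (real (2 * r)) / real (2 * r) ^ (2 * r))"
  proof -
    have "1 / fact (2 * r) \<le> exp (real (2 * r)) / real (2 * r) ^ (2 * r)"
    proof -
      have "1 / f \<le> e / a" if "a \<le> e * f" "0 < a" "0 < f" for a e f :: real
        using that by (simp add: field_simps)
      from this[OF power_self_le_exp_fact[of "2 * r"]] show ?thesis using r by simp
    qed
    moreover have "(4 * real k + 4 * real p) ^ r \<le> (4 * real k + 4 * real p + 2) ^ r" by (intro power_mono) auto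
    ultimately have "(4 * real k + 4 * real p) ^ r * (1 / fact (2 * r)) \<le> (4 * real k + 4 * real p + 2) ^ r * (exp (real (2 * r)) / real (2 * r) ^ (2 * r))"
      by (intro mult_mono) auto
    then show ?thesis by simp
  qed
  \<comment> \<open>Here \<open>2 * r = 4 * p + 2\<close> is weakened to \<open>2 * p + 2\<close>,
    the denominator of the claimed constant.\<close>
  also have "\<dots> \<le> (4 * real k + 4 * real p + 2) ^ r * (exp (real (2 * r)) / (2 * real p + 2) ^ (2 * r))"
    using r by (intro mult_left_mono divide_left_mono power_mono) auto
  also have "\<dots> = (exp 1 * sqrt (4 * real k + 4 * real p + 2) / (2 * real p + 2)) ^ (2 * r)"
  proof -
    have "exp (real (2 * r)) = exp 1 ^ (2 * r)" by (simp flip: exp_of_nat_mult)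
    moreover have "sqrt (4 * real k + 4 * real p + 2) ^ (2 * r) = (4 * real k + 4 * real p + 2) ^ r"
      by (simp add: power_mult)
    ultimately show ?thesis by (simp add: power_mult_distrib power_divide)
  qed
  finally show ?thesis by (simp only: r_def)
qed

text \<open>Young's inequality, with equality at \<open>t = R\<close>. Being affine in
  \<open>t ^ N\<close> it can be integrated, and if the mean of \<open>t ^ N\<close> is at most
  \<open>R ^ N\<close> the result is at most \<open>R\<close>: a root of a moment without roots of
  integrals.\<close>

lemma young_power:
  fixes t R :: real
  assumes "0 \<le> t" "0 < R" "1 \<le> N"
  shows "t \<le> (real N - 1) / real N * R + 1 / (real N * R ^ (N - 1)) * t ^ N"
proof -
  have "real N * R ^ (N - 1) * t \<le> (real N - 1) * R ^ N + t ^ N"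
    using power_ge_tangent[of t R N] assms by (cases N) (auto simp: algebra_simps)
  also have "(real N - 1) * R ^ N = real N * R ^ (N - 1) * ((real N - 1) / real N * R)"
    using assms by (cases N) (auto simp: field_simps)
  also have "\<dots> + t ^ N = real N * R ^ (N - 1) * ((real N - 1) / real N * R + 1 / (real N * R ^ (N - 1)) * t ^ N)"
    using assms by (simp add: distrib_left)
  finally show ?thesis using assms by (subst (asm) mult_le_cancel_left_pos) auto
qed

text \<open>The guard is a measurable form of the full row rank condition, since \<open>inv_form X g = \<infinity>\<close> as soon as \<open>g\<close> is not
  in the range of \<open>X X\<^sup>*\<close>.\<close>

definition guarded_tail_ratio :: "quat mat \<Rightarrow> nat \<Rightarrow> quat mat \<Rightarrow> ennreal" where
  "guarded_tail_ratio S k Y =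
     (if \<forall>i<k. inv_form (top_rows k Y) (unit_col k i) < \<top> then tail_ratio S k Y else 0)"

lemma measurable_guarded_tail_ratio:
  assumes S: "S \<in> carrier_mat a n" and F: "meas_mat N n l F" and k: "k \<le> n"
  shows "(\<lambda>w. guarded_tail_ratio S k (F w)) \<in> borel_measurable N"
proof -
  have [measurable]: "(\<lambda>w. inv_form (top_rows k (F w)) (unit_col k i)) \<in> borel_measurable N" for i
    by (rule measurable_inv_form[OF meas_mat_top_rows[OF F k] meas_mat_const]) simp
  have [measurable]: "(\<lambda>w. tail_ratio S k (F w)) \<in> borel_measurable N"
    by (rule measurable_tail_ratio[OF S F k])
  show ?thesis unfolding guarded_tail_ratio_def by measurable
qed

text \<open>Conditionally on the first \<open>k\<close> rows the bound contains the norm of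
  \<open>T\<close> and the root of its second moment. Young's inequality at \<open>R2\<close> and
  \<open>R1\<close> makes it affine in moments of \<open>inv_form\<close>, which can then be
  integrated over these rows.\<close>

lemma tail_ratio_conditional_expectation_le:
  assumes k: "1 \<le> k" "k \<le> n" and l: "0 < l" and Y: "Y \<in> carrier_mat n l" and X: "X = top_rows k Y"
    and fin: "\<And>i. i < k \<Longrightarrow> inv_form X (unit_col k i) < \<top>"
    and S: "S = quat_diag n n \<tau>" and \<tau>0: "\<And>i. i \<le> k \<Longrightarrow> \<tau> i = 0"
    and s: "0 < s" "\<And>i. 1 \<le> i \<Longrightarrow> i \<le> n \<Longrightarrow> 0 \<le> \<tau> i \<and> \<tau> i \<le> s"
    and F: "0 < F" "F\<^sup>2 = (\<Sum>i<n. (\<tau> (Suc i))\<^sup>2)" and r: "1 \<le> r" and R: "0 < R1" "0 < R2"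
  shows "(\<integral>\<^sup>+x. tail_ratio S k (mix_rows (- {..<k}) (mtx n l x) Y) \<partial>gauss (idx n l))
    \<le> ennreal (3 * F) * (ennreal ((real (2 * r) - 1) / real (2 * r) * R2)
        + ennreal (1 / (real (2 * r) * R2 ^ (2 * r - 1)) / (2 ^ r * pochhammer (1 / 2) r))
            * (\<integral>\<^sup>+x. inv_form X (mtx k 1 x) ^ r \<partial>gauss (idx k 1)))
      + ennreal (3 / 2 * s) * (ennreal (1 / 2 * R1) + ennreal (1 / (2 * R1)) * (\<integral>\<^sup>+x. inv_form X (mtx k 1 x) ^ 1 \<partial>gauss (idx k 1)))"
proof -
  interpret gv: prob_space "gauss (idx k 1)" by (rule prob_space_gauss)
  have Xc: "X \<in> carrier_mat k l" using Y by (simp add: X)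
  have "full_row_rank X" by (rule full_row_rank_if_inv_form_finite[OF Xc fin])
  then obtain Z where Z: "Z \<in> carrier_mat k k" "X * (X\<^sup>\<dagger> * Z) = 1\<^sub>m k" "Z * (X * X\<^sup>\<dagger>) = 1\<^sub>m k"
    using full_row_rank_gram_inverse[OF Xc] by blast
  define T where "T = X\<^sup>\<dagger> * Z"
  have T: "T \<in> carrier_mat l k" using Xc Z by (auto simp: T_def)
  define t where "t = quat_spectral_norm T"
  have k0: "0 < k" using k by simp
  have tv: "fnorm (T * v) \<le> t * fnorm v" if "v \<in> carrier_mat k 1" for v
    unfolding t_def by (rule spectral_norm_bound[OF T l k0 that])
  have form: "inv_form X (mtx k 1 x) = ennreal ((fnorm (T * mtx k 1 x))\<^sup>2)" for x
    unfolding T_def by (rule inv_form_full_rank[OF Xc Z(1,2) mtx_carrier])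
  have t0: "0 \<le> t" using order.trans[OF fnorm_nonneg tv[of "unit_col k 0"]] k0 by simp
  \<comment> \<open>A matrix with a left inverse \<open>X\<close> is nonzero; positivity is needed
    since the optimal tilt divides by \<open>t\<close>.\<close>
  have tpos: "0 < t"
  proof -
    have "t \<noteq> 0"
    proof
      assume "t = 0"
      then have "fnorm (T * unit_col k 0) = 0" using tv[of "unit_col k 0"] fnorm_nonneg[of "T * unit_col k 0"] by simp
      moreover have "T * unit_col k 0 \<in> carrier_mat l 1" using T by auto
      ultimately have "T * unit_col k 0 = 0\<^sub>m l 1" using fnorm_eq_0_iff by blast
      moreover have "X * (T * unit_col k 0) = unit_col k 0"
        using mat_assoc_cancel[OF Xc T _ unit_col_carrier(1)[of k 0]] Z(2) by (simp add: T_def)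
      ultimately have "unit_col k 0 = 0\<^sub>m k 1" using Xc by simp
      then show False using fnorm_unit_col[OF k0] by (simp add: fnorm_def)
    qed
    then show ?thesis using t0 by simp
  qed
  have mT: "(\<lambda>x. fnorm (T * mtx k 1 x)) \<in> borel_measurable (PiM (idx k 1) (\<lambda>_. borel))"
    using T by (intro measurable_fnorm[of _ l 1] meas_mat_mult[of _ l k _ 1] meas_mat_const meas_mat_mtx_self) auto
  \<comment> \<open>Only finiteness is wanted here, so that the second moment has a real
    root.\<close>
  have "(\<integral>\<^sup>+x. ennreal ((fnorm (T * mtx k 1 x))\<^sup>2) \<partial>gauss (idx k 1))
    \<le> (\<integral>\<^sup>+x. ennreal (t\<^sup>2) * ennreal (fnorm (mtx k 1 x) ^ (2 * 1)) \<partial>gauss (idx k 1))"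
  proof (rule nn_integral_mono)
    fix x
    have "(fnorm (T * mtx k 1 x))\<^sup>2 \<le> (t * fnorm (mtx k 1 x))\<^sup>2" using tv[of "mtx k 1 x"] by (intro power_mono) auto
    then show "ennreal ((fnorm (T * mtx k 1 x))\<^sup>2) \<le> ennreal (t\<^sup>2) * ennreal (fnorm (mtx k 1 x) ^ (2 * 1))"
      by (simp add: power_mult_distrib ennreal_leI flip: ennreal_mult)
  qed
  also have "\<dots> = ennreal (t\<^sup>2) * (\<integral>\<^sup>+x. ennreal (fnorm (mtx k 1 x) ^ (2 * 1)) \<partial>gauss (idx k 1))"
  proof (rule nn_integral_cmult)
    have "(\<lambda>x. fnorm (mtx k 1 x)) \<in> borel_measurable (PiM (idx k 1) (\<lambda>_. borel))"
      by (intro measurable_fnorm[of _ k 1] meas_mat_mtx_self) auto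
    then show "(\<lambda>x. ennreal (fnorm (mtx k 1 x) ^ (2 * 1))) \<in> borel_measurable (gauss (idx k 1))" by simp
  qed
  also have "\<dots> < \<top>" unfolding gauss_matrix_even_moment by (simp add: ennreal_mult_less_top)
  finally obtain m where m: "0 \<le> m" "(\<integral>\<^sup>+x. ennreal ((fnorm (T * mtx k 1 x))\<^sup>2) \<partial>gauss (idx k 1)) = ennreal m"
    by (cases "\<integral>\<^sup>+x. ennreal ((fnorm (T * mtx k 1 x))\<^sup>2) \<partial>gauss (idx k 1)") auto
  define \<theta> where "\<theta> = sqrt m"
  have \<theta>m: "(\<integral>\<^sup>+x. ennreal ((fnorm (T * mtx k 1 x))\<^sup>2) \<partial>gauss (idx k 1)) = ennreal (\<theta>\<^sup>2)"
    using m by (simp add: \<theta>_def)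
  \<comment> \<open>The case \<open>r = 1\<close> of the operator norm test, where the normal moment
    is 1; it makes \<theta> positive.\<close>
  have "ennreal (t\<^sup>2) \<le> ennreal m"
    using operator_norm_moment_le[OF T l k0 order_refl t_def] m by simp
  then have "t\<^sup>2 \<le> m" using m by (simp add: ennreal_le_iff)
  then have \<theta>: "0 < \<theta>" using tpos by (simp add: \<theta>_def less_le_trans[OF zero_less_power[OF tpos]])
  have Sc: "S \<in> carrier_mat n n" by (simp add: S)
  have main: "(\<integral>\<^sup>+x. tail_ratio S k (mix_rows (- {..<k}) (mtx n l x) Y) \<partial>gauss (idx n l)) \<le> ennreal (3 / 2 * (t * (2 * F) + s * \<theta>))"
  proof (rule tail_ratio_expectation[OF Sc _ _ k Y X Z(1,3) T_def])
    show "S\<^sup>\<dagger> = S" by (simp add: S quat_diag_adjoint)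
    show "(S * u) $$ (i, 0) = 0" if "u \<in> carrier_mat n 1" "i < k" for u i
      using that k \<tau>0[of "Suc i"] by (simp add: S quat_diag_mult_index[of _ n 1] del: index_mult_mat(1))
    show "fnorm (S * u) \<le> s * fnorm u" if u: "u \<in> carrier_mat n 1" for u
    proof (rule power2_le_imp_le)
      have "(fnorm (S * u))\<^sup>2 \<le> (\<Sum>i<n. s\<^sup>2 * (norm (u $$ (i, 0)))\<^sup>2)"
        unfolding S fnorm_quat_diag_mult[OF u] min.idem
        using s(2) by (intro sum_mono mult_right_mono power_mono) auto
      then show "(fnorm (S * u))\<^sup>2 \<le> (s * fnorm u)\<^sup>2"
        using fnorm_sq_col[OF u] by (simp add: power_mult_distrib sum_distrib_left)
    qed (use s in simp)
    show "(\<integral>\<^sup>+x. ennreal ((fnorm (S * mtx n 1 x))\<^sup>2) \<partial>gauss (idx n 1)) = ennreal ((2 * F)\<^sup>2)"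
      unfolding S gauss_diag_second_moment by (simp add: power_mult_distrib F(2))
  qed (use s tpos tv F \<theta> \<theta>m in auto)
  have poch: "0 < (2 ^ r * pochhammer (1 / 2) r :: real)" by (simp add: pochhammer_pos)
  have split: "ennreal x \<le> ennreal a + ennreal b * ennreal c" if "x \<le> a + b * c" "0 \<le> a" "0 \<le> b" "0 \<le> c" for x a b c
    using that by (simp add: ennreal_leI flip: ennreal_mult ennreal_plus)
  have t_le: "ennreal t \<le> ennreal ((real (2 * r) - 1) / real (2 * r) * R2)
        + ennreal (1 / (real (2 * r) * R2 ^ (2 * r - 1)) / (2 ^ r * pochhammer (1 / 2) r))
            * (\<integral>\<^sup>+x. inv_form X (mtx k 1 x) ^ r \<partial>gauss (idx k 1))"
  proof -
    have "t \<le> (real (2 * r) - 1) / real (2 * r) * R2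
        + 1 / (real (2 * r) * R2 ^ (2 * r - 1)) / (2 ^ r * pochhammer (1 / 2) r) * (t ^ (2 * r) * (2 ^ r * pochhammer (1 / 2) r))"
      using young_power[of t R2 "2 * r"] tpos R r pochhammer_pos[of "1 / 2 :: real" r] by simp
    then have le: "ennreal t \<le> ennreal ((real (2 * r) - 1) / real (2 * r) * R2)
        + ennreal (1 / (real (2 * r) * R2 ^ (2 * r - 1)) / (2 ^ r * pochhammer (1 / 2) r)) * ennreal (t ^ (2 * r) * (2 ^ r * pochhammer (1 / 2) r))"
    proof (rule split)
      show "0 \<le> (real (2 * r) - 1) / real (2 * r) * R2" using R r by simp
      show "0 \<le> 1 / (real (2 * r) * R2 ^ (2 * r - 1)) / (2 ^ r * pochhammer (1 / 2) r)"
        using R poch by (intro divide_nonneg_nonneg) auto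
      show "0 \<le> t ^ (2 * r) * (2 ^ r * pochhammer (1 / 2) r)" by (intro mult_nonneg_nonneg[OF _ less_imp_le[OF poch]]) (use t0 in simp)
    qed
    have "ennreal (t ^ (2 * r) * (2 ^ r * pochhammer (1 / 2) r)) \<le> (\<integral>\<^sup>+x. inv_form X (mtx k 1 x) ^ r \<partial>gauss (idx k 1))"
      using operator_norm_moment_le[OF T l k0 r t_def] unfolding form by (simp add: ennreal_power power_mult)
    from order.trans[OF le add_left_mono[OF mult_left_mono[OF this]]] show ?thesis by simp
  qed
  have \<theta>_le: "ennreal \<theta> \<le> ennreal (1 / 2 * R1) + ennreal (1 / (2 * R1)) * (\<integral>\<^sup>+x. inv_form X (mtx k 1 x) ^ 1 \<partial>gauss (idx k 1))"
  proof -
    have "\<theta> \<le> 1 / 2 * R1 + 1 / (2 * R1) * \<theta>\<^sup>2"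
      using young_power[of \<theta> R1 2] \<theta> R by simp
    then have "ennreal \<theta> \<le> ennreal (1 / 2 * R1 + 1 / (2 * R1) * \<theta>\<^sup>2)" by (rule ennreal_leI)
    also have "\<dots> = ennreal (1 / 2 * R1) + ennreal (1 / (2 * R1)) * ennreal (\<theta>\<^sup>2)"
      using R by (simp add: ennreal_plus ennreal_mult' flip: ennreal_mult)
    finally show ?thesis unfolding form power_one_right \<theta>m .
  qed
  have "ennreal (3 / 2 * (t * (2 * F) + s * \<theta>)) = ennreal (3 * F * t + 3 / 2 * s * \<theta>)"
    by (rule arg_cong[where f = ennreal]) (simp add: field_simps)
  also have "\<dots> = ennreal (3 * F * t) + ennreal (3 / 2 * s * \<theta>)"
    using F(1) s(1) t0 \<theta> by (intro ennreal_plus) auto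
  also have "\<dots> = ennreal (3 * F) * ennreal t + ennreal (3 / 2 * s) * ennreal \<theta>"
    using F(1) s(1) t0 \<theta> by (intro arg_cong2[where f = "(+)"] ennreal_mult) auto
  finally have "ennreal (3 / 2 * (t * (2 * F) + s * \<theta>)) = ennreal (3 * F) * ennreal t + ennreal (3 / 2 * s) * ennreal \<theta>" .
  with main show ?thesis
    using add_mono[OF mult_left_mono[OF t_le, of "ennreal (3 * F)"] mult_left_mono[OF \<theta>_le, of "ennreal (3 / 2 * s)"]]
    by (auto intro: order.trans)
qed

lemma guarded_tail_ratio_expectation_le:
  assumes k: "1 \<le> k" "k < n" and kl: "l = k + p"
    and S: "S = quat_diag n n \<tau>" and \<tau>0: "\<And>i. i \<le> k \<Longrightarrow> \<tau> i = 0"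
    and s: "\<And>i. 1 \<le> i \<Longrightarrow> i \<le> n \<Longrightarrow> 0 \<le> \<tau> i \<and> \<tau> i \<le> s" "s \<le> \<tau> (k + 1)"
  shows "(\<integral>\<^sup>+x. guarded_tail_ratio S k (mtx n l x) \<partial>gauss (idx n l))
    \<le> ennreal (3 * sqrt (real k / (4 * real p + 2)) * s
      + 3 * exp 1 * sqrt (4 * real k + 4 * real p + 2) / (2 * real p + 2) * sqrt (\<Sum>i<n. (\<tau> (Suc i))\<^sup>2))"
proof -
  define F where "F = sqrt (\<Sum>i<n. (\<tau> (Suc i))\<^sup>2)"
  define r where "r = 2 * p + 1"
  \<comment> \<open>\<open>R1\<close> and \<open>R2\<close> are roots of the moment bounds of order
    2 and \<open>2 * r\<close>. As base points of Young's inequality they reproduce themselves after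
    integration.\<close>
  define R1 where "R1 = 2 * sqrt (real k / (4 * real p + 2))"
  define R2 where "R2 = exp 1 * sqrt (4 * real k + 4 * real p + 2) / (2 * real p + 2)"
  have kn: "k \<le> n" and l: "0 < l" using k kl by auto
  have s0: "0 \<le> s" using s(1)[of n] k by auto
  have r1: "1 \<le> r" by (simp add: r_def)
  have R: "0 < R1" "0 < R2" using k by (auto simp: R1_def R2_def)
  have F0: "0 \<le> F" by (simp add: F_def sum_nonneg)
  have Fsq: "F\<^sup>2 = (\<Sum>i<n. (\<tau> (Suc i))\<^sup>2)" by (simp add: F_def sum_nonneg)
  have Sc: "S \<in> carrier_mat n n" by (simp add: S)
  show ?thesis
  proof (cases "s = 0")
    \<comment> \<open>The tilt needs positive \<open>s\<close> and \<open>F\<close>; a vanishing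
      tail is handled separately, where \<open>S\<close> is 0.\<close>
    case True
    have "\<tau> i = 0" if "1 \<le> i" "i \<le> n" for i using s(1)[OF that] True by auto
    then have "S = 0\<^sub>m n n" by (intro eq_matI) (auto simp: S quat_diag_def quat_of_real_def zero_quat_def)
    then have "tail_ratio S k (mtx n l x) = 0" for x
    proof -
      have "S * (mtx n l x * ((top_rows k (mtx n l x))\<^sup>\<dagger> * col_of k \<zeta>)) = 0\<^sub>m n 1" for \<zeta>
        using \<open>S = 0\<^sub>m n n\<close> by (simp add: left_mult_zero_mat[of _ n 1] mult_carrier_mat[of _ n l _ 1]
          mult_carrier_mat[of _ l k _ 1] top_rows_carrier[OF mtx_carrier, of k n l x]
          carrier_matD(2)[OF col_of_carrier(1)])
      moreover have "fnorm (0\<^sub>m n 1) = 0" by (simp add: fnorm_def)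
      ultimately have z: "ennreal (fnorm (S * (mtx n l x * ((top_rows k (mtx n l x))\<^sup>\<dagger> * col_of k \<zeta>)))
        / fnorm (top_rows k (mtx n l x) * ((top_rows k (mtx n l x))\<^sup>\<dagger> * col_of k \<zeta>))) = 0" for \<zeta>
        by (simp only: div_0 ennreal_0)
      have "tail_ratio S k (mtx n l x) \<le> 0" unfolding tail_ratio_def z by (rule SUP_least) simp
      then show ?thesis by simp
    qed
    then have "guarded_tail_ratio S k (mtx n l x) = 0" for x by (simp add: guarded_tail_ratio_def)
    then show ?thesis by simp
  next
    case False
    then have spos: "0 < s" using s0 by simp
    \<comment> \<open>The assumption \<open>s \<le> \<tau> (k + 1)\<close> enters here: an entry of
      \<open>S\<close> has size at least \<open>s\<close>, so \<open>F\<close> is positive.\<close>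
    have "(\<tau> (Suc k))\<^sup>2 \<le> F\<^sup>2" unfolding Fsq using k by (intro member_le_sum) auto
    moreover have "0 < \<tau> (Suc k)" using s(2) spos by simp
    ultimately have Fpos: "0 < F"
      using F0 by (metis less_le_trans order_less_le power_zero_numeral zero_less_power not_less)
    define m where "m = (2 ^ r * pochhammer (1 / 2) r :: real)"
    have m: "0 < m" by (simp add: m_def pochhammer_pos)
    define a1 b1 a2 b2 where "a1 = (real (2 * r) - 1) / real (2 * r) * R2"
      and "b1 = 1 / (real (2 * r) * R2 ^ (2 * r - 1)) / m" and "a2 = 1 / 2 * R1" and "b2 = 1 / (2 * R1)"
    have ab: "0 \<le> a1" "0 \<le> b1" "0 \<le> a2" "0 \<le> b2"
      using R m r1 by (auto simp: a1_def b1_def a2_def b2_def)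
    \<comment> \<open>\<open>l - (k - 1) = p + 1\<close> quaternion coordinates of the first row,
      that is, \<open>4 * (p + 1)\<close> real ones.\<close>
    define J where "J = {..<4::nat} \<times> {0::nat} \<times> {k-1..<l}"
    have J: "J \<subseteq> idx k l" "card J = 4 * (p + 1)" using k kl by (auto simp: J_def idx_def)
    define \<Xi> where "\<Xi> r' y = (\<integral>\<^sup>+x. inv_form (mtx k l y) (mtx k 1 x) ^ r' \<partial>gauss (idx k 1))" for r' y
    have K1: "(\<integral>\<^sup>+x. inv_pow 1 (\<Sum>i\<in>{..<4} \<times> {0} \<times> {k-1..<l}. (x i)\<^sup>2) \<partial>gauss (idx k l)) = ennreal (1 / (4 * real p + 2))"
      using nn_integral_gauss_inverse[OF finite_idx J] by (simp add: J_def)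
    have Kr: "(\<integral>\<^sup>+x. inv_pow r (\<Sum>i\<in>{..<4} \<times> {0} \<times> {k-1..<l}. (x i)\<^sup>2) \<partial>gauss (idx k l)) = ennreal (1 / (2 ^ r * fact r))"
      using nn_integral_gauss_inv_pow_top[OF finite_idx J] by (simp only: J_def r_def)
    have X1: "(\<integral>\<^sup>+y. \<Xi> 1 y \<partial>gauss (idx n l)) \<le> ennreal (1 / (4 * real p + 2) * (2 ^ 1 * pochhammer (2 * real k) 1))"
      and m1 [measurable]: "\<Xi> 1 \<in> borel_measurable (gauss (idx n l))"
      unfolding \<Xi>_def using inv_form_gauss_moment_le[OF k(1) kl order_refl K1 _ kn] by auto
    have Xr: "(\<integral>\<^sup>+y. \<Xi> r y \<partial>gauss (idx n l)) \<le> ennreal (1 / (2 ^ r * fact r) * (2 ^ r * pochhammer (2 * real k) r))"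
      and mr [measurable]: "\<Xi> r \<in> borel_measurable (gauss (idx n l))"
      unfolding \<Xi>_def using inv_form_gauss_moment_le[OF k(1) kl r1 Kr _ kn] by auto
    have mg: "(\<lambda>x. guarded_tail_ratio S k (mtx n l x)) \<in> borel_measurable (PiM (idx n l) (\<lambda>_. borel))"
      by (rule measurable_guarded_tail_ratio[OF Sc meas_mat_mtx_self[OF order_refl] kn])
    have "(\<integral>\<^sup>+x. guarded_tail_ratio S k (mtx n l x) \<partial>gauss (idx n l))
      = (\<integral>\<^sup>+y. \<integral>\<^sup>+x. guarded_tail_ratio S k (mix_rows (- {..<k}) (mtx n l x) (mtx n l y)) \<partial>gauss (idx n l) \<partial>gauss (idx n l))"
      by (rule gauss_matrix_resample[OF mg])
    also have "\<dots> \<le> (\<integral>\<^sup>+y. ennreal (3 * F) * (ennreal a1 + ennreal b1 * \<Xi> r y)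
      + ennreal (3 / 2 * s) * (ennreal a2 + ennreal b2 * \<Xi> 1 y) \<partial>gauss (idx n l))"
    proof (rule nn_integral_mono)
      fix y
      define X where "X = top_rows k (mtx n l y)"
      have Xm: "X = mtx k l y" unfolding X_def using kn by (intro eq_matI) (auto simp: top_rows_def mtx_index)
      have topX: "top_rows k (mix_rows (- {..<k}) (mtx n l x) (mtx n l y)) = X" for x
        unfolding X_def by (rule top_rows_mix_rows[OF mtx_carrier mtx_carrier kn])
      show "(\<integral>\<^sup>+x. guarded_tail_ratio S k (mix_rows (- {..<k}) (mtx n l x) (mtx n l y)) \<partial>gauss (idx n l))
        \<le> ennreal (3 * F) * (ennreal a1 + ennreal b1 * \<Xi> r y) + ennreal (3 / 2 * s) * (ennreal a2 + ennreal b2 * \<Xi> 1 y)"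
      proof (cases "\<forall>i<k. inv_form X (unit_col k i) < \<top>")
        case True
        then have g: "guarded_tail_ratio S k (mix_rows (- {..<k}) (mtx n l x) (mtx n l y))
          = tail_ratio S k (mix_rows (- {..<k}) (mtx n l x) (mtx n l y))" for x
          unfolding guarded_tail_ratio_def topX by (rule if_P)
        show ?thesis
          unfolding g \<Xi>_def a1_def b1_def a2_def b2_def m_def Xm[symmetric]
          by (rule tail_ratio_conditional_expectation_le[OF k(1) kn l mtx_carrier X_def _ S \<tau>0 spos s(1) Fpos Fsq r1 R])
            (use True in auto)
      next
        case False
        have "guarded_tail_ratio S k (mix_rows (- {..<k}) (mtx n l x) (mtx n l y)) = 0" for x
          unfolding guarded_tail_ratio_def topX by (simp only: False if_False)
        then show ?thesis by (simp only: nn_integral_const mult_zero_left zero_le)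
      qed
    qed
    also have "\<dots> = ennreal (3 * F) * (ennreal a1 + ennreal b1 * (\<integral>\<^sup>+y. \<Xi> r y \<partial>gauss (idx n l)))
      + ennreal (3 / 2 * s) * (ennreal a2 + ennreal b2 * (\<integral>\<^sup>+y. \<Xi> 1 y \<partial>gauss (idx n l)))"
    proof -
      interpret G: prob_space "gauss (idx n l)" by (rule prob_space_gauss)
      have "(\<integral>\<^sup>+y. c * (a + b * f y) + c' * (a' + b' * g y) \<partial>gauss (idx n l))
          = c * (a + b * (\<integral>\<^sup>+y. f y \<partial>gauss (idx n l))) + c' * (a' + b' * (\<integral>\<^sup>+y. g y \<partial>gauss (idx n l)))"
        if [measurable]: "f \<in> borel_measurable (gauss (idx n l))" "g \<in> borel_measurable (gauss (idx n l))"
        for f g and a b c a' b' c' :: ennreal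
        by (simp add: nn_integral_add nn_integral_cmult G.emeasure_space_1 del: space_gauss)
      from this[OF mr m1] show ?thesis .
    qed
    also have "\<dots> \<le> ennreal (3 * F) * (ennreal a1 + ennreal b1 * ennreal (m * R2 ^ (2 * r)))
      + ennreal (3 / 2 * s) * (ennreal a2 + ennreal b2 * ennreal (R1\<^sup>2))"
    proof (intro add_mono mult_left_mono order_refl)
      show "(\<integral>\<^sup>+y. \<Xi> 1 y \<partial>gauss (idx n l)) \<le> ennreal (R1\<^sup>2)"
        using X1 by (simp add: R1_def power_mult_distrib pochhammer_1)
      have "1 / (2 ^ r * fact r) * (2 ^ r * pochhammer (2 * real k) r) / m \<le> R2 ^ (2 * r)"
        using pinv_moment_constant_le[OF k(1), of p] by (simp only: r_def R2_def m_def)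
      then have "1 / (2 ^ r * fact r) * (2 ^ r * pochhammer (2 * real k) r) \<le> m * R2 ^ (2 * r)"
        using m by (simp only: pos_divide_le_eq mult.commute)
      then show "(\<integral>\<^sup>+y. \<Xi> r y \<partial>gauss (idx n l)) \<le> ennreal (m * R2 ^ (2 * r))"
        by (rule order.trans[OF Xr ennreal_leI])
    qed simp_all
    also have "\<dots> = ennreal (3 * F * (a1 + b1 * (m * R2 ^ (2 * r))) + 3 / 2 * s * (a2 + b2 * R1\<^sup>2))"
      using ab F0 s0 m R by (simp add: ennreal_plus ennreal_mult flip: ennreal_plus ennreal_mult)
    \<comment> \<open>The weights of Young's inequality recombine to 1.\<close>
    also have "a1 + b1 * (m * R2 ^ (2 * r)) = R2"
    proof -
      have "b1 * (m * R2 ^ (2 * r)) = 1 / real (2 * r) * R2"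
      proof -
        have "R2 ^ (2 * r) = R2 ^ (2 * r - 1) * R2" using r1 by (cases r) auto
        then show ?thesis using m R by (simp add: b1_def)
      qed
      then show ?thesis using r1 by (simp add: a1_def field_simps)
    qed
    also have "a2 + b2 * R1\<^sup>2 = R1" using R by (simp add: a2_def b2_def power2_eq_square)
    also have "3 * F * R2 + 3 / 2 * s * R1 = 3 * sqrt (real k / (4 * real p + 2)) * s
      + 3 * exp 1 * sqrt (4 * real k + 4 * real p + 2) / (2 * real p + 2) * F"
      by (simp add: R1_def R2_def)
    finally show ?thesis by (simp only: F_def)
  qed
qed

text \<open>The majorant \<open>H\<close> is fixed before \<open>Q\<close>, so the estimate covers
  every choice of orthonormal factor, including choices that depend on the outcome in a
  nonmeasurable way.\<close>

lemma rqsvd_error_dominated: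
  fixes M :: "'w measure"
  assumes M: "prob_space M" and nm: "n \<le> m" and B: "B \<in> carrier_mat m n" and svd: "is_qsvd B U \<sigma> V"
    and k: "1 \<le> k" and p: "1 \<le> p" and l: "l = k + p" "l \<le> n"
    and Om: "quat_test_matrix M n l \<Omega>"
  obtains H :: "'w \<Rightarrow> ennreal" where "H \<in> borel_measurable M"
    "(\<integral>\<^sup>+w. H w \<partial>M) \<le> ennreal ((1 + 3 * sqrt (real k / (4 * real p + 2))) * \<sigma> (k + 1)
      + 3 * exp 1 * sqrt (4 * real k + 4 * real p + 2) / (2 * real p + 2) * sqrt (\<Sum>j = k + 1..n. (\<sigma> j)\<^sup>2))"
    "\<And>w Q. w \<in> space M \<Longrightarrow> full_row_rank ((first_cols k V)\<^sup>\<dagger> * \<Omega> w) \<Longrightarrow> range_finder (B * \<Omega> w) Q \<Longrightarrow>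
      ennreal (quat_spectral_norm (rqsvd_approx Q B - B)) \<le> H w"
proof -
  interpret prob_space M by fact
  note D = is_qsvdD[OF svd B]
  have kn: "k < n" "k \<le> n" using l p by auto
  define s where "s = \<sigma> (k + 1)"
  have s0: "0 \<le> s" using D(6)[of "k + 1"] kn nm by (simp add: s_def)
  define \<tau> where "\<tau> i = (if i \<le> k then 0 else \<sigma> i)" for i
  define S where "S = quat_diag n n \<tau>"
  have Sc: "S \<in> carrier_mat n n" by (simp add: S_def)
  have Vd: "quat_unitary (V\<^sup>\<dagger>)" "V\<^sup>\<dagger> \<in> carrier_mat n n" using D by (auto simp: quat_unitary_adjoint)
  define c where "c = 3 * sqrt (real k / (4 * real p + 2)) * s
      + 3 * exp 1 * sqrt (4 * real k + 4 * real p + 2) / (2 * real p + 2) * sqrt (\<Sum>j = k + 1..n. (\<sigma> j)\<^sup>2)"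
  have sums: "(\<Sum>i<n. (\<tau> (Suc i))\<^sup>2) = (\<Sum>j = k + 1..n. (\<sigma> j)\<^sup>2)"
  proof -
    have "(\<Sum>i<n. (\<tau> (Suc i))\<^sup>2) = (\<Sum>j = 1..n. (\<tau> j)\<^sup>2)"
      using sum.shift_bounds_Suc_ivl[of "\<lambda>j. (\<tau> j)\<^sup>2" 0 n] by (simp add: atLeast0LessThan atLeastLessThanSuc_atLeastAtMost)
    also have "\<dots> = (\<Sum>j = k + 1..n. (\<tau> j)\<^sup>2)"
      by (intro sum.mono_neutral_right) (auto simp: \<tau>_def)
    also have "\<dots> = (\<Sum>j = k + 1..n. (\<sigma> j)\<^sup>2)" by (intro sum.cong) (auto simp: \<tau>_def)
    finally show ?thesis .
  qed
  have int: "(\<integral>\<^sup>+x. guarded_tail_ratio S k (mtx n l x) \<partial>gauss (idx n l)) \<le> ennreal c"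
    unfolding c_def sums[symmetric]
  proof (rule guarded_tail_ratio_expectation_le[OF k kn(1) l(1) S_def])
    show "0 \<le> \<tau> i \<and> \<tau> i \<le> s" if "1 \<le> i" "i \<le> n" for i
      using D(6)[of i] D(7)[of "k + 1" i] that nm s0 by (auto simp: \<tau>_def s_def)
  qed (auto simp: \<tau>_def s_def)
  have mg: "(\<lambda>x. guarded_tail_ratio S k (mtx n l x)) \<in> borel_measurable (PiM (idx n l) (\<lambda>_. borel))"
    by (rule measurable_guarded_tail_ratio[OF Sc meas_mat_mtx_self[OF order_refl] kn(2)])
  have mgV: "(\<lambda>x. guarded_tail_ratio S k (V\<^sup>\<dagger> * mtx n l x)) \<in> borel_measurable (PiM (idx n l) (\<lambda>_. borel))"
    by (rule measurable_guarded_tail_ratio[OF Sc meas_mat_mult[OF meas_mat_const[OF Vd(2)] meas_mat_mtx_self[OF order_refl]] kn(2)])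
  have nl: "0 < n" "0 < l" using kn l p by auto
  note tr = quat_test_matrix_nn_integral[OF M Om nl mgV]
  define Fh where "Fh w = guarded_tail_ratio S k (V\<^sup>\<dagger> * \<Omega> w)" for w
  have mF: "Fh \<in> borel_measurable M" using tr(2) by (simp add: Fh_def[abs_def])
  \<comment> \<open>Rotating \<Omega> by \<open>V\<^sup>\<dagger>\<close> does not change its
    law.\<close>
  have "(\<integral>\<^sup>+w. Fh w \<partial>M) \<le> ennreal c"
    unfolding Fh_def tr(1) gauss_matrix_unitary_left[OF mg Vd] by (rule int)
  then have "(\<integral>\<^sup>+w. ennreal s + Fh w \<partial>M) \<le> ennreal s + ennreal c"
    using mF emeasure_space_1 by (simp add: nn_integral_add add_left_mono)
  also have "\<dots> = ennreal (s + c)"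
    using s0 unfolding c_def
    by (intro ennreal_plus[symmetric] add_nonneg_nonneg mult_nonneg_nonneg divide_nonneg_nonneg real_sqrt_ge_zero sum_nonneg) auto
  finally have total: "(\<integral>\<^sup>+w. ennreal s + Fh w \<partial>M) \<le> ennreal (s + c)" .
  show ?thesis
  proof (rule that[of "\<lambda>w. ennreal s + Fh w"])
    show "(\<lambda>w. ennreal s + Fh w) \<in> borel_measurable M" using mF by simp
    have "s + c = (1 + 3 * sqrt (real k / (4 * real p + 2))) * \<sigma> (k + 1)
      + 3 * exp 1 * sqrt (4 * real k + 4 * real p + 2) / (2 * real p + 2) * sqrt (\<Sum>j = k + 1..n. (\<sigma> j)\<^sup>2)"
      by (simp add: c_def s_def distrib_right)
    then show "(\<integral>\<^sup>+w. ennreal s + Fh w \<partial>M) \<le> ennreal ((1 + 3 * sqrt (real k / (4 * real p + 2))) * \<sigma> (k + 1)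
      + 3 * exp 1 * sqrt (4 * real k + 4 * real p + 2) / (2 * real p + 2) * sqrt (\<Sum>j = k + 1..n. (\<sigma> j)\<^sup>2))"
      using total by simp
  next
    fix w Q assume w: "w \<in> space M" and fr: "full_row_rank ((first_cols k V)\<^sup>\<dagger> * \<Omega> w)"
      and Q: "range_finder (B * \<Omega> w) Q"
    have W: "\<Omega> w \<in> carrier_mat n l" using Om w by (auto simp: quat_test_matrix_def)
    define Y where "Y = V\<^sup>\<dagger> * \<Omega> w"
    define X where "X = top_rows k Y"
    have Y: "Y \<in> carrier_mat n l" using Vd W by (auto simp: Y_def)
    have X: "X \<in> carrier_mat k l" using Y by (simp add: X_def)
    have "top_rows k (V\<^sup>\<dagger>) = (first_cols k V)\<^sup>\<dagger>"
      using D(3) kn by (intro eq_matI) (auto simp: top_rows_def first_cols_def)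
    then have "X = (first_cols k V)\<^sup>\<dagger> * \<Omega> w"
      using top_rows_mult[OF Vd(2) W kn(2)] by (simp add: X_def Y_def)
    with fr have frX: "full_row_rank X" by simp
    obtain Z where Z: "Z \<in> carrier_mat k k" "X * (X\<^sup>\<dagger> * Z) = 1\<^sub>m k" "Z * (X * X\<^sup>\<dagger>) = 1\<^sub>m k"
      using full_row_rank_gram_inverse[OF X frX] by blast
    \<comment> \<open>Full row rank opens the guard, the form being a finite squared norm.\<close>
    have "inv_form X (unit_col k i) < \<top>" for i
      using inv_form_full_rank[OF X Z(1,2) unit_col_carrier(1)[of k i]] by simp
    then have Fw: "Fh w = tail_ratio S k Y" by (simp add: Fh_def guarded_tail_ratio_def X_def Y_def)
    show "ennreal (quat_spectral_norm (rqsvd_approx Q B - B)) \<le> ennreal s + Fh w"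
    proof (cases "tail_ratio S k Y")
      case (real f)
      have "quat_spectral_norm (rqsvd_approx Q B - B) \<le> s + f"
        unfolding s_def
      proof (rule rqsvd_error_le[OF B svd k kn(1) nm W Q Y_def X_def _ Z(2)])
        show "X\<^sup>\<dagger> * Z \<in> carrier_mat l k" using X Z by auto
        show "S = quat_diag n n (\<lambda>i. if i \<le> k then 0 else \<sigma> i)" by (simp add: S_def \<tau>_def[abs_def])
        show "fnorm (S * (Y * (X\<^sup>\<dagger> * Z * y))) \<le> f * fnorm y" if "y \<in> carrier_mat k 1" for y
          by (rule tail_ratio_ge[OF Sc Y X_def Z that real(2,1)])
      qed (rule real(1))
      then show ?thesis using real s0 by (simp add: Fw ennreal_leI flip: ennreal_plus)
    qed (simp add: Fw)
  qed
qed

text \<open>Jensen's inequality for the root, obtained by applying Young's inequality pointwise: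
  \<open>y\<close> carries no measurability assumption and is compared with an affine function of
  \<open>H\<close>.\<close>

lemma (in prob_space) nn_integral_root_le:
  assumes H: "H \<in> borel_measurable M" "(\<integral>\<^sup>+w. H w \<partial>M) \<le> ennreal R" "0 \<le> R" and N: "1 \<le> N"
    and y: "AE w in M. 0 \<le> y w \<and> ennreal (y w ^ N) \<le> H w"
  shows "(\<integral>\<^sup>+w. ennreal (y w) \<partial>M) \<le> ennreal (R powr (1 / real N))"
proof (rule ennreal_le_epsilon)
  fix e :: real assume e: "0 < e"
  \<comment> \<open>The slack \<open>e\<close> keeps \<open>c\<close> positive when \<open>R\<close>
    is 0, as Young's inequality requires.\<close>
  define c where "c = R powr (1 / real N) + e"
  have c: "0 < c" using e by (simp add: c_def add_nonneg_pos)
  have "R \<le> c ^ N"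
  proof (cases "R = 0")
    case False
    then have "R = (R powr (1 / real N)) ^ N"
      using assms(3) N by (simp add: powr_realpow[symmetric] powr_powr)
    also have "\<dots> \<le> c ^ N" using e by (intro power_mono) (auto simp: c_def)
    finally show ?thesis .
  qed (use c in simp)
  define a b where "a = (real N - 1) / real N * c" and "b = 1 / (real N * c ^ (N - 1))"
  have ab: "0 \<le> a" "0 \<le> b" using c N by (auto simp: a_def b_def)
  have "(\<integral>\<^sup>+w. ennreal (y w) \<partial>M) \<le> (\<integral>\<^sup>+w. ennreal a + ennreal b * H w \<partial>M)"
  proof (rule nn_integral_mono_AE, use y in eventually_elim)
    case (elim w)
    then have "ennreal (y w) \<le> ennreal (a + b * y w ^ N)"
      using young_power[of "y w" c N] c N by (intro ennreal_leI) (simp add: a_def b_def)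
    also have "\<dots> = ennreal a + ennreal b * ennreal (y w ^ N)"
      using ab elim by (simp add: ennreal_plus ennreal_mult flip: ennreal_mult)
    also have "\<dots> \<le> ennreal a + ennreal b * H w" using elim by (intro add_left_mono mult_left_mono) auto
    finally show ?case .
  qed
  also have "\<dots> = ennreal a + ennreal b * (\<integral>\<^sup>+w. H w \<partial>M)"
    using H(1) emeasure_space_1 by (simp add: nn_integral_add nn_integral_cmult)
  also have "\<dots> \<le> ennreal a + ennreal b * ennreal (c ^ N)"
    using H(2) \<open>R \<le> c ^ N\<close> by (intro add_left_mono mult_left_mono order.trans[OF H(2)] ennreal_leI) auto
  also have "\<dots> = ennreal (a + b * c ^ N)"
    using ab c by (simp add: ennreal_plus ennreal_mult flip: ennreal_mult)
  also have "a + b * c ^ N = c"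
  proof -
    have "c ^ N = c ^ (N - 1) * c" using N by (cases N) auto
    then have "b * c ^ N = 1 / real N * c" using c by (simp add: b_def)
    then show ?thesis using N by (simp add: a_def field_simps)
  qed
  finally show "(\<integral>\<^sup>+w. ennreal (y w) \<partial>M) \<le> ennreal (R powr (1 / real N)) + ennreal e"
    using e by (simp add: c_def ennreal_plus)
qed

theorem theorem2:
  fixes M :: "'w measure"
    and A U V :: "quat mat"
    and \<sigma> :: "nat \<Rightarrow> real"
    and m n k p l :: nat
    and \<Omega> :: "'w \<Rightarrow> quat mat"
    and Q :: "nat \<Rightarrow> 'w \<Rightarrow> quat mat"
  assumes "prob_space M"
    and "n \<le> m" and "A \<in> carrier_mat m n"
    and "is_qsvd A U \<sigma> V"
    and "1 \<le> k" and "1 \<le> p" and "l = k + p" and "l \<le> n"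
    and "quat_test_matrix M n l \<Omega>"
    and "AE w in M. full_row_rank (quat_adjoint (first_cols k V) * \<Omega> w)"
    and "\<And>q w. w \<in> space M \<Longrightarrow> range_finder (power_sample A q (\<Omega> w)) (Q q w)"
  shows "((\<integral>\<^sup>+ w. ennreal (quat_spectral_norm (rqsvd_approx (Q 0 w) A - A)) \<partial>M)
      \<le> ennreal ((1 + 3 * sqrt (real k / (4 * real p + 2))) * \<sigma> (k + 1)
          + 3 * exp 1 * sqrt (4 * real k + 4 * real p + 2) / (2 * real p + 2)
              * sqrt (\<Sum>j = k + 1..n. (\<sigma> j)\<^sup>2)))
    \<and> (\<forall>q>0. (\<integral>\<^sup>+ w. ennreal (quat_spectral_norm (rqsvd_approx (Q q w) A - A)) \<partial>M)
      \<le> ennreal (((1 + 3 * sqrt (real k / (4 * real p + 2))) * \<sigma> (k + 1) ^ (2 * q + 1)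
          + 3 * exp 1 * sqrt (4 * real k + 4 * real p + 2) / (2 * real p + 2)
              * sqrt (\<Sum>j = k + 1..n. \<sigma> j ^ (2 * (2 * q + 1))))
            powr (1 / (2 * real q + 1))))"
proof -
  interpret prob_space M by fact
  define C where "C q = (1 + 3 * sqrt (real k / (4 * real p + 2))) * \<sigma> (k + 1) ^ (2 * q + 1)
          + 3 * exp 1 * sqrt (4 * real k + 4 * real p + 2) / (2 * real p + 2)
              * sqrt (\<Sum>j = k + 1..n. \<sigma> j ^ (2 * (2 * q + 1)))" for q
  have s0: "0 \<le> \<sigma> (k + 1)"
    using is_qsvdD(6)[OF assms(4,3), of "k + 1"] assms(2,6-8) by simp
  have C0: "0 \<le> C q" for q
    using s0 unfolding C_def
    by (intro add_nonneg_nonneg mult_nonneg_nonneg divide_nonneg_nonneg real_sqrt_ge_zero sum_nonneg zero_le_even_power') auto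
  \<comment> \<open>The plain algorithm is the case \<open>q = 0\<close>, where the exponent is
    1.\<close>
  have bound: "(\<integral>\<^sup>+ w. ennreal (quat_spectral_norm (rqsvd_approx (Q q w) A - A)) \<partial>M)
    \<le> ennreal (C q powr (1 / real (2 * q + 1)))" for q
  proof -
    \<comment> \<open>A range finder for the power sample of \<open>A\<close> is one for the plain
      sample of \<open>B\<close>, and \<open>B\<close> has the same \<open>V\<close>, so the assumed
      rank condition applies to it.\<close>
    define B where "B = (A * A\<^sup>\<dagger>) ^\<^sub>m q * A"
    have AA: "A * A\<^sup>\<dagger> \<in> carrier_mat m m" using assms(3) by auto
    have B: "B \<in> carrier_mat m n" unfolding B_def by (rule mult_carrier_mat[OF pow_carrier_mat[OF AA] assms(3)])
    have svdB: "is_qsvd B U (\<lambda>i. \<sigma> i ^ (2 * q + 1)) V" unfolding B_def by (rule qsvd_power[OF assms(3,4,2)])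
    obtain H where H: "H \<in> borel_measurable M"
      "(\<integral>\<^sup>+w. H w \<partial>M) \<le> ennreal ((1 + 3 * sqrt (real k / (4 * real p + 2))) * \<sigma> (k + 1) ^ (2 * q + 1)
        + 3 * exp 1 * sqrt (4 * real k + 4 * real p + 2) / (2 * real p + 2) * sqrt (\<Sum>j = k + 1..n. (\<sigma> j ^ (2 * q + 1))\<^sup>2))"
      and dom: "\<And>w Q. w \<in> space M \<Longrightarrow> full_row_rank ((first_cols k V)\<^sup>\<dagger> * \<Omega> w) \<Longrightarrow> range_finder (B * \<Omega> w) Q \<Longrightarrow>
        ennreal (quat_spectral_norm (rqsvd_approx Q B - B)) \<le> H w"
      by (rule rqsvd_error_dominated[OF assms(1,2) B svdB assms(5-9)]) blast
    have "(\<sigma> j ^ (2 * q + 1))\<^sup>2 = \<sigma> j ^ (2 * (2 * q + 1))" for j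
      by (simp only: power_mult[symmetric] mult.commute)
    then have HC: "(\<integral>\<^sup>+w. H w \<partial>M) \<le> ennreal (C q)" using H(2) by (simp only: C_def)
    show ?thesis
    proof (rule nn_integral_root_le[OF H(1) HC C0])
      show "AE w in M. 0 \<le> quat_spectral_norm (rqsvd_approx (Q q w) A - A) \<and>
        ennreal (quat_spectral_norm (rqsvd_approx (Q q w) A - A) ^ (2 * q + 1)) \<le> H w"
        using assms(10) AE_space
      proof eventually_elim
        case (elim w)
        have rf: "range_finder (B * \<Omega> w) (Q q w)"
          using assms(11)[OF elim(2), of q] by (simp add: power_sample_def B_def)
        have W: "\<Omega> w \<in> carrier_mat n l" using assms(9) elim(2) by (auto simp: quat_test_matrix_def)
        have Qc: "Q q w \<in> carrier_mat m l" "(Q q w)\<^sup>\<dagger> * Q q w = 1\<^sub>m l"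
          using rf B W by (auto simp: range_finder_def)
        have n1: "1 \<le> n" using assms(5,7,8) by simp
        have E: "rqsvd_approx (Q q w) A - A \<in> carrier_mat m n" using assms(3) by (auto simp: rqsvd_approx_def)
        obtain x where "fnorm ((rqsvd_approx (Q q w) A - A) * x) = quat_spectral_norm (rqsvd_approx (Q q w) A - A)"
          using spectral_norm_attained[OF E] n1 assms(2) by auto
        then have "0 \<le> quat_spectral_norm (rqsvd_approx (Q q w) A - A)" using fnorm_nonneg by metis
        \<comment> \<open>The power of the error for \<open>A\<close> is at most the error for
          \<open>B\<close>, and that one is dominated by \<open>H\<close>.\<close>
        moreover have "ennreal (quat_spectral_norm (rqsvd_approx (Q q w) A - A) ^ (2 * q + 1)) \<le> H w"
          using ennreal_leI[OF rqsvd_power_error_le[OF assms(3,4) n1 assms(2) Qc B_def]] dom[OF elim(2,1) rf]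
          by (rule order.trans)
        ultimately show ?case by simp
      qed
    qed simp
  qed
  have C_0: "C 0 = (1 + 3 * sqrt (real k / (4 * real p + 2))) * \<sigma> (k + 1)
    + 3 * exp 1 * sqrt (4 * real k + 4 * real p + 2) / (2 * real p + 2) * sqrt (\<Sum>j = k + 1..n. (\<sigma> j)\<^sup>2)"
    by (simp add: C_def power2_eq_square)
  have powr_0: "C 0 powr (1 / real (2 * 0 + 1)) = C 0" using C0[of 0] by simp
  have expo: "real (2 * q + 1) = 2 * real q + 1" for q by simp
  show ?thesis
    using bound[of 0] bound unfolding powr_0 unfolding C_0 unfolding expo C_def by blast
qed

end
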